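(* There exist $t_0>0$ and $C>0$ such that for all $t>t_0$ and $n\ge1$: $$\mu\otimes\tilde{\mathbb{P}}\left(\left\{(x,\underline\omega) : \kappa(\mathcal{E}_n(x,\underline\omega),\mu)>\frac{t}{\sqrt n}\right\}\right)\le e^{-Ct^2}.$$
   Context: A Lasota-Yorke map is a piecewise $C^2$ map $T:[0,1]\to[0,1]$ (with finitely many pieces) for which $\lambda(T):=\inf|T'|>0$. A finite random Lasota-Yorke system $(\Omega,\mathbb{P},T)$ consists of a finite set $\Omega$, a probability vector $\mathbb{P}=\{p_\omega\}_{\omega\in\Omega}$ with all $p_\omega>0$, and Lasota-Yorke maps $T=\{T_\omega\}_{\omega\in\Omega}$. Let $X=[0,1]$, $\tilde\Omega=\Omega^{\mathbb{N}}$ with elements $\underline\omega=(\omega_1,\omega_2,\ldots)$, $\tilde{\mathbb{P}}=\mathbb{P}^{\otimes\mathbb{N}}$, and $T_{\underline\omega}^n=T_{\omega_n}\circ\cdots\circ T_{\omega_1}$ ($T_{\underline\omega}^0=\mathrm{id}$). Standing assumptions: $\lambda(T_\omega)>1$ for all $\omega\in\Omega$, and the random covering property holds: for any non-trivial subinterval $I\subset[0,1]$ there exist $n\ge1$ and $\underline\omega\in\Omega^n$ with $T_{\underline\omega}^n(I)=[0,1]$. Under these assumptions there is a unique probability measure $\mu$ absolutely continuous with respect to Lebesgue measure that is stationary, i.e. $\mu(A)=\sum_\omega p_\omega\mu(T_\omega^{-1}A)$ for all Borel $A$; its density is of bounded variation and bounded away from $0$. The empirical measure is $\mathcal{E}_n(x,\underline\omega)=\frac1n\sum_{j=0}^{n-1}\delta_{T_{\underline\omega}^jx}$.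 The Kantorovich distance between probability measures $\nu_1,\nu_2$ on $[0,1]$ is $\kappa(\nu_1,\nu_2)=\int_0^1|F_{\nu_1}(t)-F_{\nu_2}(t)|\,dt$, where $F_\nu(t)=\nu([0,t])$. *)

theory Defs
  imports "HOL-Probability.Probability"
begin

definition unit_borel :: "real measure" where
  "unit_borel = restrict_space borel {0..1}"

definition unit_lebesgue :: "real measure" where
  "unit_lebesgue = restrict_space lborel {0..1}"

text \<open>One-sided derivatives at the end points, so this is \<open>C\<^sup>2\<close> up to the boundary.\<close>

definition C2_on :: "real \<Rightarrow> real \<Rightarrow> (real \<Rightarrow> real) \<Rightarrow> bool" where
  "C2_on a b g \<longleftrightarrow> (\<exists>g' g''.
     (\<forall>x\<in>{a..b}. (g has_real_derivative g' x) (at x within {a..b})) \<and>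
     (\<forall>x\<in>{a..b}. (g' has_real_derivative g'' x) (at x within {a..b})) \<and>
     continuous_on {a..b} g'')"

text \<open>Each branch extends to a \<open>C\<^sup>2\<close> function on the closed interval, as is standard for
  Lasota-Yorke maps; the values of \<open>T\<close> at the finitely many break points themselves are
  unconstrained. Maps of the unit interval are total functions on the reals whose values
  outside the unit interval are never used.\<close>

definition piecewise_C2 :: "(real \<Rightarrow> real) \<Rightarrow> bool" where
  "piecewise_C2 T \<longleftrightarrow> (\<exists>(k::nat) (a::nat \<Rightarrow> real). a 0 = 0 \<and> a k = 1 \<and>
     (\<forall>i<k. a i < a (Suc i) \<and>
        (\<exists>g. C2_on (a i) (a (Suc i)) g \<and> (\<forall>x\<in>{a i<..<a (Suc i)}. T x = g x))))"

text \<open>The infimum runs over all points where the derivative exists. For a piecewise \<open>C\<^sup>2\<close> map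
  this does not depend on a choice of branches: at a break point where \<open>T\<close> happens to be
  differentiable, the derivative is the limit of the derivatives at nearby points.\<close>

definition min_expansion :: "(real \<Rightarrow> real) \<Rightarrow> real" where
  "min_expansion T = (INF x\<in>{x\<in>{0<..<1}. T differentiable (at x)}. \<bar>deriv T x\<bar>)"

definition lasota_yorke :: "(real \<Rightarrow> real) \<Rightarrow> bool" where
  "lasota_yorke T \<longleftrightarrow> T ` {0..1} \<subseteq> {0..1} \<and> piecewise_C2 T \<and> min_expansion T > 0"

text \<open>Sequences are indexed from 0: \<open>w k\<close> is the \<open>(k+1)\<close>-st symbol \<open>\<omega>\<^sub>k\<^sub>+\<^sub>1\<close>.\<close>

fun random_iterate :: "('w \<Rightarrow> real \<Rightarrow> real) \<Rightarrow> (nat \<Rightarrow> 'w) \<Rightarrow> nat \<Rightarrow> real \<Rightarrow> real" where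
  "random_iterate T w 0 = id"
| "random_iterate T w (Suc n) = T (w n) \<circ> random_iterate T w n"

text \<open>Words of length \<open>n\<close> are represented by infinite sequences, of which
  \<open>random_iterate T w n\<close> only reads the first \<open>n\<close> entries.\<close>

definition random_covering :: "('w \<Rightarrow> real \<Rightarrow> real) \<Rightarrow> bool" where
  "random_covering T \<longleftrightarrow>
     (\<forall>I. is_interval I \<and> I \<subseteq> {0..1} \<and> interior I \<noteq> {} \<longrightarrow>
        (\<exists>n\<ge>1. \<exists>w. random_iterate T w n ` I = {0..1}))"

definition stationary :: "'w::finite pmf \<Rightarrow> ('w \<Rightarrow> real \<Rightarrow> real) \<Rightarrow> real measure \<Rightarrow> bool" where
  "stationary p T \<mu> \<longleftrightarrow>
     (\<forall>A\<in>sets unit_borel.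
        measure \<mu> A = (\<Sum>\<omega>\<in>UNIV. pmf p \<omega> * measure \<mu> (T \<omega> -` A \<inter> {0..1})))"

definition ac_stationary_prob ::
    "'w::finite pmf \<Rightarrow> ('w \<Rightarrow> real \<Rightarrow> real) \<Rightarrow> real measure \<Rightarrow> bool" where
  "ac_stationary_prob p T \<mu> \<longleftrightarrow>
     prob_space \<mu> \<and> sets \<mu> = sets unit_borel \<and>
     absolutely_continuous unit_lebesgue \<mu> \<and> stationary p T \<mu>"

definition sequence_measure :: "'w pmf \<Rightarrow> (nat \<Rightarrow> 'w) measure" where
  "sequence_measure p = (\<Pi>\<^sub>M i\<in>UNIV. measure_pmf p)"

text \<open>\<open>return unit_borel y\<close> is the Dirac measure at \<open>y\<close>.\<close>

definition empirical_measure ::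
    "('w \<Rightarrow> real \<Rightarrow> real) \<Rightarrow> nat \<Rightarrow> real \<Rightarrow> (nat \<Rightarrow> 'w) \<Rightarrow> real measure" where
  "empirical_measure T n x w = measure_of {0..1} (sets unit_borel)
     (\<lambda>A. ennreal (1 / real n) *
        (\<Sum>j<n. emeasure (return unit_borel (random_iterate T w j x)) A))"

definition kantorovich :: "real measure \<Rightarrow> real measure \<Rightarrow> real" where
  "kantorovich \<nu>1 \<nu>2 = (LINT t:{0..1}|lborel. \<bar>measure \<nu>1 {0..t} - measure \<nu>2 {0..t}\<bar>)"

end

theory Submission
  imports Defs
begin

text \<open>Let \<open>F\<close> be the distribution function of \<open>\<mu>\<close>. Since
\<open>n\<close> times the Kantorovich distance between the empirical measure and \<open>\<mu>\<close> is the integral over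
\<open>t \<in> [0,1]\<close> of \<open>\<bar>S\<^sub>n \<phi>\<^sub>t\<bar>\<close>, where \<open>\<phi>\<^sub>t\<close> is the indicator of \<open>[0,t]\<close> minus \<open>F t\<close> and \<open>S\<^sub>n\<close>
denotes the Birkhoff sum, Jensen's inequality in \<open>t\<close> and Markov's inequality reduce the theorem
to a sub-Gaussian bound for the exponential moments of \<open>S\<^sub>n \<phi>\<^sub>t\<close> that is uniform in \<open>t\<close>.

The moments are controlled by the transfer operator \<open>L\<close>, averaged over the symbols, which is dual
to the averaged composition operator. Let \<open>h\<close> be the stationary density and let \<open>G\<close> be the sum of
all \<open>L\<^sup>k (\<phi>\<^sub>t h)\<close>. Then \<open>g = G / h\<close> solves the Poisson equation \<open>\<phi>\<^sub>t = g - a\<close>, where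
\<open>a = L (h g) / h\<close>. Probabilistically this splits \<open>S\<^sub>n \<phi>\<^sub>t\<close> into a sum of bounded reversed
martingale differences and a bounded boundary term; analytically it says that \<open>h exp (s a)\<close> is a
supersolution, because \<open>exp z \<le> z + exp (z\<^sup>2)\<close> yields
\<open>L (h exp (s a) exp (s \<phi>\<^sub>t)) = L (h exp (s g)) \<le> exp (s\<^sup>2 R\<^sup>2) h exp (s a)\<close>.
Iterating this inequality is lemma \<open>exponential_moment\<close>.

The remaining input is a bound for \<open>G\<close> that is uniform in \<open>t\<close>. It comes from exponential decay
of \<open>L\<^sup>k\<close> on functions of bounded variation with zero integral (\<open>exponential_decay\<close>), which rests on
two facts. A Lasota-Yorke inequality for an iterate of \<open>L\<close> keeps the variation of densities
bounded (\<open>iterate_LY\<close>). The covering property gives a uniform lower bound for \<open>L\<^sup>N f\<close>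
(\<open>minorization\<close>): a density of variation at most \<open>A\<close> is at least one half on one of finitely many
intervals, and each of them is spread over the whole unit interval by some word. Hence after every
\<open>N\<close> steps two densities share a fixed amount of constant mass, which can be removed from both
without leaving the class of densities of variation at most \<open>A\<close>; their difference contracts
geometrically. Decay also produces \<open>h\<close>, and, functions of bounded variation being dense in the
integrable ones, it shows that \<open>\<mu>\<close> has density \<open>h\<close>.

Densities are genuine functions on the real line that vanish outside the unit interval, and the
transfer operator is a genuine finite sum over preimages. Thus identities such as \<open>L h = h\<close> and the
expansion of \<open>L\<^sup>n\<close> over words hold at every point, whereas positivity and lower bounds have to
tolerate finitely many exceptions, which originate from images of break points.\<close>

section \<open>Functions dominated by an increasing function\<close>

text \<open>Bounded variation is expressed by a majorant: an increasing \<open>v\<close> with values in \<open>[0, B]\<close> whose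
increments dominate those of \<open>f\<close>. Majorants can be added, transported along monotone branches and
restricted to the pieces of a partition, where their increments telescope. The predicate concerns
the whole line, so that for a function vanishing outside the unit interval the jumps at the end
points count.\<close>

definition bvar :: "(real \<Rightarrow> real) \<Rightarrow> real \<Rightarrow> bool" where
  "bvar f B \<longleftrightarrow> (\<exists>v. (\<forall>x y. x \<le> y \<longrightarrow> \<bar>f y - f x\<bar> \<le> v y - v x) \<and> (\<forall>x. 0 \<le> v x \<and> v x \<le> B))"

lemma bvar_nonneg: "bvar f B \<Longrightarrow> 0 \<le> B"
  unfolding bvar_def using order_trans by blast

lemma bvar_mono: "bvar f B \<Longrightarrow> B \<le> C \<Longrightarrow> bvar f C"
  unfolding bvar_def by (meson order_trans)

lemma bvar_zero: "bvar (\<lambda>x. 0) 0"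
  unfolding bvar_def by (rule exI[of _ "\<lambda>x. 0"]) auto

lemma bvar_add:
  assumes "bvar f B" "bvar g C" shows "bvar (\<lambda>x. f x + g x) (B + C)"
proof -
  from assms obtain v w where
    v: "\<And>x y. x \<le> y \<Longrightarrow> \<bar>f y - f x\<bar> \<le> v y - v x" "\<And>x. 0 \<le> v x \<and> v x \<le> B" and
    w: "\<And>x y. x \<le> y \<Longrightarrow> \<bar>g y - g x\<bar> \<le> w y - w x" "\<And>x. 0 \<le> w x \<and> w x \<le> C"
    unfolding bvar_def by blast
  show ?thesis unfolding bvar_def
  proof (rule exI[of _ "\<lambda>x. v x + w x"], intro conjI allI impI)
    fix x y :: real assume "x \<le> y"
    then show "\<bar>f y + g y - (f x + g x)\<bar> \<le> v y + w y - (v x + w x)"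
      using v(1)[of x y] w(1)[of x y] by linarith
  next
    fix x show "0 \<le> v x + w x" "v x + w x \<le> B + C"
      using v(2)[of x] w(2)[of x] by linarith+
  qed
qed

lemma bvar_cmult:
  assumes "bvar f B" shows "bvar (\<lambda>x. c * f x) (\<bar>c\<bar> * B)"
proof -
  from assms obtain v where
    v: "\<And>x y. x \<le> y \<Longrightarrow> \<bar>f y - f x\<bar> \<le> v y - v x" "\<And>x. 0 \<le> v x \<and> v x \<le> B"
    unfolding bvar_def by blast
  show ?thesis unfolding bvar_def
  proof (rule exI[of _ "\<lambda>x. \<bar>c\<bar> * v x"], intro conjI allI impI)
    fix x y :: real assume "x \<le> y"
    have "\<bar>c * f y - c * f x\<bar> = \<bar>c\<bar> * \<bar>f y - f x\<bar>"
      by (simp add: right_diff_distrib[symmetric] abs_mult)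
    also have "\<dots> \<le> \<bar>c\<bar> * (v y - v x)" using v(1)[OF \<open>x \<le> y\<close>] by (intro mult_left_mono) auto
    finally show "\<bar>c * f y - c * f x\<bar> \<le> \<bar>c\<bar> * v y - \<bar>c\<bar> * v x" by (simp add: right_diff_distrib)
  qed (use v(2) in \<open>auto intro: mult_left_mono\<close>)
qed

lemma bvar_sum:
  assumes "finite I" "\<And>i. i \<in> I \<Longrightarrow> bvar (f i) (B i)"
  shows "bvar (\<lambda>x. \<Sum>i\<in>I. f i x) (\<Sum>i\<in>I. B i)"
  using assms by (induction I rule: finite_induct) (auto simp: bvar_zero intro: bvar_add)

text \<open>The majorants of the summands add up to a majorant of the sum.\<close>

lemma bvar_suminf:
  assumes f: "\<And>k. bvar (f k) (B k)" and sB: "summable B" and sf: "\<And>x. summable (\<lambda>k. f k x)"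
  shows "bvar (\<lambda>x. \<Sum>k. f k x) (\<Sum>k. B k)"
proof -
  from f have "\<exists>v. (\<forall>x y. x \<le> y \<longrightarrow> \<bar>f k y - f k x\<bar> \<le> v y - v x) \<and> (\<forall>x. 0 \<le> v x \<and> v x \<le> B k)" for k
    unfolding bvar_def by blast
  then obtain v where
    v: "\<And>k x y. x \<le> y \<Longrightarrow> \<bar>f k y - f k x\<bar> \<le> v k y - v k x" "\<And>k x. 0 \<le> v k x \<and> v k x \<le> B k"
    by metis
  have sv: "summable (\<lambda>k. v k x)" for x
    by (rule summable_comparison_test'[OF sB, of 0]) (use v(2) in auto)
  show ?thesis unfolding bvar_def
  proof (rule exI[of _ "\<lambda>x. \<Sum>k. v k x"], intro conjI allI impI)
    fix x y :: real assume xy: "x \<le> y"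
    have s: "summable (\<lambda>k. v k y - v k x)" by (intro summable_diff sv)
    have sa: "summable (\<lambda>k. \<bar>f k y - f k x\<bar>)"
      by (rule summable_comparison_test'[OF s, of 0]) (use v(1)[OF xy] in auto)
    have "\<bar>(\<Sum>k. f k y) - (\<Sum>k. f k x)\<bar> = \<bar>\<Sum>k. f k y - f k x\<bar>"
      by (simp add: suminf_diff[OF sf sf])
    also have "\<dots> \<le> (\<Sum>k. \<bar>f k y - f k x\<bar>)" by (rule summable_rabs[OF sa])
    also have "\<dots> \<le> (\<Sum>k. v k y - v k x)" by (rule suminf_le[OF v(1)[OF xy] sa s])
    also have "\<dots> = (\<Sum>k. v k y) - (\<Sum>k. v k x)" by (simp add: suminf_diff[OF sv sv])
    finally show "\<bar>(\<Sum>k. f k y) - (\<Sum>k. f k x)\<bar> \<le> (\<Sum>k. v k y) - (\<Sum>k. v k x)" .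
  next
    fix x
    show "0 \<le> (\<Sum>k. v k x)" by (rule suminf_nonneg[OF sv]) (use v(2) in auto)
    show "(\<Sum>k. v k x) \<le> (\<Sum>k. B k)" by (rule suminf_le[OF _ sv sB]) (use v(2) in auto)
  qed
qed

lemma oscillation_le:
  fixes f v :: "real \<Rightarrow> real"
  assumes v: "\<And>x y. x \<le> y \<Longrightarrow> \<bar>f y - f x\<bar> \<le> v y - v x" and x: "a \<le> x" "x \<le> b" and z: "a \<le> z" "z \<le> b"
  shows "\<bar>f x - f z\<bar> \<le> v b - v a"
proof -
  have mono: "r \<le> s \<Longrightarrow> v r \<le> v s" for r s using v[of r s] by linarith
  have "v a \<le> v x" "v a \<le> v z" "v x \<le> v b" "v z \<le> v b" using x z by (auto intro: mono)
  moreover have "\<bar>f x - f z\<bar> \<le> \<bar>v x - v z\<bar>" using v[of x z] v[of z x] by (cases "x \<le> z") auto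
  ultimately show ?thesis by linarith
qed

lemma bvar_measurable:
  assumes "bvar f B" shows "f \<in> borel_measurable borel"
proof -
  from assms obtain v where
    v: "\<And>x y. x \<le> y \<Longrightarrow> \<bar>f y - f x\<bar> \<le> v y - v x" unfolding bvar_def by blast
  have "mono v" by (rule monoI) (use v in fastforce)
  moreover have "mono (\<lambda>x. v x - f x)" by (rule monoI) (use v in fastforce)
  ultimately have "(\<lambda>x. v x - (v x - f x)) \<in> borel_measurable borel"
    by (intro borel_measurable_diff borel_measurable_mono)
  then show ?thesis by simp
qed

definition supp01 :: "(real \<Rightarrow> real) \<Rightarrow> bool" where
  "supp01 f \<longleftrightarrow> (\<forall>x. x \<notin> {0..1} \<longrightarrow> f x = 0)"

text \<open>A function that vanishes to the left of the unit interval has to climb to each of its values, so the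
variation controls the supremum.\<close>

lemma bvar_bound:
  assumes "bvar f B" "supp01 f" shows "\<bar>f x\<bar> \<le> B"
proof -
  from assms obtain v where
    v: "\<And>x y. x \<le> y \<Longrightarrow> \<bar>f y - f x\<bar> \<le> v y - v x" "\<And>x. 0 \<le> v x \<and> v x \<le> B"
    unfolding bvar_def by blast
  have "f (min x (-1)) = 0" using assms(2) unfolding supp01_def by auto
  then have "\<bar>f x\<bar> \<le> v x - v (min x (-1))" using v(1)[of "min x (-1)" x] by simp
  then show ?thesis using v(2)[of x] v(2)[of "min x (-1)"] by linarith
qed

lemma bvar_indicator:
  assumes "a \<le> b" shows "bvar (indicator {a..b}) 2"
  unfolding bvar_def
  by (rule exI[of _ "\<lambda>x. if x < a then 0 else if x \<le> b then 1 else 2"])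
     (use assms in \<open>auto simp: indicator_def\<close>)

lemma bvar_restrict_atMost:
  assumes "bvar f B" "supp01 f" shows "bvar (\<lambda>x. indicator {..t} x * f x) (2 * B)"
proof -
  from assms obtain v where
    v: "\<And>x y. x \<le> y \<Longrightarrow> \<bar>f y - f x\<bar> \<le> v y - v x" "\<And>x. 0 \<le> v x \<and> v x \<le> B"
    unfolding bvar_def by blast
  have mv: "x \<le> y \<Longrightarrow> v x \<le> v y" for x y using v(1)[of x y] by linarith
  show ?thesis unfolding bvar_def
  proof (rule exI[of _ "\<lambda>x. if x \<le> t then v x else 2 * B"], intro conjI allI impI)
    fix x y :: real assume xy: "x \<le> y"
    show "\<bar>indicator {..t} y * f y - indicator {..t} x * f x\<bar>
      \<le> (if y \<le> t then v y else 2 * B) - (if x \<le> t then v x else 2 * B)"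
      using v(1)[OF xy] bvar_bound[OF assms, of x] v(2)[of x] v(2)[of y] xy
      by (auto simp: indicator_def)
  next
    fix x show "0 \<le> (if x \<le> t then v x else 2 * B)" "(if x \<le> t then v x else 2 * B) \<le> 2 * B"
      using v(2)[of x] by auto
  qed
qed

lemma bounded_supp01_integrable:
  assumes "f \<in> borel_measurable borel" "supp01 f" "\<And>x. \<bar>f x\<bar> \<le> B"
  shows "integrable lborel f"
proof -
  have "integrable lborel (\<lambda>x. B * indicator {0..1::real} x)" by simp
  then show ?thesis
  proof (rule Bochner_Integration.integrable_bound)
    show "AE x in lborel. norm (f x) \<le> norm (B * indicator {0..1} x)"
      using assms(2,3) by (intro AE_I2) (auto simp: supp01_def indicator_def intro: order_trans[OF assms(3)])
  qed (use assms(1) in simp)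
qed

lemma bounded_supp01_mult_integrable:
  assumes f: "f \<in> borel_measurable borel" "supp01 f" "\<And>x. \<bar>f x\<bar> \<le> B"
    and u: "u \<in> borel_measurable borel" "\<And>x. \<bar>u x\<bar> \<le> U"
  shows "integrable lborel (\<lambda>x. f x * u x)"
proof (rule bounded_supp01_integrable)
  have "0 \<le> B" using f(3)[of 0] by linarith
  then show "\<bar>f x * u x\<bar> \<le> B * U" for x unfolding abs_mult by (intro mult_mono f(3) u(2)) auto
qed (use f u in \<open>auto simp: supp01_def\<close>)

lemma bvar_integrable: "bvar f B \<Longrightarrow> supp01 f \<Longrightarrow> integrable lborel f"
  using bounded_supp01_integrable bvar_measurable bvar_bound by blast

section \<open>Functions of bounded variation are dense\<close>

definition bv_approximable :: "(real \<Rightarrow> real) \<Rightarrow> bool" where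
  "bv_approximable f \<longleftrightarrow> (\<forall>e>0. \<exists>g B. bvar g B \<and> supp01 g \<and> (LBINT x. \<bar>f x - g x\<bar>) < e)"

lemma bv_approximable_bvar: "bvar f B \<Longrightarrow> supp01 f \<Longrightarrow> bv_approximable f"
  unfolding bv_approximable_def
  by (intro allI impI exI[of _ f] exI[of _ B]) simp

lemma bv_approximable_add:
  assumes f: "bv_approximable f1" "bv_approximable f2" and i: "integrable lborel f1" "integrable lborel f2"
  shows "bv_approximable (\<lambda>x. f1 x + c * f2 x)"
  unfolding bv_approximable_def
proof (intro allI impI)
  fix e :: real assume e: "e > 0"
  define d where "d = e / (2 * (1 + \<bar>c\<bar>))"
  have d: "d > 0" "d * (1 + \<bar>c\<bar>) = e / 2" using e by (auto simp: d_def field_simps add_nonneg_eq_0_iff)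
  obtain g1 B1 where 1: "bvar g1 B1" "supp01 g1" "(LBINT x. \<bar>f1 x - g1 x\<bar>) < d"
    using f(1) d(1) unfolding bv_approximable_def by blast
  obtain g2 B2 where 2: "bvar g2 B2" "supp01 g2" "(LBINT x. \<bar>f2 x - g2 x\<bar>) < d"
    using f(2) d(1) unfolding bv_approximable_def by blast
  note gi = bvar_integrable[OF 1(1,2)] bvar_integrable[OF 2(1,2)]
  have "(LBINT x. \<bar>(f1 x + c * f2 x) - (g1 x + c * g2 x)\<bar>) \<le> (LBINT x. \<bar>f1 x - g1 x\<bar> + \<bar>c\<bar> * \<bar>f2 x - g2 x\<bar>)"
  proof (rule integral_mono)
    fix x
    have "(f1 x + c * f2 x) - (g1 x + c * g2 x) = (f1 x - g1 x) + c * (f2 x - g2 x)" by (simp add: algebra_simps)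
    then show "\<bar>(f1 x + c * f2 x) - (g1 x + c * g2 x)\<bar> \<le> \<bar>f1 x - g1 x\<bar> + \<bar>c\<bar> * \<bar>f2 x - g2 x\<bar>"
      using abs_triangle_ineq[of "f1 x - g1 x" "c * (f2 x - g2 x)"] by (simp add: abs_mult)
  qed (use i gi in auto)
  also have "\<dots> = (LBINT x. \<bar>f1 x - g1 x\<bar>) + \<bar>c\<bar> * (LBINT x. \<bar>f2 x - g2 x\<bar>)"
    using i gi by simp
  also have "\<dots> \<le> d + \<bar>c\<bar> * d" using 1(3) 2(3) by (intro add_mono mult_left_mono) auto
  also have "\<dots> < e" using d(2) e by (simp add: algebra_simps)
  finally have "(LBINT x. \<bar>(f1 x + c * f2 x) - (g1 x + c * g2 x)\<bar>) < e" .
  moreover have "bvar (\<lambda>x. g1 x + c * g2 x) (B1 + \<bar>c\<bar> * B2)" by (intro bvar_add bvar_cmult 1 2)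
  moreover have "supp01 (\<lambda>x. g1 x + c * g2 x)" using 1(2) 2(2) by (auto simp: supp01_def)
  ultimately show "\<exists>g B. bvar g B \<and> supp01 g \<and> (LBINT x. \<bar>f1 x + c * f2 x - g x\<bar>) < e" by blast
qed

lemma bv_approximable_limit:
  fixes s :: "nat \<Rightarrow> real \<Rightarrow> real"
  assumes s: "\<And>i. bv_approximable (s i)" "\<And>i. integrable lborel (s i)" and w: "integrable lborel w"
    and f: "f \<in> borel_measurable lborel" "\<And>x. (\<lambda>i. s i x) \<longlonglongrightarrow> f x" "\<And>i x. \<bar>s i x\<bar> \<le> w x"
  shows "bv_approximable f"
  unfolding bv_approximable_def
proof (intro allI impI)
  fix e :: real assume e: "e > 0"
  have fw: "\<bar>f x\<bar> \<le> w x" for x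
    using LIMSEQ_le_const2[OF tendsto_rabs[OF f(2)[of x]]] f(3) by blast
  have fi: "integrable lborel f" by (rule Bochner_Integration.integrable_bound[OF w f(1)])
      (use fw in \<open>auto intro!: AE_I2 intro: order_trans[OF _ abs_ge_self]\<close>)
  have "(\<lambda>i. LBINT x. \<bar>f x - s i x\<bar>) \<longlonglongrightarrow> (\<integral>x. 0 \<partial>(lborel::real measure))"
  proof (rule integral_dominated_convergence[where w = "\<lambda>x. 2 * w x"])
    show "(\<lambda>x. \<bar>f x - s i x\<bar>) \<in> borel_measurable lborel" for i
      using f(1) borel_measurable_integrable[OF s(2)[of i]] by measurable
    show "AE x in lborel. (\<lambda>i. \<bar>f x - s i x\<bar>) \<longlonglongrightarrow> 0"
    proof (rule AE_I2)
      fix x show "(\<lambda>i. \<bar>f x - s i x\<bar>) \<longlonglongrightarrow> 0"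
        using tendsto_rabs[OF tendsto_diff[OF tendsto_const[of "f x"] f(2)[of x]]] by simp
    qed
    show "AE x in lborel. norm \<bar>f x - s i x\<bar> \<le> 2 * w x" for i
    proof (rule AE_I2)
      fix x show "norm \<bar>f x - s i x\<bar> \<le> 2 * w x" using fw[of x] f(3)[of i x] by auto
    qed
  qed (use w in auto)
  then have "\<exists>i. (LBINT x. \<bar>f x - s i x\<bar>) < e / 2"
    using order_tendstoD(2)[of _ 0 sequentially "e / 2"] e by (auto simp: eventually_sequentially)
  then obtain i where i: "(LBINT x. \<bar>f x - s i x\<bar>) < e / 2" by blast
  obtain g B where g: "bvar g B" "supp01 g" "(LBINT x. \<bar>s i x - g x\<bar>) < e / 2"
    using s(1)[of i] e unfolding bv_approximable_def by (meson half_gt_zero)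
  note gi = bvar_integrable[OF g(1,2)]
  have "(LBINT x. \<bar>f x - g x\<bar>) \<le> (LBINT x. \<bar>f x - s i x\<bar> + \<bar>s i x - g x\<bar>)"
    by (rule integral_mono) (use fi s(2) gi in auto)
  also have "\<dots> = (LBINT x. \<bar>f x - s i x\<bar>) + (LBINT x. \<bar>s i x - g x\<bar>)" using fi s(2) gi by simp
  also have "\<dots> < e" using i g(3) by simp
  finally show "\<exists>g B. bvar g B \<and> supp01 g \<and> (LBINT x. \<bar>f x - g x\<bar>) < e" using g by blast
qed

text \<open>Indicators of half lines have bounded variation, and the approximable sets form a Dynkin system.\<close>

lemma bv_approximable_indicator:
  assumes "A \<in> sets borel"
  shows "bv_approximable (\<lambda>x. indicator {0..1} x * indicator A x)"
proof -
  have int: "integrable lborel (\<lambda>x. indicator {0..1::real} x * indicator A x :: real)" if "A \<in> sets borel" for A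
    by (rule bounded_supp01_integrable[of _ 1]) (use that in \<open>auto simp: supp01_def indicator_def\<close>)
  have st: "Int_stable (range (atMost :: real \<Rightarrow> real set))"
    by (auto simp: Int_stable_def)
  have sub: "range (atMost :: real \<Rightarrow> real set) \<subseteq> Pow UNIV" by simp
  have B: "sets borel = sigma_sets UNIV (range (atMost :: real \<Rightarrow> real set))"
    by (subst borel_eq_atMost) simp
  have "A \<in> sigma_sets UNIV (range (atMost :: real \<Rightarrow> real set))" using assms B by simp
  from st sub this show ?thesis
  proof (induction rule: sigma_sets_induct_disjoint)
    case (basic A)
    then obtain t where "A = {..t}" by blast
    then show ?case
      using bv_approximable_bvar[OF bvar_restrict_atMost[OF bvar_indicator[of 0 1], of t]]
      by (simp add: supp01_def mult.commute)
  next
    case empty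
    then show ?case using bv_approximable_bvar[OF bvar_zero] by (simp add: supp01_def)
  next
    case (compl A)
    then have A: "A \<in> sets borel" using B by simp
    have "bv_approximable (\<lambda>x. indicator {0..1} x + (-1) * (indicator {0..1} x * indicator A x))"
      by (rule bv_approximable_add[OF bv_approximable_bvar[OF bvar_indicator[of 0 1]] compl(2) _ int[OF A]])
         (auto simp: supp01_def)
    moreover have "(\<lambda>x::real. indicator {0..1} x + (-1) * (indicator {0..1} x * indicator A x) :: real)
        = (\<lambda>x. indicator {0..1} x * indicator (UNIV - A) x)" by (auto simp: indicator_def)
    ultimately show ?case by simp
  next
    case (union A)
    then have A: "A i \<in> sets borel" for i using B by auto
    define s where "s n x = (\<Sum>i<n. indicator {0..1} x * indicator (A i) x :: real)" for n :: nat and x :: real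
    have s_eq: "s n x = indicator {0..1} x * indicator (\<Union>i<n. A i) x" for n x
    proof -
      have "indicator (\<Union>i<n. A i) x = (\<Sum>i<n. indicator (A i) x :: real)"
        by (rule indicator_UN_disjoint) (use union(1) in \<open>auto simp: disjoint_family_on_def\<close>)
      then show ?thesis by (simp add: s_def sum_distrib_left)
    qed
    have int_s: "integrable lborel (s n)" for n unfolding s_def[abs_def] by (intro Bochner_Integration.integrable_sum int A)
    have ap: "bv_approximable (s n)" for n
    proof (induction n)
      case 0 show ?case using bv_approximable_bvar[OF bvar_zero] by (simp add: s_def[abs_def] supp01_def)
    next
      case (Suc n)
      have "bv_approximable (\<lambda>x. s n x + 1 * (indicator {0..1} x * indicator (A n) x))"
        by (rule bv_approximable_add[OF Suc union(3) int_s int[OF A]])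
      moreover have "(\<lambda>x. s n x + 1 * (indicator {0..1} x * indicator (A n) x)) = s (Suc n)"
        unfolding s_def[abs_def] sum.lessThan_Suc mult_1_left ..
      ultimately show ?case by simp
    qed
    show ?case
    proof (rule bv_approximable_limit[OF ap int_s, where w = "indicator {0..1}"])
      have "(\<Union>i. A i) \<in> sets borel" using A by auto
      then show "(\<lambda>x::real. indicator {0..1} x * indicator (\<Union>i. A i) x :: real) \<in> borel_measurable lborel"
        by (intro borel_measurable_times borel_measurable_indicator) auto
      fix x :: real
      have "(\<lambda>n. indicator (\<Union>i<n. A i) x) \<longlonglongrightarrow> (indicator (\<Union>i. A i) x :: real)"
        by (rule LIMSEQ_indicator_UN)
      then show "(\<lambda>n. s n x) \<longlonglongrightarrow> indicator {0..1} x * indicator (\<Union>i. A i) x"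
        unfolding s_eq by (intro tendsto_mult tendsto_const)
      show "\<bar>s i x\<bar> \<le> indicator {0..1} x" for i unfolding s_eq by (auto simp: indicator_def)
    qed simp
  qed
qed

lemma integrable_bv_approximable:
  assumes "integrable lborel (f :: real \<Rightarrow> real)"
  shows "bv_approximable (\<lambda>x. indicator {0..1} x * f x)"
  using assms
proof (induction rule: integrable_induct)
  case (base A c)
  have A: "A \<in> sets borel" using base(1) by simp
  have i: "integrable lborel (\<lambda>x. indicator {0..1::real} x * indicator A x :: real)"
    by (rule bounded_supp01_integrable[of _ 1]) (use A in \<open>auto simp: supp01_def indicator_def\<close>)
  have "bv_approximable (\<lambda>x. 0 + c * (indicator {0..1} x * indicator A x))"
    by (rule bv_approximable_add[OF bv_approximable_bvar[OF bvar_zero] bv_approximable_indicator[OF A] _ i])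
       (auto simp: supp01_def)
  then show ?case by (simp add: mult_ac)
next
  case (add f g)
  have i: "integrable lborel (\<lambda>x. indicator {0..1::real} x * f x)" if "integrable lborel f" for f :: "real \<Rightarrow> real"
    using integrable_mult_indicator[OF _ that, of "{0..1}"] by simp
  have "bv_approximable (\<lambda>x. indicator {0..1} x * f x + 1 * (indicator {0..1} x * g x))"
    by (rule bv_approximable_add) (use add i in auto)
  then show ?case by (simp add: distrib_left)
next
  case (lim f s)
  have i: "integrable lborel (\<lambda>x. indicator {0..1::real} x * f x)" if "integrable lborel f" for f :: "real \<Rightarrow> real"
    using integrable_mult_indicator[OF _ that, of "{0..1}"] by simp
  show ?case
  proof (rule bv_approximable_limit[OF lim(5) i[OF lim(1)], where w = "\<lambda>x. 2 * \<bar>f x\<bar>"])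
    show "integrable lborel (\<lambda>x. 2 * \<bar>f x\<bar>)" using lim(4) by simp
    show "(\<lambda>x. indicator {0..1} x * f x) \<in> borel_measurable lborel"
      using borel_measurable_integrable[OF i[OF lim(4)]] .
    fix x
    show "(\<lambda>i. indicator {0..1} x * s i x) \<longlonglongrightarrow> indicator {0..1} x * f x"
      using lim(2)[of x] by (intro tendsto_mult tendsto_const) simp
    show "\<bar>indicator {0..1} x * s i x\<bar> \<le> 2 * \<bar>f x\<bar>" for i
      using lim(3)[of x i] by (auto simp: indicator_def)
  qed
qed

section \<open>Exponential inequalities and the unit interval\<close>

text \<open>The linear term disappears when a centred variable is averaged, which leaves a sub-Gaussian
bound. The inequality follows from \<open>exp z \<le> 1 + z + z\<^sup>2\<close> for \<open>\<bar>z\<bar> \<le> 1\<close> and is crude elsewhere.\<close>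

lemma exp_le_add_exp_square: "exp z \<le> z + exp (z\<^sup>2)" for z :: real
proof -
  have sq: "1 + z\<^sup>2 \<le> exp (z\<^sup>2)" by (rule exp_ge_add_one_self)
  consider "1 < z" | "0 \<le> z" "z \<le> 1" | "-1 \<le> z" "z < 0" | "z < -1" by linarith
  then show ?thesis
  proof cases
    case 1
    then have "z \<le> z\<^sup>2" by (simp add: power2_eq_square)
    then have "exp z \<le> exp (z\<^sup>2)" by simp
    then show ?thesis using 1 by linarith
  next
    case 2 then show ?thesis using exp_bound[of z] sq by linarith
  next
    case 3
    have "1 \<le> (1 + z + z\<^sup>2) * (1 - z)"
    proof -
      have "z ^ 3 \<le> 0" using 3 by (simp add: power_le_zero_eq)
      then show ?thesis by (simp add: algebra_simps power2_eq_square power3_eq_cube)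
    qed
    moreover have "1 - z \<le> exp (- z)" using exp_ge_add_one_self[of "- z"] by simp
    moreover have "0 \<le> 1 + z + z\<^sup>2" using 3 by (simp add: add_nonneg_nonneg)
    ultimately have "1 \<le> (1 + z + z\<^sup>2) * exp (- z)" by (meson mult_left_mono order_trans)
    then have "exp z \<le> 1 + z + z\<^sup>2" by (simp add: exp_minus field_simps)
    then show ?thesis using sq by linarith
  next
    case 4
    have "- z \<le> z\<^sup>2" using 4 mult_mono[of 1 "- z" "- z" "- z"] by (simp add: power2_eq_square)
    moreover have "exp z \<le> 1" using 4 by simp
    ultimately show ?thesis using sq by linarith
  qed
qed

lemma prob_space_unit_lebesgue: "prob_space unit_lebesgue"
  by (rule prob_spaceI) (simp add: unit_lebesgue_def emeasure_restrict_space space_restrict_space)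

lemma unit_lebesgue_measurable: "f \<in> borel_measurable borel \<Longrightarrow> f \<in> borel_measurable unit_lebesgue"
  unfolding unit_lebesgue_def by (rule measurable_restrict_space1) simp

text \<open>The value of \<open>s\<close> minimises \<open>n s\<^sup>2 R\<^sup>2 - s t \<surd>n\<close>, with minimum \<open>- t\<^sup>2 / (4 R\<^sup>2)\<close>. For \<open>t > 16 R\<close> half of
this exponent absorbs the boundary term \<open>2 s R\<close> and the factor two.\<close>

lemma gaussian_tail_exponent:
  fixes R t :: real and n :: nat
  assumes R: "1 \<le> R" and t: "16 * R < t" and n: "1 \<le> n"
  defines "s \<equiv> t / (2 * R\<^sup>2 * sqrt (real n))"
  shows "2 * exp (2 * s * R + real n * s\<^sup>2 * R\<^sup>2) * exp (- (s * t * sqrt (real n))) \<le> exp (- (1 / (8 * R\<^sup>2)) * t\<^sup>2)"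
proof -
  define x where "x = t / R"
  have tx: "t = x * R" and x: "16 < x" using R t by (auto simp: x_def field_simps)
  have sn: "1 \<le> sqrt (real n)" "sqrt (real n) * sqrt (real n) = real n" using n by auto
  have s: "s = x / (2 * R * sqrt (real n))" using R by (simp add: s_def tx power2_eq_square)
  have 1: "s * t * sqrt (real n) = x\<^sup>2 / 2" using R sn by (simp add: s tx power2_eq_square)
  have 2: "real n * s\<^sup>2 * R\<^sup>2 = x\<^sup>2 / 4"
    using R sn n by (simp add: s power2_eq_square field_simps)
  have "2 * s * R = x / sqrt (real n)" using R by (simp add: s)
  also have "\<dots> \<le> x" using x sn(1) by (simp add: divide_le_eq mult_left_le)
  finally have 3: "2 * s * R \<le> x" .
  have 4: "(1 / (8 * R\<^sup>2)) * t\<^sup>2 = x\<^sup>2 / 8" using R by (simp add: tx power2_eq_square)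
  have "2 \<le> exp (1::real)" using exp_ge_add_one_self[of 1] by simp
  then have "2 * exp (2 * s * R + real n * s\<^sup>2 * R\<^sup>2) * exp (- (s * t * sqrt (real n)))
      \<le> exp 1 * exp (2 * s * R + real n * s\<^sup>2 * R\<^sup>2) * exp (- (s * t * sqrt (real n)))"
    by (intro mult_right_mono) auto
  also have "\<dots> = exp (1 + (2 * s * R + real n * s\<^sup>2 * R\<^sup>2) - s * t * sqrt (real n))"
    by (simp add: exp_add exp_diff exp_minus field_simps)
  also have "\<dots> \<le> exp (- (1 / (8 * R\<^sup>2)) * t\<^sup>2)"
  proof -
    have "16 * x \<le> x\<^sup>2" unfolding power2_eq_square using x by (intro mult_right_mono) auto
    then have "1 + (2 * s * R + real n * s\<^sup>2 * R\<^sup>2) - s * t * sqrt (real n) \<le> - (x\<^sup>2 / 8)"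
      using 1 2 3 x by linarith
    then show ?thesis by (simp only: exp_le_cancel_iff mult_minus_left 4)
  qed
  finally show ?thesis .
qed

section \<open>One monotone piece\<close>

lemma fibre_sum_inj:
  assumes "inj_on T J"
  shows "(\<Sum>x\<in>{x\<in>J. T x = y}. F x) = (if y \<in> T ` J then F (the_inv_into J T y) else 0)"
proof (cases "y \<in> T ` J")
  case True
  then obtain x where x: "x \<in> J" "T x = y" by auto
  then have "{x\<in>J. T x = y} = {x}" using assms by (auto simp: inj_on_def)
  moreover have "the_inv_into J T y = x" using the_inv_into_f_f[OF assms x(1)] x(2) by simp
  ultimately show ?thesis using True by simp
next
  case False
  then have "{x\<in>J. T x = y} = {}" by auto
  with False show ?thesis by (simp only: if_False sum.empty)
qed

lemma strict_mono_or_antimono_inj: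
  fixes T :: "real \<Rightarrow> real"
  assumes "strict_mono_on J T \<or> strict_antimono_on J T"
  shows "inj_on T J"
proof (rule inj_onI, rule ccontr)
  fix x y assume *: "x \<in> J" "y \<in> J" "T x = T y" "x \<noteq> y"
  then consider "x < y" | "y < x" by linarith
  then show False
    using assms monotone_onD[of J "(<)" "(<)" T] monotone_onD[of J "(<)" "(>)" T] * by cases fastforce+
qed

text \<open>The fibre sum \<open>k\<close> equals \<open>F\<close> composed with the inverse branch on the interval \<open>T ` J\<close> and vanishes
elsewhere. A majorant is obtained from that of \<open>F\<close> (reversed if the branch is decreasing) by
adding a jump of height \<open>M\<close> at each end of the image. Because of these jumps, expansion by a factor
only slightly larger than one need not decrease the variation in a single step.\<close>

lemma bvar_fibre_sum:
  fixes T F u :: "real \<Rightarrow> real"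
  assumes mono: "strict_mono_on J T \<or> strict_antimono_on J T" and K: "is_interval (T ` J)"
    and F: "\<And>x y. x \<in> J \<Longrightarrow> y \<in> J \<Longrightarrow> x \<le> y \<Longrightarrow> \<bar>F y - F x\<bar> \<le> u y - u x"
    and M: "\<And>x. x \<in> J \<Longrightarrow> \<bar>F x\<bar> \<le> M" and u: "\<And>x. x \<in> J \<Longrightarrow> m \<le> u x \<and> u x \<le> m + d"
    and nn: "0 \<le> M" "0 \<le> d"
  shows "bvar (\<lambda>y. \<Sum>x\<in>{x\<in>J. T x = y}. F x) (2 * M + d)"
proof -
  have inj: "inj_on T J" by (rule strict_mono_or_antimono_inj[OF mono])
  let ?k = "\<lambda>y. \<Sum>x\<in>{x\<in>J. T x = y}. F x" and ?p = "the_inv_into J T"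
  have kK: "y \<in> T ` J \<Longrightarrow> ?k y = F (?p y)" and k0: "y \<notin> T ` J \<Longrightarrow> ?k y = 0" for y
    by (simp_all only: fibre_sum_inj[OF inj] if_True if_False)
  have pJ: "y \<in> T ` J \<Longrightarrow> ?p y \<in> J" for y using the_inv_into_into[OF inj] by blast
  have Tp: "y \<in> T ` J \<Longrightarrow> T (?p y) = y" for y using f_the_inv_into_f[OF inj] by blast
  \<comment> \<open>a monotone majorant of the variation on the image of the piece\<close>
  obtain U where U: "\<And>x y. x \<in> T ` J \<Longrightarrow> y \<in> T ` J \<Longrightarrow> x \<le> y \<Longrightarrow> \<bar>?k y - ?k x\<bar> \<le> U y - U x"
    and Ub: "\<And>x. x \<in> T ` J \<Longrightarrow> 0 \<le> U x \<and> U x \<le> d"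
  proof (cases "strict_mono_on J T")
    case True
    have le: "?p x \<le> ?p y" if "x \<in> T ` J" "y \<in> T ` J" "x \<le> y" for x y
      using monotone_onD[OF True pJ[OF that(2)] pJ[OF that(1)]] Tp[OF that(1)] Tp[OF that(2)] that(3)
      by linarith
    show thesis
    proof (rule that[of "\<lambda>y. u (?p y) - m"])
      fix x y assume *: "x \<in> T ` J" "y \<in> T ` J" "x \<le> y"
      show "\<bar>?k y - ?k x\<bar> \<le> u (?p y) - m - (u (?p x) - m)"
        using F[OF pJ[OF *(1)] pJ[OF *(2)] le[OF *]] by (simp only: kK[OF *(1)] kK[OF *(2)])
    next
      fix x assume "x \<in> T ` J" then show "0 \<le> u (?p x) - m \<and> u (?p x) - m \<le> d" using u[OF pJ] by fastforce
    qed
  next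
    case False
    then have an: "strict_antimono_on J T" using mono by blast
    have le: "?p y \<le> ?p x" if "x \<in> T ` J" "y \<in> T ` J" "x \<le> y" for x y
      using monotone_onD[OF an pJ[OF that(1)] pJ[OF that(2)]] Tp[OF that(1)] Tp[OF that(2)] that(3)
      by linarith
    show thesis
    proof (rule that[of "\<lambda>y. m + d - u (?p y)"])
      fix x y assume *: "x \<in> T ` J" "y \<in> T ` J" "x \<le> y"
      show "\<bar>?k y - ?k x\<bar> \<le> m + d - u (?p y) - (m + d - u (?p x))"
        using F[OF pJ[OF *(2)] pJ[OF *(1)] le[OF *]] by (simp only: kK[OF *(1)] kK[OF *(2)])
    next
      fix x assume "x \<in> T ` J" then show "0 \<le> m + d - u (?p x) \<and> m + d - u (?p x) \<le> d" using u[OF pJ] by fastforce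
    qed
  qed
  have kM: "\<bar>?k y\<bar> \<le> M" if "y \<in> T ` J" for y using M[OF pJ[OF that]] kK[OF that] by simp
  define v where "v y = (if y \<in> T ` J then M + U y else if \<exists>z\<in>T ` J. z < y then 2 * M + d else 0)" for y
  have mid: "y \<in> T ` J" if "x \<in> T ` J" "z \<in> T ` J" "x \<le> y" "y \<le> z" for x y z
    using K that unfolding is_interval_1 by blast
  show ?thesis unfolding bvar_def
  proof (rule exI[of _ v], intro conjI allI impI)
    fix x y :: real assume xy: "x \<le> y"
    consider "x \<in> T ` J" "y \<in> T ` J" | "x \<in> T ` J" "y \<notin> T ` J" | "x \<notin> T ` J" "y \<in> T ` J" | "x \<notin> T ` J" "y \<notin> T ` J"
      by blast
    then show "\<bar>?k y - ?k x\<bar> \<le> v y - v x"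
    proof cases
      case 1 then show ?thesis using U[OF 1 xy] by (simp add: v_def)
    next
      case 2
      then have "x < y" using xy by (cases "x = y") auto
      then have "v y = 2 * M + d" using 2 unfolding v_def by auto
      moreover have "v x = M + U x" using 2 by (simp add: v_def)
      ultimately show ?thesis using k0[OF 2(2)] kM[OF 2(1)] Ub[OF 2(1)] by simp
    next
      case 3
      then have "\<not> (\<exists>z\<in>T ` J. z < x)" using mid[of _ y x] xy by fastforce
      then have "v x = 0" using 3 unfolding v_def by auto
      moreover have "v y = M + U y" using 3 by (simp add: v_def)
      ultimately show ?thesis using k0[OF 3(1)] kM[OF 3(2)] Ub[OF 3(2)] by simp
    next
      case 4
      have "\<exists>z\<in>T ` J. z < y" if "\<exists>z\<in>T ` J. z < x" using that xy less_le_trans by blast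
      then have "v x \<le> v y" using 4 nn by (cases "\<exists>z\<in>T ` J. z < x") (auto simp: v_def)
      then show ?thesis using k0[OF 4(1)] k0[OF 4(2)] by simp
    qed
  next
    fix x show "0 \<le> v x" "v x \<le> 2 * M + d" using Ub[of x] nn by (auto simp: v_def)
  qed
qed

section \<open>Expanding maps and their transfer operators\<close>

text \<open>A piecewise \<open>C\<^sup>2\<close> map described by a finite exceptional set \<open>S\<close> and by local conditions off \<open>S\<close>.
Unlike a list of branches, this form is visibly stable under composition: exceptional points are
pulled back and derivatives follow the chain rule.\<close>

definition expanding :: "real \<Rightarrow> real set \<Rightarrow> (real \<Rightarrow> real) \<Rightarrow> bool" where
  "expanding lam S T \<longleftrightarrow> finite S \<and> {0,1} \<subseteq> S \<and> S \<subseteq> {0..1} \<and> T \<in> borel_measurable borel \<and> (\<forall>x. T x \<in> {0..1}) \<and>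
     (\<exists>K T''. \<forall>x\<in>{0..1}-S. (T has_real_derivative deriv T x) (at x) \<and> lam \<le> \<bar>deriv T x\<bar> \<and> \<bar>deriv T x\<bar> \<le> K \<and>
        (deriv T has_real_derivative T'' x) (at x) \<and> \<bar>T'' x\<bar> \<le> K)"

text \<open>The Perron-Frobenius operator. Exceptional points do not contribute, even if \<open>T\<close> happens to be
differentiable there.\<close>

definition transfer :: "real set \<Rightarrow> (real \<Rightarrow> real) \<Rightarrow> (real \<Rightarrow> real) \<Rightarrow> real \<Rightarrow> real" where
  "transfer S T f y = (\<Sum>x\<in>{x\<in>{0..1} - S. T x = y}. f x / \<bar>deriv T x\<bar>)"

lemma expandingD:
  assumes "expanding lam S T"
  shows "finite S" "0 \<in> S" "1 \<in> S" "S \<subseteq> {0..1}" "T \<in> borel_measurable borel" "T x \<in> {0..1}"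
    "x \<in> {0..1} - S \<Longrightarrow> (T has_real_derivative deriv T x) (at x)"
    "x \<in> {0..1} - S \<Longrightarrow> lam \<le> \<bar>deriv T x\<bar>"
  using assms unfolding expanding_def by auto

lemma expanding_second_derivative:
  assumes "expanding lam S T"
  shows "\<exists>K T''. \<forall>x\<in>{0..1} - S. \<bar>deriv T x\<bar> \<le> K \<and> (deriv T has_real_derivative T'' x) (at x) \<and> \<bar>T'' x\<bar> \<le> K"
  using assms unfolding expanding_def by blast

lemma expanding_piece_continuous:
  assumes g: "expanding lam S T" and J: "J \<subseteq> {0..1} - S"
  shows "continuous_on J T" "continuous_on J (deriv T)"
proof -
  show "continuous_on J T"
    by (rule continuous_at_imp_continuous_on) (use expandingD(7)[OF g] J DERIV_isCont in blast)
  obtain K T'' where "\<And>x. x \<in> {0..1} - S \<Longrightarrow> (deriv T has_real_derivative T'' x) (at x)"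
    using expanding_second_derivative[OF g] by blast
  then show "continuous_on J (deriv T)"
    using J DERIV_isCont by (intro continuous_at_imp_continuous_on) blast
qed

text \<open>The derivative is continuous and does not vanish on the piece, hence has constant sign there.\<close>

lemma expanding_piece_mono:
  assumes g: "expanding lam S T" and lam: "lam > 0" and J: "J \<subseteq> {0..1} - S" "is_interval J"
  shows "strict_mono_on J T \<or> strict_antimono_on J T" "is_interval (T ` J)" "inj_on T J"
proof -
  have nz: "deriv T x \<noteq> 0" if "x \<in> J" for x using expandingD(8)[OF g, of x] J that lam by auto
  have im: "is_interval (deriv T ` J)"
    using connected_continuous_image[OF expanding_piece_continuous(2)[OF g J(1)]] J(2)
    by (simp add: is_interval_connected_1)
  have "(\<forall>x\<in>J. deriv T x > 0) \<or> (\<forall>x\<in>J. deriv T x < 0)"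
  proof (rule ccontr)
    assume "\<not> ?thesis"
    then obtain x y where xy: "x \<in> J" "y \<in> J" "deriv T x \<le> 0" "0 \<le> deriv T y" by (auto simp: not_less)
    then have "0 \<in> deriv T ` J" using im unfolding is_interval_1 by blast
    then show False using nz by auto
  qed
  then show mono: "strict_mono_on J T \<or> strict_antimono_on J T"
  proof
    assume pos: "\<forall>x\<in>J. deriv T x > 0"
    have "T x < T y" if "x \<in> J" "y \<in> J" "x < y" for x y
    proof (rule DERIV_pos_imp_increasing[OF \<open>x < y\<close>])
      fix z assume "x \<le> z" "z \<le> y"
      then have "z \<in> J" using J(2) that unfolding is_interval_1 by blast
      then show "\<exists>D. (T has_real_derivative D) (at z) \<and> 0 < D" using expandingD(7)[OF g, of z] J(1) pos by blast
    qed
    then show ?thesis by (auto simp: monotone_on_def)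
  next
    assume neg: "\<forall>x\<in>J. deriv T x < 0"
    have "T x > T y" if "x \<in> J" "y \<in> J" "x < y" for x y
    proof (rule DERIV_neg_imp_decreasing[OF \<open>x < y\<close>])
      fix z assume "x \<le> z" "z \<le> y"
      then have "z \<in> J" using J(2) that unfolding is_interval_1 by blast
      then show "\<exists>D. (T has_real_derivative D) (at z) \<and> D < 0" using expandingD(7)[OF g, of z] J(1) neg by blast
    qed
    then show ?thesis by (auto simp: monotone_on_def)
  qed
  show "is_interval (T ` J)"
    using connected_continuous_image[OF expanding_piece_continuous(1)[OF g J(1)]] J(2)
    by (simp add: is_interval_connected_1)
  show "inj_on T J" by (rule strict_mono_or_antimono_inj[OF mono])
qed

lemma expanding_piece_lipschitz:
  assumes g: "expanding lam S T" and lam: "lam > 0"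
  obtains Q where "Q \<ge> 0" "\<And>J x y. J \<subseteq> {0..1} - S \<Longrightarrow> is_interval J \<Longrightarrow> x \<in> J \<Longrightarrow> y \<in> J \<Longrightarrow> x \<le> y \<Longrightarrow>
    \<bar>1 / \<bar>deriv T y\<bar> - 1 / \<bar>deriv T x\<bar>\<bar> \<le> Q * (y - x)"
proof -
  obtain K T'' where K: "\<And>x. x \<in> {0..1} - S \<Longrightarrow> \<bar>deriv T x\<bar> \<le> K"
    "\<And>x. x \<in> {0..1} - S \<Longrightarrow> (deriv T has_real_derivative T'' x) (at x)"
    "\<And>x. x \<in> {0..1} - S \<Longrightarrow> \<bar>T'' x\<bar> \<le> K"
    using expanding_second_derivative[OF g] by blast
  show thesis
  proof (rule that[of "\<bar>K\<bar> / lam\<^sup>2"])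
    fix J x y assume J: "J \<subseteq> {0..1} - S" "is_interval J" and x: "x \<in> J" and y: "y \<in> J" and xy: "x \<le> y"
    have sub: "{x..y} \<subseteq> {0..1} - S" 
    proof
      fix z assume "z \<in> {x..y}"
      then have "z \<in> J" using J(2) x y unfolding is_interval_1 by fastforce
      then show "z \<in> {0..1} - S" using J(1) by blast
    qed
    have "norm (deriv T y - deriv T x) \<le> \<bar>K\<bar> * norm (y - x)"
    proof (rule field_differentiable_bound[of "{x..y}" "deriv T" T''])
      fix z assume "z \<in> {x..y}"
      then have z: "z \<in> {0..1} - S" using sub by blast
      show "(deriv T has_field_derivative T'' z) (at z within {x..y})"
        using K(2)[OF z] has_field_derivative_at_within by blast
      show "norm (T'' z) \<le> \<bar>K\<bar>" using K(3)[OF z] by simp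
    qed (use xy in auto)
    then have d: "\<bar>deriv T y - deriv T x\<bar> \<le> \<bar>K\<bar> * (y - x)" using xy by simp
    have lx: "lam \<le> \<bar>deriv T x\<bar>" and ly: "lam \<le> \<bar>deriv T y\<bar>" using expandingD(8)[OF g] J x y by auto
    have "1 / \<bar>deriv T y\<bar> - 1 / \<bar>deriv T x\<bar> = (\<bar>deriv T x\<bar> - \<bar>deriv T y\<bar>) / (\<bar>deriv T x\<bar> * \<bar>deriv T y\<bar>)"
      using lx ly lam by (auto simp: field_simps)
    also have "\<bar>\<dots>\<bar> = \<bar>\<bar>deriv T x\<bar> - \<bar>deriv T y\<bar>\<bar> / (\<bar>deriv T x\<bar> * \<bar>deriv T y\<bar>)" by (simp add: abs_mult)
    also have "\<dots> \<le> (\<bar>K\<bar> * (y - x)) / (lam * lam)"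
      by (intro frac_le mult_mono) (use d lx ly lam xy in auto)
    finally show "\<bar>1 / \<bar>deriv T y\<bar> - 1 / \<bar>deriv T x\<bar>\<bar> \<le> \<bar>K\<bar> / lam\<^sup>2 * (y - x)"
      by (simp add: power2_eq_square)
  qed simp
qed

section \<open>Partitions\<close>

definition partition01 :: "nat \<Rightarrow> (nat \<Rightarrow> real) \<Rightarrow> bool" where
  "partition01 k a \<longleftrightarrow> a 0 = 0 \<and> a k = 1 \<and> (\<forall>i<k. a i < a (Suc i))"

lemma partition01_mono:
  assumes "partition01 k a" "i \<le> j" "j \<le> k" shows "a i \<le> a j"
  using assms(2,3)
proof (induction j rule: dec_induct)
  case (step j)
  then show ?case using assms(1) unfolding partition01_def by (meson Suc_le_lessD less_imp_le order_trans)
qed simp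

lemma partition01_range: "partition01 k a \<Longrightarrow> i \<le> k \<Longrightarrow> a i \<in> {0..1}"
  using partition01_mono[of k a 0 i] partition01_mono[of k a i k] by (simp add: partition01_def)

lemma partition01_cover:
  assumes "partition01 k a" "0 \<le> x" "x < 1"
  obtains i where "i < k" "a i \<le> x" "x < a (Suc i)"
proof -
  have "\<exists>i<j. a i \<le> x \<and> x < a (Suc i)" if "x < a j" for j
    using that
  proof (induction j)
    case 0 then show ?case using assms by (simp add: partition01_def)
  next
    case (Suc j) then show ?case by (cases "x < a j") (auto intro: less_SucI)
  qed
  from this[of k] show thesis using that assms by (auto simp: partition01_def)
qed

lemma partition01_disjoint:
  assumes "partition01 k a" "i < k" "j < k" "i \<noteq> j"
  shows "{a i..<a (Suc i)} \<inter> {a j..<a (Suc j)} = {}"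
proof -
  have "i < j \<or> j < i" using assms by linarith
  then show ?thesis
  proof
    assume "i < j" then show ?thesis using partition01_mono[OF assms(1), of "Suc i" j] assms by auto
  next
    assume "j < i" then show ?thesis using partition01_mono[OF assms(1), of "Suc j" i] assms by auto
  qed
qed

lemma partition01_gap:
  assumes p: "partition01 k a" "i < k" "s \<in> a ` {..k}" shows "\<not> (a i < s \<and> s < a (Suc i))"
proof
  assume s: "a i < s \<and> s < a (Suc i)"
  obtain j where j: "j \<le> k" "s = a j" using p by auto
  show False using partition01_mono[OF p(1), of j i] partition01_mono[OF p(1), of "Suc i" j] j s p(2)
    by (cases "j \<le> i") auto
qed

lemma ex_partition01:
  assumes A: "finite A" "0 \<in> A" "1 \<in> A" "A \<subseteq> {0..1}"
  obtains k a where "partition01 k a" "A = a ` {..k}"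
proof -
  define xs where "xs = sorted_list_of_set A"
  have xs: "set xs = A" "sorted xs" "distinct xs" unfolding xs_def using A by auto
  have st: "sorted_wrt (<) xs" unfolding xs_def by simp
  define k where "k = length xs - 1"
  have ne: "xs \<noteq> []" using xs A by auto
  have lk: "length xs = Suc k" using ne by (simp add: k_def)
  have img: "A = (!) xs ` {..k}" using xs(1) lk by (auto simp: set_conv_nth image_iff less_Suc_eq_le)
  have mono: "i < j \<Longrightarrow> j \<le> k \<Longrightarrow> xs ! i < xs ! j" for i j
    using st lk by (auto simp: sorted_wrt_nth_less)
  have "xs ! 0 = 0"
  proof -
    obtain j where j: "j \<le> k" "xs ! j = 0" using A(2) img by auto
    have "xs ! 0 \<ge> 0" using img A(4) by auto
    then show ?thesis using mono[of 0 j] j by (cases "j = 0") auto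
  qed
  moreover have "xs ! k = 1"
  proof -
    obtain j where j: "j \<le> k" "xs ! j = 1" using A(3) img by auto
    have "xs ! k \<le> 1" using img A(4) by auto
    then show ?thesis using mono[of j k] j by (cases "j = k") auto
  qed
  ultimately have "partition01 k ((!) xs)" using mono by (auto simp: partition01_def)
  then show thesis using that img by blast
qed

text \<open>Arbitrary refinement is harmless in the Lasota-Yorke inequality: it enlarges the factor of the
integral but not the factor of the variation.\<close>

lemma ex_fine_partition01:
  assumes S: "finite S" "0 \<in> S" "1 \<in> S" "S \<subseteq> {0..1}" and d: "d > 0"
  obtains k a where "partition01 k a" "S \<subseteq> a ` {..k}" "\<And>i. i < k \<Longrightarrow> a (Suc i) - a i \<le> d"
proof -
  obtain m :: nat where m: "m > 0" "1 / real m < d"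
    using d reals_Archimedean[OF d] by (metis inverse_eq_divide of_nat_0_less_iff zero_less_Suc)
  define A where "A = S \<union> (\<lambda>j. real j / real m) ` {..m}"
  have "finite A" "0 \<in> A" "1 \<in> A" "A \<subseteq> {0..1}" using S m by (auto simp: A_def divide_simps)
  then obtain k a where ka: "partition01 k a" "A = a ` {..k}" using ex_partition01 by metis
  show thesis
  proof (rule that[OF ka(1)])
    show "S \<subseteq> a ` {..k}" using ka(2) A_def by blast
    fix i assume i: "i < k"
    show "a (Suc i) - a i \<le> d"
    proof (rule ccontr)
      assume c: "\<not> ?thesis"
      define j where "j = Suc (nat \<lfloor>real m * a i\<rfloor>)"
      have ai: "0 \<le> a i" "a (Suc i) \<le> 1"
        using partition01_range[OF ka(1), of i] partition01_range[OF ka(1), of "Suc i"] i by auto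
      have j1: "real m * a i < real j" "real j \<le> real m * a i + 1" unfolding j_def using ai by (auto; linarith)+
      then have j: "a i < real j / real m" "real j / real m \<le> a i + 1 / real m"
        using m by (auto simp: field_simps)
      moreover have "a i + 1 / real m < a (Suc i)" using c m by linarith
      ultimately have lt: "a i < real j / real m \<and> real j / real m < a (Suc i)" by linarith
      then have "real j / real m \<le> 1" using ai by linarith
      then have "j \<le> m" using m by (simp add: divide_simps)
      then have "real j / real m \<in> a ` {..k}" using ka(2) A_def by auto
      then show False using partition01_gap[OF ka(1) i] lt by blast
    qed
  qed
qed

text \<open>Break points of the partition that are not exceptional stay in their piece, so that the pieces
exhaust the complement of \<open>S\<close> exactly. A piece is therefore half-open or open.\<close>

definition piece :: "real set \<Rightarrow> (nat \<Rightarrow> real) \<Rightarrow> nat \<Rightarrow> real set" where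
  "piece S a i = {a i..<a (Suc i)} - S"

lemma piece_subset:
  assumes "partition01 k a" "i < k" shows "piece S a i \<subseteq> {0..1} - S"
  using partition01_range[OF assms(1), of i] partition01_range[OF assms(1), of "Suc i"] assms(2)
  by (auto simp: piece_def)

lemma piece_interval:
  assumes "partition01 k a" "S \<subseteq> a ` {..k}" "i < k" shows "is_interval (piece S a i)"
proof -
  have "s \<notin> S" if "a i < s" "s < a (Suc i)" for s using partition01_gap[OF assms(1,3)] assms(2) that by blast
  then have "piece S a i = (if a i \<in> S then {a i<..<a (Suc i)} else {a i..<a (Suc i)})"
    unfolding piece_def by (auto simp: le_less)
  then show ?thesis by (simp add: is_interval_1)
qed

lemma piece_borel: "finite S \<Longrightarrow> piece S a i \<in> sets borel"
  unfolding piece_def by (intro sets.Diff) (auto intro: borel_closed finite_imp_closed)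

lemma pieces_union:
  assumes "partition01 k a" "1 \<in> S" shows "(\<Union>i<k. piece S a i) = {0..1} - S"
proof
  show "(\<Union>i<k. piece S a i) \<subseteq> {0..1} - S" using piece_subset[OF assms(1)] by blast
  show "{0..1} - S \<subseteq> (\<Union>i<k. piece S a i)"
  proof
    fix x assume x: "x \<in> {0..1} - S"
    then have "x \<noteq> 1" using assms(2) by auto
    then obtain i where "i < k" "a i \<le> x" "x < a (Suc i)" using partition01_cover[OF assms(1), of x] x by auto
    then show "x \<in> (\<Union>i<k. piece S a i)" using x by (auto simp: piece_def)
  qed
qed

lemma pieces_disjoint:
  assumes "partition01 k a" "i < k" "j < k" "i \<noteq> j" shows "piece S a i \<inter> piece S a j = {}"
  using partition01_disjoint[OF assms] by (auto simp: piece_def)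

lemma finite_fibre_inj: "inj_on T J \<Longrightarrow> finite {x\<in>J. T x = y}"
proof -
  assume i: "inj_on T J"
  have "finite (T ` {x\<in>J. T x = y})" by (rule finite_subset[of _ "{y}"]) auto
  moreover have "inj_on T {x\<in>J. T x = y}" by (rule inj_on_subset[OF i]) blast
  ultimately show ?thesis by (rule finite_imageD)
qed

lemma transfer_pieces:
  assumes g: "expanding lam S T" "lam > 0" and p: "partition01 k a" "S \<subseteq> a ` {..k}"
  shows "transfer S T f y = (\<Sum>i<k. \<Sum>x\<in>{x\<in>piece S a i. T x = y}. f x / \<bar>deriv T x\<bar>)"
    and "finite {x\<in>{0..1} - S. T x = y}"
proof -
  have inj: "i < k \<Longrightarrow> inj_on T (piece S a i)" for i
    using expanding_piece_mono(3)[OF g piece_subset[OF p(1)] piece_interval[OF p]] .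
  have un: "{x\<in>{0..1} - S. T x = y} = (\<Union>i<k. {x\<in>piece S a i. T x = y})"
    using pieces_union[OF p(1) expandingD(3)[OF g(1)]] by blast
  show "transfer S T f y = (\<Sum>i<k. \<Sum>x\<in>{x\<in>piece S a i. T x = y}. f x / \<bar>deriv T x\<bar>)"
    unfolding transfer_def un
  proof (rule sum.UNION_disjoint)
    show "\<forall>i\<in>{..<k}. finite {x \<in> piece S a i. T x = y}" using finite_fibre_inj[OF inj] by simp
    show "\<forall>i\<in>{..<k}. \<forall>j\<in>{..<k}. i \<noteq> j \<longrightarrow> {x \<in> piece S a i. T x = y} \<inter> {x \<in> piece S a j. T x = y} = {}"
    proof (intro ballI impI)
      fix i j assume "i \<in> {..<k}" "j \<in> {..<k}" "i \<noteq> j"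
      then have "piece S a i \<inter> piece S a j = {}" by (intro pieces_disjoint[OF p(1)]) auto
      then show "{x \<in> piece S a i. T x = y} \<inter> {x \<in> piece S a j. T x = y} = {}" by blast
    qed
  qed simp
  show "finite {x\<in>{0..1} - S. T x = y}" unfolding un by (intro finite_UN_I finite_fibre_inj inj) auto
qed

lemma expanding_finite_fibre:
  assumes "expanding lam S T" "lam > 0" shows "finite {x\<in>{0..1} - S. T x = y}"
proof -
  obtain k a where ka: "partition01 k a" "S = a ` {..k}"
    by (rule ex_partition01[OF expandingD(1-4)[OF assms(1)]])
  show ?thesis by (rule transfer_pieces(2)[OF assms ka(1)]) (simp add: ka(2))
qed

section \<open>Lasota--Yorke inequality\<close>

lemma sum_indicator_partition01_le:
  assumes "partition01 k a" "b \<ge> (0::real)"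
  shows "(\<Sum>i<k. indicator {a i..<a (Suc i)} x * b) \<le> b"
proof (cases "\<exists>i<k. x \<in> {a i..<a (Suc i)}")
  case True
  then obtain i where i: "i < k" "x \<in> {a i..<a (Suc i)}" by blast
  have "(\<Sum>j<k. indicator {a j..<a (Suc j)} x * b) = (\<Sum>j\<in>{i}. indicator {a j..<a (Suc j)} x * b)"
  proof (rule sum.mono_neutral_right)
    show "\<forall>j\<in>{..<k} - {i}. indicator {a j..<a (Suc j)} x * b = 0"
    proof
      fix j assume j: "j \<in> {..<k} - {i}"
      have "x \<notin> {a j..<a (Suc j)}" using partition01_disjoint[OF assms(1), of i j] i j by auto
      then show "indicator {a j..<a (Suc j)} x * b = 0" by simp
    qed
  qed (use i in auto)
  also have "\<dots> = b" using i(2) by simp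
  finally show ?thesis by (rule eq_refl)
next
  case False
  then have "(\<Sum>i<k. indicator {a i..<a (Suc i)} x * b) = (\<Sum>i<k. 0)"
    by (intro sum.cong) (auto simp: indicator_def)
  also have "\<dots> \<le> b" using assms(2) by simp
  finally show ?thesis .
qed

text \<open>On a short piece of length \<open>l\<close>, where the majorant of \<open>f\<close> grows by \<open>D\<close>, the supremum of \<open>\<bar>f\<bar>\<close> is at
most \<open>D\<close> plus the average of \<open>\<bar>f\<bar>\<close>. The branch contributes \<open>D / lam\<close> from the interior, twice the
supremum over \<open>lam\<close> from the two jumps, and an error proportional to \<open>l\<close> from the Lipschitz weight
\<open>1 / \<bar>T'\<bar>\<close>. The first two account for the factor \<open>3 / lam\<close>; a fine partition makes the last one
smaller than \<open>e\<close>.\<close>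

lemma transfer_bvar:
  assumes g: "expanding lam S T" and lam: "lam > 0" and e: "e > 0"
  shows "\<exists>C\<ge>0. \<forall>f B. bvar f B \<longrightarrow> supp01 f \<longrightarrow>
    bvar (transfer S T f) ((3 / lam + e) * B + C * (LBINT x. \<bar>f x\<bar>))"
proof -
  obtain Q where Q: "Q \<ge> 0" "\<And>J x y. J \<subseteq> {0..1} - S \<Longrightarrow> is_interval J \<Longrightarrow> x \<in> J \<Longrightarrow> y \<in> J \<Longrightarrow> x \<le> y \<Longrightarrow>
    \<bar>1 / \<bar>deriv T y\<bar> - 1 / \<bar>deriv T x\<bar>\<bar> \<le> Q * (y - x)" using expanding_piece_lipschitz[OF g lam] by blast
  \<comment> \<open>mesh for which the variation of the weight on a piece is at most \<open>e\<close>\<close>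
  define d where "d = e / (Q + 1)"
  have d: "d > 0" "Q * d \<le> e" using e Q(1) by (auto simp: d_def field_simps)
  obtain k a where p: "partition01 k a" "S \<subseteq> a ` {..k}" and fine: "\<And>i. i < k \<Longrightarrow> a (Suc i) - a i \<le> d"
    by (rule ex_fine_partition01[OF expandingD(1-4)[OF g] d(1)]) blast
  define l where "l i = a (Suc i) - a i" for i
  have l: "l i > 0" "l i \<le> d" if "i < k" for i
    using fine[OF that] p(1) that by (auto simp: l_def partition01_def)
  define Ci where "Ci i = 2 / (lam * l i) + Q" for i
  define C where "C = (\<Sum>i<k. Ci i)"
  have Ci: "0 \<le> Ci i" if "i < k" for i using l(1)[OF that] lam Q(1) by (simp add: Ci_def)
  have CiC: "Ci i \<le> C" if "i < k" for i unfolding C_def using Ci that by (intro member_le_sum) auto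
  show ?thesis
  proof (intro exI[of _ C] conjI allI impI)
    show "0 \<le> C" unfolding C_def using Ci by (intro sum_nonneg) auto
    fix f B assume fB: "bvar f B" and sf: "supp01 f"
    obtain v where v: "\<And>x y. x \<le> y \<Longrightarrow> \<bar>f y - f x\<bar> \<le> v y - v x" "\<And>x. 0 \<le> v x \<and> v x \<le> B"
      using fB unfolding bvar_def by blast
    have intf: "integrable lborel (\<lambda>x. \<bar>f x\<bar>)" using bvar_integrable[OF fB sf] by simp
    have intfi: "integrable lborel (\<lambda>x. indicator {a i..<a (Suc i)} x * \<bar>f x\<bar>)" for i
      using integrable_mult_indicator[OF _ intf, of "{a i..<a (Suc i)}"] by simp
    define I where "I i = (LBINT x. indicator {a i..<a (Suc i)} x * \<bar>f x\<bar>)" for i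
    define D where "D i = v (a (Suc i)) - v (a i)" for i
    have I0: "I i \<ge> 0" for i unfolding I_def by (intro integral_nonneg_AE) auto
    have D0: "D i \<ge> 0" if "i < k" for i using v(1)[of "a i" "a (Suc i)"] l(1)[OF that] by (simp add: D_def l_def)
    have sup: "\<bar>f x\<bar> \<le> I i / l i + D i" if i: "i < k" and x: "x \<in> {a i..<a (Suc i)}" for i x
    proof -
      have pt: "\<bar>f x\<bar> \<le> \<bar>f z\<bar> + D i" if z: "z \<in> {a i..<a (Suc i)}" for z
        using oscillation_le[where f = f and v = v and a = "a i" and x = x and b = "a (Suc i)" and z = z, OF v(1)] x z by (simp add: D_def)
      have "(LBINT z. indicator {a i..<a (Suc i)} z * (\<bar>f x\<bar> - D i)) \<le> I i"
        unfolding I_def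
      proof (rule integral_mono[OF _ intfi])
        show "integrable lborel (\<lambda>z. indicator {a i..<a (Suc i)} z * (\<bar>f x\<bar> - D i))"
          using l(1)[OF i] by (intro integrable_mult_left integrable_real_indicator) (auto simp: l_def)
        fix z show "indicator {a i..<a (Suc i)} z * (\<bar>f x\<bar> - D i) \<le> indicator {a i..<a (Suc i)} z * \<bar>f z\<bar>"
          using pt[of z] by (auto simp: indicator_def)
      qed
      moreover have "(LBINT z. indicator {a i..<a (Suc i)} z * (\<bar>f x\<bar> - D i)) = l i * (\<bar>f x\<bar> - D i)"
        using l(1)[OF i] by (simp add: l_def)
      ultimately show ?thesis using l(1)[OF i] by (simp add: field_simps)
    qed
    define Fi where "Fi i y = (\<Sum>x\<in>{x\<in>piece S a i. T x = y}. f x / \<bar>deriv T x\<bar>)" for i y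
    have Fi: "bvar (Fi i) ((3 / lam + e) * D i + C * I i)" if i: "i < k" for i
    proof -
      let ?J = "piece S a i"
      have J: "?J \<subseteq> {0..1} - S" "is_interval ?J" using piece_subset[OF p(1) i] piece_interval[OF p i] by auto
      define s where "s = I i / l i + D i"
      have s0: "0 \<le> s" using I0[of i] D0[OF i] l(1)[OF i] by (simp add: s_def)
      have fs: "x \<in> ?J \<Longrightarrow> \<bar>f x\<bar> \<le> s" for x using sup[OF i, of x] by (auto simp: piece_def s_def)
      have dl: "x \<in> ?J \<Longrightarrow> lam \<le> \<bar>deriv T x\<bar>" for x using expandingD(8)[OF g, of x] J(1) by blast
      define u where "u x = v x / lam + s * Q * (x - a i)" for x
      have "bvar (Fi i) (2 * (s / lam) + (D i / lam + s * Q * l i))"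
        unfolding Fi_def
      proof (rule bvar_fibre_sum[where u = u and m = "v (a i) / lam"])
        show "strict_mono_on ?J T \<or> strict_antimono_on ?J T" "is_interval (T ` ?J)"
          using expanding_piece_mono[OF g lam J] by auto
        show "0 \<le> s / lam" "0 \<le> D i / lam + s * Q * l i" using s0 lam D0[OF i] l(1)[OF i] Q(1) by auto
      next
        fix x assume x: "x \<in> ?J"
        have "\<bar>f x / \<bar>deriv T x\<bar>\<bar> = \<bar>f x\<bar> / \<bar>deriv T x\<bar>" by simp
        also have "\<dots> \<le> s / lam" using fs[OF x] dl[OF x] lam s0 by (intro frac_le) auto
        finally show "\<bar>f x / \<bar>deriv T x\<bar>\<bar> \<le> s / lam" .
        have xi: "a i \<le> x" "x \<le> a (Suc i)" using x by (auto simp: piece_def)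
        have vx: "v (a i) \<le> v x" "v x \<le> v (a (Suc i))" using v(1)[OF xi(1)] v(1)[OF xi(2)] by linarith+
        have "s * Q * (x - a i) \<le> s * Q * l i" using xi s0 Q(1) by (intro mult_left_mono) (auto simp: l_def)
        moreover have "0 \<le> s * Q * (x - a i)" using xi s0 Q(1) by simp
        moreover have "v (a i) / lam \<le> v x / lam" "v x / lam \<le> v (a i) / lam + D i / lam"
          using vx lam by (simp_all add: D_def divide_right_mono add_divide_distrib[symmetric])
        ultimately show "v (a i) / lam \<le> u x \<and> u x \<le> v (a i) / lam + (D i / lam + s * Q * l i)"
          unfolding u_def by linarith
      next
        fix x y assume x: "x \<in> ?J" and y: "y \<in> ?J" and xy: "x \<le> y"
        have "f y / \<bar>deriv T y\<bar> - f x / \<bar>deriv T x\<bar>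
          = (f y - f x) / \<bar>deriv T y\<bar> + f x * (1 / \<bar>deriv T y\<bar> - 1 / \<bar>deriv T x\<bar>)"
          by (simp add: algebra_simps diff_divide_distrib)
        also have "\<bar>\<dots>\<bar> \<le> \<bar>f y - f x\<bar> / \<bar>deriv T y\<bar> + \<bar>f x\<bar> * \<bar>1 / \<bar>deriv T y\<bar> - 1 / \<bar>deriv T x\<bar>\<bar>"
          by (rule order_trans[OF abs_triangle_ineq]) (simp add: abs_mult)
        also have "\<bar>f y - f x\<bar> / \<bar>deriv T y\<bar> \<le> (v y - v x) / lam"
          using v(1)[OF xy] dl[OF y] lam by (intro frac_le) auto
        also have "\<bar>f x\<bar> * \<bar>1 / \<bar>deriv T y\<bar> - 1 / \<bar>deriv T x\<bar>\<bar> \<le> s * (Q * (y - x))"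
          by (intro mult_mono fs x Q(2)[OF J x y xy] s0) simp
        finally show "\<bar>f y / \<bar>deriv T y\<bar> - f x / \<bar>deriv T x\<bar>\<bar> \<le> u y - u x"
          unfolding u_def by (simp add: algebra_simps diff_divide_distrib)
      qed
      then show ?thesis
      proof (rule bvar_mono)
        have "2 * (s / lam) + (D i / lam + s * Q * l i) = (3 / lam + Q * l i) * D i + Ci i * I i"
          using l(1)[OF i] lam unfolding s_def Ci_def by (simp add: field_simps)
        also have "\<dots> \<le> (3 / lam + e) * D i + C * I i"
        proof (intro add_mono mult_right_mono D0[OF i] I0 CiC[OF i])
          have "Q * l i \<le> Q * d" using l(2)[OF i] Q(1) by (rule mult_left_mono)
          then show "Q * l i \<le> e" using d(2) by linarith
        qed simp
        finally show "2 * (s / lam) + (D i / lam + s * Q * l i) \<le> (3 / lam + e) * D i + C * I i" .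
      qed
    qed
    have tr: "transfer S T f = (\<lambda>y. \<Sum>i<k. Fi i y)"
      using transfer_pieces(1)[OF g lam p] by (auto simp: Fi_def)
    have "bvar (transfer S T f) (\<Sum>i<k. (3 / lam + e) * D i + C * I i)"
      unfolding tr by (rule bvar_sum) (use Fi in auto)
    then show "bvar (transfer S T f) ((3 / lam + e) * B + C * (LBINT x. \<bar>f x\<bar>))"
    proof (rule bvar_mono)
      have "(\<Sum>i<k. D i) = v (a k) - v (a 0)" unfolding D_def by (rule sum_lessThan_telescope)
      then have sD: "(\<Sum>i<k. D i) \<le> B" using v(2)[of "a k"] v(2)[of "a 0"] by linarith
      have "(\<Sum>i<k. I i) = (LBINT x. (\<Sum>i<k. indicator {a i..<a (Suc i)} x * \<bar>f x\<bar>))"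
        unfolding I_def by (rule Bochner_Integration.integral_sum[symmetric]) (rule intfi)
      also have "\<dots> \<le> (LBINT x. \<bar>f x\<bar>)"
        by (intro integral_mono intf Bochner_Integration.integrable_sum intfi sum_indicator_partition01_le[OF p(1)]) auto
      finally have sI: "(\<Sum>i<k. I i) \<le> (LBINT x. \<bar>f x\<bar>)" .
      show "(\<Sum>i<k. (3 / lam + e) * D i + C * I i) \<le> (3 / lam + e) * B + C * (LBINT x. \<bar>f x\<bar>)"
        unfolding sum.distrib sum_distrib_left[symmetric]
        using sD sI lam e \<open>0 \<le> C\<close> by (intro add_mono mult_left_mono) auto
    qed
  qed
qed

section \<open>Duality\<close>

text \<open>Measurability comes from the monotone inverse branch, duality from the one-dimensional change of
variables formula.\<close>

lemma fibre_sum_change_of_variables: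
  fixes T F f u :: "real \<Rightarrow> real"
  assumes g: "expanding lam S T" and lam: "lam > 0" and J: "J \<subseteq> {0..1} - S" "is_interval J" "J \<in> sets borel"
    and f: "f \<in> borel_measurable borel" "\<And>x. \<bar>f x\<bar> \<le> B"
    and u: "u \<in> borel_measurable borel" "\<And>x. \<bar>u x\<bar> \<le> U"
  defines "h \<equiv> \<lambda>y. \<Sum>x\<in>{x\<in>J. T x = y}. f x / \<bar>deriv T x\<bar>"
  shows "h \<in> borel_measurable borel" "\<bar>h y\<bar> \<le> B / lam" "supp01 h"
    "(LBINT y. h y * u y) = (LBINT x. indicator J x * (f x * u (T x)))"
proof -
  note mono = expanding_piece_mono[OF g lam J(1,2)]
  let ?p = "the_inv_into J T" and ?K = "T ` J"
  have hK: "h y = (if y \<in> ?K then f (?p y) / \<bar>deriv T (?p y)\<bar> else 0)" for y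
    unfolding h_def by (rule fibre_sum_inj[OF mono(3)])
  have pJ: "y \<in> ?K \<Longrightarrow> ?p y \<in> J" for y using the_inv_into_into[OF mono(3)] by blast
  have Tp: "y \<in> ?K \<Longrightarrow> T (?p y) = y" for y using f_the_inv_into_f[OF mono(3)] by blast
  have pT: "x \<in> J \<Longrightarrow> ?p (T x) = x" for x using the_inv_into_f_f[OF mono(3)] by blast
  have dl: "x \<in> J \<Longrightarrow> lam \<le> \<bar>deriv T x\<bar>" for x using expandingD(8)[OF g, of x] J(1) by blast
  have Kb: "?K \<in> sets borel" using mono(2) by (rule real_interval_borel_measurable)
  have B0: "0 \<le> B" using f(2)[of 0] by linarith
  have pm: "?p \<in> borel_measurable (restrict_space borel ?K)"
  proof (cases "strict_mono_on J T")
    case True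
    have "mono_on ?K ?p"
    proof (rule mono_onI)
      fix x y assume *: "x \<in> ?K" "y \<in> ?K" "x \<le> y"
      show "?p x \<le> ?p y"
        using monotone_onD[OF True pJ[OF *(2)] pJ[OF *(1)]] Tp[OF *(1)] Tp[OF *(2)] *(3) by linarith
    qed
    then show ?thesis by (rule borel_measurable_mono_on_fnc)
  next
    case False
    then have an: "strict_antimono_on J T" using mono(1) by blast
    have "mono_on ?K (\<lambda>y. - ?p y)"
    proof (rule mono_onI)
      fix x y assume *: "x \<in> ?K" "y \<in> ?K" "x \<le> y"
      show "- ?p x \<le> - ?p y"
        using monotone_onD[OF an pJ[OF *(1)] pJ[OF *(2)]] Tp[OF *(1)] Tp[OF *(2)] *(3) by linarith
    qed
    then have "(\<lambda>y. - ?p y) \<in> borel_measurable (restrict_space borel ?K)" by (rule borel_measurable_mono_on_fnc)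
    then show ?thesis by simp
  qed
  define G where "G x = f x / \<bar>indicator J x * deriv T x\<bar>" for x
  have "(\<lambda>x. indicator J x *\<^sub>R deriv T x) \<in> borel_measurable borel"
    by (rule borel_measurable_continuous_on_indicator[OF J(3) expanding_piece_continuous(2)[OF g J(1)]])
  then have Gm: "G \<in> borel_measurable borel" unfolding G_def using f(1) by simp
  have "(\<lambda>y. G (?p y)) \<in> borel_measurable (restrict_space borel ?K)"
    using measurable_compose[OF pm Gm] .
  then have "(\<lambda>y. indicator ?K y *\<^sub>R G (?p y)) \<in> borel_measurable borel"
    using borel_measurable_restrict_space_iff[of ?K borel "\<lambda>y. G (?p y)"] Kb by simp
  moreover have "h = (\<lambda>y. indicator ?K y *\<^sub>R G (?p y))"
    using pJ by (auto simp: hK G_def indicator_def fun_eq_iff)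
  ultimately show hm: "h \<in> borel_measurable borel" by simp
  have hb: "\<bar>h y\<bar> \<le> B / lam" for y
  proof (cases "y \<in> ?K")
    case True
    have "\<bar>h y\<bar> = \<bar>f (?p y)\<bar> / \<bar>deriv T (?p y)\<bar>" using True by (simp add: hK)
    also have "\<dots> \<le> B / lam" using f(2) dl[OF pJ[OF True]] lam B0 by (intro frac_le) auto
    finally show ?thesis .
  qed (use B0 lam in \<open>simp add: hK\<close>)
  then show "\<bar>h y\<bar> \<le> B / lam" .
  have "?K \<subseteq> {0..1}" using expandingD(6)[OF g] by blast
  then show hs: "supp01 h" by (auto simp: supp01_def hK)
  have int1: "integrable lborel (\<lambda>y. h y * u y)"
    by (rule bounded_supp01_mult_integrable[OF hm hs hb u])
  then have s1: "set_integrable lborel ?K (\<lambda>y. h y * u y)"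
    unfolding set_integrable_def using Kb by (intro integrable_mult_indicator) auto
  have "set_integrable lebesgue ?K (\<lambda>y. h y * u y)"
    using s1 unfolding set_integrable_def using integrable_completion Kb int1 
    by (smt (verit) borel_measurable_integrable)
  then have abs: "(\<lambda>y. h y * u y) absolutely_integrable_on ?K" .
  have "(\<lambda>x. \<bar>deriv T x\<bar> * (h (T x) * u (T x))) absolutely_integrable_on J \<and>
     integral J (\<lambda>x. \<bar>deriv T x\<bar> * (h (T x) * u (T x))) = integral ?K (\<lambda>y. h y * u y)"
  proof (rule iffD2[OF has_absolute_integral_change_of_variables_1'
        [where S = J and g = T and g' = "deriv T" and f = "\<lambda>y. h y * u y"]])
    show "J \<in> sets lebesgue" using J(3) by simp
    show "(T has_field_derivative deriv T x) (at x within J)" if "x \<in> J" for x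
      using expandingD(7)[OF g, of x] that J(1) has_field_derivative_at_within by blast
    show "inj_on T J" by (rule mono(3))
  qed (use abs in simp)
  then have "integral J (\<lambda>x. \<bar>deriv T x\<bar> * (h (T x) * u (T x))) = integral ?K (\<lambda>y. h y * u y)" by blast
  moreover have "integral J (\<lambda>x. \<bar>deriv T x\<bar> * (h (T x) * u (T x))) = integral J (\<lambda>x. f x * u (T x))"
  proof (rule Henstock_Kurzweil_Integration.integral_cong)
    fix x assume x: "x \<in> J"
    then show "\<bar>deriv T x\<bar> * (h (T x) * u (T x)) = f x * u (T x)"
      using pT[OF x] dl[OF x] lam by (auto simp: hK)
  qed
  moreover have "integral ?K (\<lambda>y. h y * u y) = (LINT y:?K|lborel. h y * u y)"
    using set_borel_integral_eq_integral(2)[OF s1] by simp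
  moreover have "(LINT y:?K|lborel. h y * u y) = (LBINT y. h y * u y)"
    unfolding set_lebesgue_integral_def by (intro Bochner_Integration.integral_cong) (auto simp: hK indicator_def)
  moreover have "integral J (\<lambda>x. f x * u (T x)) = (LINT x:J|lborel. f x * u (T x))"
  proof -
    have "integrable lborel (\<lambda>x. indicator J x *\<^sub>R (f x * u (T x)))"
    proof (rule bounded_supp01_integrable)
      show "(\<lambda>x. indicator J x *\<^sub>R (f x * u (T x))) \<in> borel_measurable borel"
        using J(3) f(1) measurable_compose[OF expandingD(5)[OF g] u(1)] by measurable
      show "supp01 (\<lambda>x. indicator J x *\<^sub>R (f x * u (T x)))" using J(1) by (auto simp: supp01_def indicator_def)
      have "\<bar>f x * u (T x)\<bar> \<le> B * U" for x unfolding abs_mult by (rule mult_mono[OF f(2) u(2)]) (use B0 in auto)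
      moreover have "0 \<le> B * U" using u(2)[of 0] B0 by auto
      ultimately show "\<bar>indicator J x *\<^sub>R (f x * u (T x))\<bar> \<le> B * U" for x by (auto simp: indicator_def)
    qed
    then show ?thesis using set_borel_integral_eq_integral(2)[of J "\<lambda>x. f x * u (T x)"]
      by (simp add: set_integrable_def)
  qed
  ultimately show "(LBINT y. h y * u y) = (LBINT x. indicator J x * (f x * u (T x)))"
    by (simp add: set_lebesgue_integral_def)
qed

lemma transfer_supp01:
  assumes "expanding lam S T" shows "supp01 (transfer S T f)"
proof -
  have "transfer S T f y = 0" if "y \<notin> {0..1}" for y
  proof -
    have "{x \<in> {0..1} - S. T x = y} = {}" using expandingD(6)[OF assms] that by blast
    then show ?thesis unfolding transfer_def by (simp only: sum.empty)
  qed
  then show ?thesis by (simp add: supp01_def)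
qed

lemma transfer_bounded_dual:
  assumes g: "expanding lam S T" and lam: "lam > 0"
  shows "\<exists>k\<ge>0. \<forall>f B. f \<in> borel_measurable borel \<longrightarrow> (\<forall>x. \<bar>f x\<bar> \<le> B) \<longrightarrow> supp01 f \<longrightarrow>
      transfer S T f \<in> borel_measurable borel \<and> (\<forall>y. \<bar>transfer S T f y\<bar> \<le> k * B) \<and>
      (\<forall>u U. u \<in> borel_measurable borel \<longrightarrow> (\<forall>x. \<bar>u x\<bar> \<le> U) \<longrightarrow>
         (LBINT y. transfer S T f y * u y) = (LBINT x. f x * u (T x)))"
proof -
  obtain k a where p: "partition01 k a" and Sa: "S = a ` {..k}" by (rule ex_partition01[OF expandingD(1-4)[OF g]])
  then have p2: "S \<subseteq> a ` {..k}" by simp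
  show ?thesis
  proof (intro exI[of _ "real k / lam"] conjI allI impI)
    show "0 \<le> real k / lam" using lam by simp
    fix f B assume f: "f \<in> borel_measurable borel" "\<forall>x. \<bar>f x\<bar> \<le> B" "supp01 f"
    define Fi where "Fi i y = (\<Sum>x\<in>{x\<in>piece S a i. T x = y}. f x / \<bar>deriv T x\<bar>)" for i y
    have tr: "transfer S T f = (\<lambda>y. \<Sum>i<k. Fi i y)"
      using transfer_pieces(1)[OF g lam p p2] by (auto simp: Fi_def)
    note cv = fibre_sum_change_of_variables[OF g lam piece_subset[OF p] piece_interval[OF p p2] piece_borel[OF expandingD(1)[OF g]]
        f(1) f(2)[rule_format], folded Fi_def]
    have one: "(\<lambda>x. 1::real) \<in> borel_measurable borel" "\<And>x::real. \<bar>1::real\<bar> \<le> 1" by auto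
    have Fm: "Fi i \<in> borel_measurable borel" and Fb: "\<bar>Fi i y\<bar> \<le> B / lam" and Fs: "supp01 (Fi i)" if "i < k" for i y
      using cv(1-3)[OF that that one] by blast+
    show tm: "transfer S T f \<in> borel_measurable borel" unfolding tr
      by (rule borel_measurable_sum) (use Fm in auto)
    show "\<bar>transfer S T f y\<bar> \<le> real k / lam * B" for y
    proof -
      have "\<bar>transfer S T f y\<bar> \<le> (\<Sum>i<k. \<bar>Fi i y\<bar>)" unfolding tr by (rule sum_abs)
      also have "\<dots> \<le> (\<Sum>i<k. B / lam)" by (rule sum_mono) (use Fb in auto)
      finally show ?thesis by simp
    qed
    fix u :: "real \<Rightarrow> real" and U assume u: "u \<in> borel_measurable borel" "\<forall>x. \<bar>u x\<bar> \<le> U"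
    have uT: "(\<lambda>x. u (T x)) \<in> borel_measurable borel" by (rule measurable_compose[OF expandingD(5)[OF g] u(1)])
    have uTm: "(\<lambda>x. f x * u (T x)) \<in> borel_measurable borel" using f(1) uT by measurable
    have int2: "integrable lborel (\<lambda>x. f x * u (T x))"
      by (rule bounded_supp01_mult_integrable[OF f(1,3) _ uT]) (use f(2) u(2) in auto)
    have int1: "integrable lborel (\<lambda>y. Fi i y * u y)" if "i < k" for i
      by (rule bounded_supp01_mult_integrable[OF Fm[OF that] Fs[OF that] Fb[OF that] u(1)]) (use u(2) in auto)
    have "(LBINT y. transfer S T f y * u y) = (\<Sum>i<k. LBINT y. Fi i y * u y)"
      unfolding tr sum_distrib_right by (rule Bochner_Integration.integral_sum) (use int1 in auto)
    also have "\<dots> = (\<Sum>i<k. LBINT x. indicator (piece S a i) x * (f x * u (T x)))"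
      by (rule sum.cong[OF refl], rule cv(4)) (use u in auto)
    also have "\<dots> = (LBINT x. (\<Sum>i<k. indicator (piece S a i) x * (f x * u (T x))))"
      using integrable_mult_indicator[OF _ int2] piece_borel[OF expandingD(1)[OF g]]
      by (intro Bochner_Integration.integral_sum[symmetric]) simp
    also have "\<dots> = (LBINT x. f x * u (T x))"
    proof (rule integral_cong_AE)
      have "AE x in lborel. x \<notin> S"
        using AE_discrete_difference[of S lborel] expandingD(1)[OF g] countable_finite by auto
      then show "AE x in lborel. (\<Sum>i<k. indicator (piece S a i) x * (f x * u (T x))) = f x * u (T x)"
      proof eventually_elim
        case (elim x)
        have "(\<Sum>i<k. indicator (piece S a i) x) = (indicator (\<Union>i<k. piece S a i) x :: real)"
          by (rule indicator_UN_disjoint[symmetric])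
             (auto simp: disjoint_family_on_def intro: pieces_disjoint[OF p, THEN equalityD1, THEN subsetD])
        also have "\<dots> = indicator ({0..1} - S) x" by (simp add: pieces_union[OF p expandingD(3)[OF g]])
        finally have "(\<Sum>i<k. indicator (piece S a i) x * (f x * u (T x))) = indicator ({0..1} - S) x * (f x * u (T x))"
          by (simp add: sum_distrib_right[symmetric])
        also have "\<dots> = f x * u (T x)" using elim f(3) by (auto simp: indicator_def supp01_def)
        finally show ?case .
      qed
      show "(\<lambda>x. \<Sum>i<k. indicator (piece S a i) x * (f x * u (T x))) \<in> borel_measurable lborel"
        using uTm piece_borel[OF expandingD(1)[OF g], of a] by measurable
    qed (use uTm in simp)
    finally show "(LBINT y. transfer S T f y * u y) = (LBINT x. f x * u (T x))" .
  qed
qed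

section \<open>Composition\<close>

text \<open>The equality of operators is exact and not merely almost everywhere: both sides are sums over the
same preimages, grouped by the intermediate point on the left.\<close>

lemma transfer_compose:
  assumes g1: "expanding l1 S1 T1" and l1: "l1 > 0" and g2: "expanding l2 S2 T2" and l2: "l2 > 0"
  defines "S \<equiv> S1 \<union> {x\<in>{0..1} - S1. T1 x \<in> S2}"
  shows "expanding (l1 * l2) S (T2 \<circ> T1)" "transfer S2 T2 (transfer S1 T1 f) = transfer S (T2 \<circ> T1) f"
proof -
  obtain K1 D1 where 1: "\<And>x. x\<in>{0..1} - S1 \<Longrightarrow> \<bar>deriv T1 x\<bar> \<le> K1 \<and> (deriv T1 has_real_derivative D1 x) (at x) \<and> \<bar>D1 x\<bar> \<le> K1"
    using expanding_second_derivative[OF g1] by blast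
  obtain K2 D2 where 2: "\<And>x. x\<in>{0..1} - S2 \<Longrightarrow> \<bar>deriv T2 x\<bar> \<le> K2 \<and> (deriv T2 has_real_derivative D2 x) (at x) \<and> \<bar>D2 x\<bar> \<le> K2"
    using expanding_second_derivative[OF g2] by blast
  have "{x\<in>{0..1} - S1. T1 x \<in> S2} = (\<Union>y\<in>S2. {x\<in>{0..1} - S1. T1 x = y})" by blast
  then have fin: "finite S" unfolding S_def
    using expandingD(1)[OF g1] expandingD(1)[OF g2] expanding_finite_fibre[OF g1 l1] by simp
  have x1: "x \<in> {0..1} - S1" and x2: "T1 x \<in> {0..1} - S2" if "x \<in> {0..1} - S" for x
    using that expandingD(6)[OF g1, of x] by (auto simp: S_def)
  have der: "(T2 \<circ> T1 has_real_derivative deriv T2 (T1 x) * deriv T1 x) (at x)" if "x \<in> {0..1} - S" for x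
    using DERIV_chain[OF expandingD(7)[OF g2 x2[OF that]] expandingD(7)[OF g1 x1[OF that]]] .
  have dd: "deriv (T2 \<circ> T1) x = deriv T2 (T1 x) * deriv T1 x" if "x \<in> {0..1} - S" for x
    using DERIV_imp_deriv[OF der[OF that]] .
  define E where "E x = D2 (T1 x) * deriv T1 x * deriv T1 x + D1 x * deriv T2 (T1 x)" for x
  have S01: "0 \<in> S" "1 \<in> S" using expandingD(2,3)[OF g1] by (auto simp: S_def)
  show "expanding (l1 * l2) S (T2 \<circ> T1)" unfolding expanding_def
  proof (intro conjI exI[of _ "\<bar>K2\<bar> * \<bar>K1\<bar> + \<bar>K2\<bar> * \<bar>K1\<bar> * \<bar>K1\<bar>"] exI[of _ E] ballI)
    show "finite S" by (rule fin)
    show "{0,1} \<subseteq> S" using S01 by simp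
    show "S \<subseteq> {0..1}" using expandingD(4)[OF g1] by (auto simp: S_def)
    show "T2 \<circ> T1 \<in> borel_measurable borel" using measurable_comp[OF expandingD(5)[OF g1] expandingD(5)[OF g2]] .
    show "\<forall>x. (T2 \<circ> T1) x \<in> {0..1}" using expandingD(6)[OF g2] by simp
  next
    fix x assume x: "x \<in> {0..1} - S"
    show "(T2 \<circ> T1 has_real_derivative deriv (T2 \<circ> T1) x) (at x)" using der[OF x] dd[OF x] by simp
    show "l1 * l2 \<le> \<bar>deriv (T2 \<circ> T1) x\<bar>"
      unfolding dd[OF x] abs_mult using expandingD(8)[OF g1 x1[OF x]] expandingD(8)[OF g2 x2[OF x]] l1 l2
      by (subst mult.commute) (intro mult_mono, auto)
    have b1: "\<bar>deriv T1 x\<bar> \<le> \<bar>K1\<bar>" "\<bar>D1 x\<bar> \<le> \<bar>K1\<bar>" using 1[OF x1[OF x]] by linarith+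
    have b2: "\<bar>deriv T2 (T1 x)\<bar> \<le> \<bar>K2\<bar>" "\<bar>D2 (T1 x)\<bar> \<le> \<bar>K2\<bar>" using 2[OF x2[OF x]] by linarith+
    have "\<bar>deriv (T2 \<circ> T1) x\<bar> \<le> \<bar>K2\<bar> * \<bar>K1\<bar>" unfolding dd[OF x] abs_mult using b1 b2 by (intro mult_mono) auto
    then show "\<bar>deriv (T2 \<circ> T1) x\<bar> \<le> \<bar>K2\<bar> * \<bar>K1\<bar> + \<bar>K2\<bar> * \<bar>K1\<bar> * \<bar>K1\<bar>" by (rule order_trans) simp
    have "\<bar>E x\<bar> \<le> \<bar>D2 (T1 x)\<bar> * \<bar>deriv T1 x\<bar> * \<bar>deriv T1 x\<bar> + \<bar>D1 x\<bar> * \<bar>deriv T2 (T1 x)\<bar>"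
      unfolding E_def by (rule order_trans[OF abs_triangle_ineq]) (simp add: abs_mult)
    also have "\<dots> \<le> \<bar>K2\<bar> * \<bar>K1\<bar> * \<bar>K1\<bar> + \<bar>K1\<bar> * \<bar>K2\<bar>" using b1 b2 by (intro add_mono mult_mono) auto
    finally show "\<bar>E x\<bar> \<le> \<bar>K2\<bar> * \<bar>K1\<bar> + \<bar>K2\<bar> * \<bar>K1\<bar> * \<bar>K1\<bar>" by (simp add: algebra_simps)
    have op: "open ({0<..<1} - S)" using fin by (intro open_Diff finite_imp_closed) auto
    have xin: "x \<in> {0<..<1} - S" using x S01 by (auto simp: le_less)
    have "((\<lambda>x. deriv T2 (T1 x) * deriv T1 x) has_real_derivative E x) (at x)"
      unfolding E_def
      using DERIV_mult[OF DERIV_chain2[OF conjunct1[OF conjunct2[OF 2[OF x2[OF x]]]] expandingD(7)[OF g1 x1[OF x]]]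
          conjunct1[OF conjunct2[OF 1[OF x1[OF x]]]]] by simp
    then show "(deriv (T2 \<circ> T1) has_real_derivative E x) (at x)"
      by (rule DERIV_cong_ev[THEN iffD1, rotated -1])
         (use dd in \<open>auto intro!: eventually_mono[OF eventually_nhds_in_open[OF op xin]]\<close>)
  qed
  show "transfer S2 T2 (transfer S1 T1 f) = transfer S (T2 \<circ> T1) f"
  proof
    fix y
    let ?A = "{z\<in>{0..1} - S2. T2 z = y}" and ?B = "\<lambda>z. {x\<in>{0..1} - S1. T1 x = z}"
    have "transfer S2 T2 (transfer S1 T1 f) y = (\<Sum>z\<in>?A. \<Sum>x\<in>?B z. f x / \<bar>deriv T1 x\<bar> / \<bar>deriv T2 z\<bar>)"
      unfolding transfer_def by (simp add: sum_divide_distrib)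
    also have "\<dots> = (\<Sum>(z, x)\<in>Sigma ?A ?B. f x / \<bar>deriv T1 x\<bar> / \<bar>deriv T2 z\<bar>)"
      by (rule sum.Sigma) (use expanding_finite_fibre[OF g1 l1] expanding_finite_fibre[OF g2 l2] in auto)
    also have "\<dots> = (\<Sum>x\<in>{x\<in>{0..1} - S. (T2 \<circ> T1) x = y}. f x / \<bar>deriv (T2 \<circ> T1) x\<bar>)"
    proof (rule sum.reindex_bij_witness[of _ "\<lambda>x. (T1 x, x)" snd])
      fix q assume "q \<in> Sigma ?A ?B"
      then show "(T1 (snd q), snd q) = q" "snd q \<in> {x\<in>{0..1} - S. (T2 \<circ> T1) x = y}" by (auto simp: S_def)
      then have "snd q \<in> {0..1} - S" "fst q = T1 (snd q)" by (auto simp: prod_eq_iff)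
      then show "f (snd q) / \<bar>deriv (T2 \<circ> T1) (snd q)\<bar> = (case q of (z, x) \<Rightarrow> f x / \<bar>deriv T1 x\<bar> / \<bar>deriv T2 z\<bar>)"
        using dd by (simp add: case_prod_unfold abs_mult mult.commute)
    next
      fix x assume "x \<in> {x\<in>{0..1} - S. (T2 \<circ> T1) x = y}"
      then show "snd (T1 x, x) = x" "(T1 x, x) \<in> Sigma ?A ?B"
        using x1[of x] x2[of x] by auto
    qed
    finally show "transfer S2 T2 (transfer S1 T1 f) y = transfer S (T2 \<circ> T1) f y" by (simp add: transfer_def)
  qed
qed

section \<open>Algebra of the transfer operator\<close>

lemma transfer_add: "transfer S T (\<lambda>x. f x + g x) y = transfer S T f y + transfer S T g y"
  unfolding transfer_def by (simp add: add_divide_distrib sum.distrib)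

lemma transfer_cmult: "transfer S T (\<lambda>x. c * f x) y = c * transfer S T f y"
  unfolding transfer_def by (simp add: sum_distrib_left)

lemma transfer_sum: "transfer S T (\<lambda>x. \<Sum>i\<in>I. f i x) y = (\<Sum>i\<in>I. transfer S T (f i) y)"
  unfolding transfer_def sum_divide_distrib by (rule sum.swap)

lemma transfer_suminf:
  assumes "\<And>x. summable (\<lambda>n. f n x)"
  shows "transfer S T (\<lambda>x. \<Sum>n. f n x) y = (\<Sum>n. transfer S T (f n) y)"
    "summable (\<lambda>n. transfer S T (f n) y)"
proof -
  have s: "summable (\<lambda>n. f n x / \<bar>deriv T x\<bar>)" for x using assms by (rule summable_divide)
  show "transfer S T (\<lambda>x. \<Sum>n. f n x) y = (\<Sum>n. transfer S T (f n) y)"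
    unfolding transfer_def suminf_sum[OF s] by (simp add: suminf_divide[OF assms])
  show "summable (\<lambda>n. transfer S T (f n) y)"
    unfolding transfer_def using s by (rule summable_sum)
qed

lemma transfer_nonneg:
  assumes "\<And>x. T x = y \<Longrightarrow> 0 \<le> f x" shows "0 \<le> transfer S T f y"
  unfolding transfer_def using assms by (intro sum_nonneg) auto

lemma transfer_neg: "{y. transfer S T f y < 0} \<subseteq> T ` {x. f x < 0}"
proof
  fix y assume y: "y \<in> {y. transfer S T f y < 0}"
  then have "\<not> (\<forall>x. T x = y \<longrightarrow> 0 \<le> f x)" using transfer_nonneg[of T y f S] by fastforce
  then show "y \<in> T ` {x. f x < 0}" by force
qed

text \<open>Subtracting a constant from \<open>L\<^sup>n f\<close> may produce negative values at the finitely many points where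
a preimage is exceptional; this weaker positivity is preserved by the transfer operator.\<close>

definition ess_nonneg :: "(real \<Rightarrow> real) \<Rightarrow> bool" where
  "ess_nonneg f \<longleftrightarrow> finite {x. f x < 0}"

lemma ess_nonneg_transfer: "ess_nonneg f \<Longrightarrow> ess_nonneg (transfer S T f)"
  unfolding ess_nonneg_def using finite_subset[OF transfer_neg] by blast

lemma ess_nonneg_sum:
  assumes "finite I" "\<And>i. i \<in> I \<Longrightarrow> ess_nonneg (f i)" "\<And>i. i \<in> I \<Longrightarrow> (0::real) \<le> c i"
  shows "ess_nonneg (\<lambda>x. \<Sum>i\<in>I. c i * f i x)"
proof -
  have "{x. (\<Sum>i\<in>I. c i * f i x) < 0} \<subseteq> (\<Union>i\<in>I. {x. f i x < 0})"
  proof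
    fix x assume x: "x \<in> {x. (\<Sum>i\<in>I. c i * f i x) < 0}"
    show "x \<in> (\<Union>i\<in>I. {x. f i x < 0})"
    proof (rule ccontr)
      assume "x \<notin> (\<Union>i\<in>I. {x. f i x < 0})"
      then have "\<forall>i\<in>I. 0 \<le> f i x" by (auto simp: not_less)
      then have "0 \<le> (\<Sum>i\<in>I. c i * f i x)" using assms(3) by (intro sum_nonneg) auto
      with x show False by simp
    qed
  qed
  then show ?thesis unfolding ess_nonneg_def
    by (rule finite_subset) (use assms(1,2) in \<open>auto simp: ess_nonneg_def\<close>)
qed

lemma ess_nonneg_AE: "ess_nonneg f \<Longrightarrow> AE x in lborel. 0 \<le> f x"
proof -
  assume "ess_nonneg f"
  then have "AE x in lborel. x \<notin> {x. f x < 0}"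
    unfolding ess_nonneg_def by (intro AE_discrete_difference) (auto simp: countable_finite)
  then show ?thesis by eventually_elim auto
qed

lemma integral_abs_ess_nonneg:
  assumes "ess_nonneg f" "f \<in> borel_measurable borel"
  shows "(LBINT x. \<bar>f x\<bar>) = (LBINT x. f x)"
  using ess_nonneg_AE[OF assms(1)] assms(2) by (intro integral_cong_AE) auto

lemma integral_abs_le_bound:
  assumes "f \<in> borel_measurable borel" "supp01 f" "\<And>x. \<bar>f x\<bar> \<le> B"
  shows "(LBINT x. \<bar>f x\<bar>) \<le> B"
proof -
  have "(LBINT x. \<bar>f x\<bar>) \<le> (LBINT x. B * indicator {0..1::real} x)"
  proof (rule integral_mono)
    show "integrable lborel (\<lambda>x. \<bar>f x\<bar>)" using bounded_supp01_integrable[OF assms] by simp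
    fix x show "\<bar>f x\<bar> \<le> B * indicator {0..1} x" using assms(2,3) by (auto simp: indicator_def supp01_def)
  qed simp
  then show ?thesis by simp
qed

section \<open>The random system\<close>

text \<open>The maps are defined on the whole line with values in the unit interval. Words are finite lists, read
from left to right, so that \<open>fold T ws\<close> is the composed map.\<close>

locale random_system =
  fixes p :: "'w::finite pmf" and T :: "'w \<Rightarrow> real \<Rightarrow> real" and S :: "'w \<Rightarrow> real set" and lam :: real
  assumes p_pos: "0 < pmf p \<omega>" and expanding: "expanding lam (S \<omega>) (T \<omega>)" and lam: "1 < lam"
    and covering: "\<And>I. is_interval I \<Longrightarrow> I \<subseteq> {0..1} \<Longrightarrow> interior I \<noteq> {} \<Longrightarrow>
      \<exists>ws. ws \<noteq> [] \<and> fold T ws ` I = {0..1}"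
begin

lemma lam0: "0 < lam" using lam by simp

lemma sum_pmf: "(\<Sum>\<omega>\<in>UNIV. pmf p \<omega>) = 1" by (rule sum_pmf_eq_1) auto

definition L :: "(real \<Rightarrow> real) \<Rightarrow> real \<Rightarrow> real" where
  "L f y = (\<Sum>\<omega>\<in>UNIV. pmf p \<omega> * transfer (S \<omega>) (T \<omega>) f y)"

text \<open>The averaged composition operator, dual to \<open>L\<close>.\<close>

definition koopman :: "(real \<Rightarrow> real) \<Rightarrow> real \<Rightarrow> real" where
  "koopman u x = (\<Sum>\<omega>\<in>UNIV. pmf p \<omega> * u (T \<omega> x))"

lemma L_add: "L (\<lambda>x. f x + g x) = (\<lambda>y. L f y + L g y)"
  unfolding L_def by (simp add: transfer_add distrib_left sum.distrib)

lemma L_cmult: "L (\<lambda>x. c * f x) = (\<lambda>y. c * L f y)"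
  unfolding L_def by (auto simp: transfer_cmult sum_distrib_left mult.left_commute)

lemma Ln_add: "(L ^^ n) (\<lambda>x. f x + g x) = (\<lambda>y. (L ^^ n) f y + (L ^^ n) g y)"
  by (induction n) (auto simp: L_add)

lemma Ln_cmult: "(L ^^ n) (\<lambda>x. c * f x) = (\<lambda>y. c * (L ^^ n) f y)"
  by (induction n) (auto simp: L_cmult)

lemma Ln_diff: "(L ^^ n) (\<lambda>x. f x - g x) = (\<lambda>y. (L ^^ n) f y - (L ^^ n) g y)"
  using Ln_add[of n f "\<lambda>x. (-1) * g x"] Ln_cmult[of n "-1" g] by simp

lemma L_suminf:
  assumes "\<And>x. summable (\<lambda>n. f n x)"
  shows "L (\<lambda>x. \<Sum>n. f n x) y = (\<Sum>n. L (f n) y)" "summable (\<lambda>n. L (f n) y)"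
proof -
  have s: "summable (\<lambda>n. pmf p \<omega> * transfer (S \<omega>) (T \<omega>) (f n) y)" for \<omega>
    by (intro summable_mult transfer_suminf(2) assms)
  show "summable (\<lambda>n. L (f n) y)" unfolding L_def using s by (rule summable_sum)
  show "L (\<lambda>x. \<Sum>n. f n x) y = (\<Sum>n. L (f n) y)"
    unfolding L_def suminf_sum[OF s]
    by (intro sum.cong refl) (simp add: transfer_suminf(1)[OF assms] suminf_mult[OF transfer_suminf(2)[OF assms]])
qed

text \<open>Boundedness and duality are proved together because both are inherited summand by summand.\<close>

lemma L_bounded_dual:
  "\<exists>k\<ge>0. \<forall>f B. f \<in> borel_measurable borel \<longrightarrow> (\<forall>x. \<bar>f x\<bar> \<le> B) \<longrightarrow> supp01 f \<longrightarrow>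
      L f \<in> borel_measurable borel \<and> (\<forall>y. \<bar>L f y\<bar> \<le> k * B) \<and>
      (\<forall>u U. u \<in> borel_measurable borel \<longrightarrow> (\<forall>x. \<bar>u x\<bar> \<le> U) \<longrightarrow>
         (LBINT y. L f y * u y) = (LBINT x. f x * koopman u x))"
proof -
  define P where "P \<omega> k \<longleftrightarrow> k \<ge> 0 \<and> (\<forall>f B. f \<in> borel_measurable borel \<longrightarrow> (\<forall>x. \<bar>f x\<bar> \<le> B) \<longrightarrow> supp01 f \<longrightarrow>
      transfer (S \<omega>) (T \<omega>) f \<in> borel_measurable borel \<and> (\<forall>y. \<bar>transfer (S \<omega>) (T \<omega>) f y\<bar> \<le> k * B) \<and>
      (\<forall>u U. u \<in> borel_measurable borel \<longrightarrow> (\<forall>x. \<bar>u x\<bar> \<le> U) \<longrightarrow>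
         (LBINT y. transfer (S \<omega>) (T \<omega>) f y * u y) = (LBINT x. f x * u (T \<omega> x))))" for \<omega> k
  have "\<exists>k. P \<omega> k" for \<omega> unfolding P_def using transfer_bounded_dual[OF expanding lam0] by blast
  then obtain k where k: "\<And>\<omega>. P \<omega> (k \<omega>)" by metis
  show ?thesis
  proof (intro exI[of _ "\<Sum>\<omega>\<in>UNIV. k \<omega>"] conjI allI impI)
    have k0: "0 \<le> k \<omega>" for \<omega> using k unfolding P_def by blast
    show "0 \<le> (\<Sum>\<omega>\<in>UNIV. k \<omega>)" using k0 by (intro sum_nonneg) auto
    fix f B assume f: "f \<in> borel_measurable borel" "\<forall>x. \<bar>f x\<bar> \<le> B" "supp01 f"
    let ?t = "\<lambda>\<omega>. transfer (S \<omega>) (T \<omega>) f"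
    have m: "?t \<omega> \<in> borel_measurable borel" and b: "\<bar>?t \<omega> y\<bar> \<le> k \<omega> * B" for \<omega> y
      using k[of \<omega>] f unfolding P_def by auto
    have s: "supp01 (?t \<omega>)" for \<omega> by (rule transfer_supp01[OF expanding])
    have d: "(LBINT y. ?t \<omega> y * u y) = (LBINT x. f x * u (T \<omega> x))"
      if "u \<in> borel_measurable borel" "\<forall>x. \<bar>u x\<bar> \<le> U" for \<omega> u U
      using k[of \<omega>] f that unfolding P_def by blast
    show Lm: "L f \<in> borel_measurable borel" unfolding L_def[abs_def] using m by measurable
    show "\<bar>L f y\<bar> \<le> (\<Sum>\<omega>\<in>UNIV. k \<omega>) * B" for y
    proof -
      have "\<bar>L f y\<bar> \<le> (\<Sum>\<omega>\<in>UNIV. \<bar>pmf p \<omega> * ?t \<omega> y\<bar>)" unfolding L_def by (rule sum_abs)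
      also have "\<dots> \<le> (\<Sum>\<omega>\<in>UNIV. k \<omega> * B)"
      proof (rule sum_mono)
        fix \<omega>
        have "\<bar>pmf p \<omega> * ?t \<omega> y\<bar> \<le> 1 * \<bar>?t \<omega> y\<bar>"
          unfolding abs_mult by (intro mult_right_mono) (auto simp: pmf_le_1)
        then show "\<bar>pmf p \<omega> * ?t \<omega> y\<bar> \<le> k \<omega> * B" using b[of \<omega> y] by linarith
      qed
      finally show ?thesis by (simp add: sum_distrib_right)
    qed
    fix u :: "real \<Rightarrow> real" and U assume u: "u \<in> borel_measurable borel" "\<forall>x. \<bar>u x\<bar> \<le> U"
    have i1: "integrable lborel (\<lambda>y. pmf p \<omega> * (?t \<omega> y * u y))" for \<omega>
      by (intro integrable_mult_right bounded_supp01_mult_integrable[OF m s b u(1)]) (use u(2) in auto)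
    have i2: "integrable lborel (\<lambda>x. pmf p \<omega> * (f x * u (T \<omega> x)))" for \<omega>
      by (intro integrable_mult_right
          bounded_supp01_mult_integrable[OF f(1,3) _ measurable_compose[OF expandingD(5)[OF expanding] u(1)]])
         (use f(2) u(2) in auto)
    have "(LBINT y. L f y * u y) = (LBINT y. (\<Sum>\<omega>\<in>UNIV. pmf p \<omega> * (?t \<omega> y * u y)))"
      unfolding L_def by (simp add: sum_distrib_right mult.assoc)
    also have "\<dots> = (\<Sum>\<omega>\<in>UNIV. LBINT y. pmf p \<omega> * (?t \<omega> y * u y))"
      by (rule Bochner_Integration.integral_sum) (rule i1)
    also have "\<dots> = (\<Sum>\<omega>\<in>UNIV. LBINT x. pmf p \<omega> * (f x * u (T \<omega> x)))"
      using d[OF u] by simp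
    also have "\<dots> = (LBINT x. (\<Sum>\<omega>\<in>UNIV. pmf p \<omega> * (f x * u (T \<omega> x))))"
      by (rule Bochner_Integration.integral_sum[symmetric]) (rule i2)
    also have "\<dots> = (LBINT x. f x * koopman u x)"
      unfolding koopman_def by (simp add: sum_distrib_left mult.left_commute)
    finally show "(LBINT y. L f y * u y) = (LBINT x. f x * koopman u x)" .
  qed
qed

lemma L_measurable:
  assumes "f \<in> borel_measurable borel" "\<And>x. \<bar>f x\<bar> \<le> B" "supp01 f"
  shows "L f \<in> borel_measurable borel"
  using L_bounded_dual assms by blast

lemma L_dual:
  assumes "f \<in> borel_measurable borel" "\<And>x. \<bar>f x\<bar> \<le> B" "supp01 f"
    and "u \<in> borel_measurable borel" "\<And>x. \<bar>u x\<bar> \<le> U"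
  shows "(LBINT y. L f y * u y) = (LBINT x. f x * koopman u x)"
  using L_bounded_dual assms by blast

lemma koopman_measurable: "u \<in> borel_measurable borel \<Longrightarrow> koopman u \<in> borel_measurable borel"
  unfolding koopman_def[abs_def]
  by (intro borel_measurable_sum borel_measurable_times borel_measurable_const measurable_compose[OF expandingD(5)[OF expanding]])

lemma koopman_bound: "(\<And>x. \<bar>u x\<bar> \<le> U) \<Longrightarrow> \<bar>koopman u x\<bar> \<le> U"
proof -
  assume u: "\<And>x. \<bar>u x\<bar> \<le> U"
  have "\<bar>koopman u x\<bar> \<le> (\<Sum>\<omega>\<in>UNIV. \<bar>pmf p \<omega> * u (T \<omega> x)\<bar>)" unfolding koopman_def by (rule sum_abs)
  also have "\<dots> \<le> (\<Sum>\<omega>\<in>UNIV. pmf p \<omega> * U)"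
    by (rule sum_mono) (simp add: abs_mult u mult_left_mono)
  also have "\<dots> = U" by (simp add: sum_distrib_right[symmetric] sum_pmf)
  finally show ?thesis .
qed

lemma L_supp01: "supp01 (L f)"
  using transfer_supp01[OF expanding] by (simp add: supp01_def L_def)

lemma L_ess_nonneg: "ess_nonneg f \<Longrightarrow> ess_nonneg (L f)"
  unfolding L_def[abs_def] by (intro ess_nonneg_sum ess_nonneg_transfer) auto

lemma L_nonneg: "(\<And>x. 0 \<le> f x) \<Longrightarrow> 0 \<le> L f y"
  unfolding L_def by (intro sum_nonneg mult_nonneg_nonneg transfer_nonneg) auto

text \<open>The crude one-step bound. Its constant may exceed one, and it serves to propagate bounded variation
to intermediate times.\<close>

lemma L_bvar: "\<exists>C\<ge>0. \<forall>f B. bvar f B \<longrightarrow> supp01 f \<longrightarrow> bvar (L f) (C * B)"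
proof -
  have "\<exists>C\<ge>0. \<forall>f B. bvar f B \<longrightarrow> supp01 f \<longrightarrow>
     bvar (transfer (S \<omega>) (T \<omega>) f) ((3 / lam + 1) * B + C * (LBINT x. \<bar>f x\<bar>))" for \<omega>
    using transfer_bvar[OF expanding lam0, of 1] by simp
  then obtain C where C: "\<And>\<omega>. 0 \<le> C \<omega>" "\<And>\<omega> f B. bvar f B \<Longrightarrow> supp01 f \<Longrightarrow>
     bvar (transfer (S \<omega>) (T \<omega>) f) ((3 / lam + 1) * B + C \<omega> * (LBINT x. \<bar>f x\<bar>))" by metis
  show ?thesis
  proof (intro exI[of _ "\<Sum>\<omega>\<in>UNIV. (3 / lam + 1 + C \<omega>)"] conjI allI impI)
    show "0 \<le> (\<Sum>\<omega>\<in>UNIV. (3 / lam + 1 + C \<omega>))" using C(1) lam0 by (intro sum_nonneg) simp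
    fix f B assume f: "bvar f B" "supp01 f"
    have B0: "0 \<le> B" by (rule bvar_nonneg[OF f(1)])
    have "bvar (transfer (S \<omega>) (T \<omega>) f) ((3 / lam + 1 + C \<omega>) * B)" for \<omega>
    proof (rule bvar_mono[OF C(2)[OF f]])
      have "C \<omega> * (LBINT x. \<bar>f x\<bar>) \<le> C \<omega> * B"
        using integral_abs_le_bound[OF bvar_measurable[OF f(1)] f(2) bvar_bound[OF f]] C(1) by (rule mult_left_mono)
      then show "(3 / lam + 1) * B + C \<omega> * (LBINT x. \<bar>f x\<bar>) \<le> (3 / lam + 1 + C \<omega>) * B"
        by (simp add: distrib_right)
    qed
    then have "bvar (L f) (\<Sum>\<omega>\<in>UNIV. \<bar>pmf p \<omega>\<bar> * ((3 / lam + 1 + C \<omega>) * B))"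
      unfolding L_def[abs_def] by (intro bvar_sum bvar_cmult) auto
    then show "bvar (L f) ((\<Sum>\<omega>\<in>UNIV. (3 / lam + 1 + C \<omega>)) * B)"
    proof (rule bvar_mono)
      have "(\<Sum>\<omega>\<in>UNIV. \<bar>pmf p \<omega>\<bar> * ((3 / lam + 1 + C \<omega>) * B)) \<le> (\<Sum>\<omega>\<in>UNIV. 1 * ((3 / lam + 1 + C \<omega>) * B))"
        using C(1) B0 lam0 by (intro sum_mono mult_right_mono) (auto simp: pmf_le_1)
      then show "(\<Sum>\<omega>\<in>UNIV. \<bar>pmf p \<omega>\<bar> * ((3 / lam + 1 + C \<omega>) * B)) \<le> (\<Sum>\<omega>\<in>UNIV. (3 / lam + 1 + C \<omega>)) * B"
        by (simp add: sum_distrib_right)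
    qed
  qed
qed

lemma Ln_bvar: "\<exists>C\<ge>0. \<forall>f B. bvar f B \<longrightarrow> supp01 f \<longrightarrow> bvar ((L ^^ n) f) (C * B)"
proof (induction n)
  case 0 show ?case by (rule exI[of _ 1]) simp
next
  case (Suc n)
  then obtain C where C: "C \<ge> 0" "\<And>f B. bvar f B \<Longrightarrow> supp01 f \<Longrightarrow> bvar ((L ^^ n) f) (C * B)" by blast
  obtain C1 where C1: "C1 \<ge> 0" "\<And>f B. bvar f B \<Longrightarrow> supp01 f \<Longrightarrow> bvar (L f) (C1 * B)" using L_bvar by blast
  show ?case
  proof (intro exI[of _ "C * C1"] conjI allI impI)
    fix f B assume f: "bvar f B" "supp01 f"
    show "bvar ((L ^^ Suc n) f) (C * C1 * B)"
      using C(2)[OF C1(2)[OF f] L_supp01] by (simp only: funpow_Suc_right comp_def mult.assoc)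
  qed (use C C1 in simp)
qed

lemma Ln_supp01: "supp01 f \<Longrightarrow> supp01 ((L ^^ n) f)"
  by (cases n) (auto simp: L_supp01)

lemma Ln_ess_nonneg: "ess_nonneg f \<Longrightarrow> ess_nonneg ((L ^^ n) f)"
  by (induction n) (auto simp: L_ess_nonneg)

lemma Ln_nonneg: "(\<And>x. 0 \<le> f x) \<Longrightarrow> 0 \<le> (L ^^ n) f y"
  by (induction n arbitrary: y) (auto intro: L_nonneg)

lemma Ln_dual:
  assumes f: "bvar f B" "supp01 f" and u: "u \<in> borel_measurable borel" "\<And>x. \<bar>u x\<bar> \<le> U"
  shows "(LBINT y. (L ^^ n) f y * u y) = (LBINT x. f x * (koopman ^^ n) u x)"
    and "(koopman ^^ n) u \<in> borel_measurable borel" "\<bar>(koopman ^^ n) u x\<bar> \<le> U"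
proof -
  have k: "(koopman ^^ n) u \<in> borel_measurable borel \<and> (\<forall>x. \<bar>(koopman ^^ n) u x\<bar> \<le> U)" for n
    by (induction n) (use u in \<open>auto intro!: koopman_measurable koopman_bound\<close>)
  then show "(koopman ^^ n) u \<in> borel_measurable borel" "\<bar>(koopman ^^ n) u x\<bar> \<le> U" by auto
  show "(LBINT y. (L ^^ n) f y * u y) = (LBINT x. f x * (koopman ^^ n) u x)"
    using f
  proof (induction n arbitrary: f B)
    case (Suc n)
    obtain C where "bvar (L f) (C * B)" using L_bvar Suc.prems by blast
    then have "(LBINT y. (L ^^ n) (L f) y * u y) = (LBINT x. L f x * (koopman ^^ n) u x)"
      using Suc.IH L_supp01 by blast
    also have "\<dots> = (LBINT x. f x * koopman ((koopman ^^ n) u) x)"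
      by (rule L_dual[OF bvar_measurable[OF Suc.prems(1)] bvar_bound[OF Suc.prems] Suc.prems(2)]) (use k in auto)
    finally show ?case by (simp add: funpow_swap1)
  qed simp
qed

lemma Ln_integral:
  assumes f: "bvar f B" "supp01 f"
  shows "(LBINT y. (L ^^ n) f y) = (LBINT x. f x)"
proof -
  have "koopman (\<lambda>x. 1) = (\<lambda>x. 1)" by (auto simp: koopman_def sum_pmf)
  then have "(koopman ^^ n) (\<lambda>x. 1) = (\<lambda>x. 1)" by (induction n) auto
  then show ?thesis using Ln_dual(1)[OF f, of "\<lambda>x. 1" 1 n] by simp
qed

section \<open>Words\<close>

definition word_prob :: "'w list \<Rightarrow> real" where "word_prob ws = prod_list (map (pmf p) ws)"

definition word_transfer :: "'w list \<Rightarrow> (real \<Rightarrow> real) \<Rightarrow> real \<Rightarrow> real" where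
  "word_transfer ws = fold (\<lambda>\<omega>. transfer (S \<omega>) (T \<omega>)) ws"

lemma word_prob_pos: "0 < word_prob ws"
  unfolding word_prob_def by (induction ws) (auto simp: p_pos)

lemma finite_words: "finite {ws :: 'w list. length ws = n}"
  using finite_lists_length_eq[of "UNIV :: 'w set" n] by simp

lemma sum_words_Suc:
  "(\<Sum>ws\<in>{ws. length ws = Suc n}. F ws) = (\<Sum>\<omega>\<in>UNIV. \<Sum>ws\<in>{ws. length ws = n}. F (\<omega> # ws))"
proof -
  have "(\<Sum>\<omega>\<in>UNIV. \<Sum>ws\<in>{ws. length ws = n}. F (\<omega> # ws))
    = (\<Sum>(\<omega>, ws)\<in>UNIV \<times> {ws. length ws = n}. F (\<omega> # ws))" by (rule sum.cartesian_product)
  also have "\<dots> = (\<Sum>ws\<in>{ws. length ws = Suc n}. F ws)"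
    by (rule sum.reindex_bij_witness[of _ "\<lambda>ws. (hd ws, tl ws)" "\<lambda>(\<omega>, ws). \<omega> # ws"])
       (auto simp: length_Suc_conv)
  finally show ?thesis ..
qed

lemma sum_word_prob: "(\<Sum>ws\<in>{ws. length ws = n}. word_prob ws) = 1"
proof (induction n)
  case (Suc n)
  then show ?case
    by (simp add: sum_words_Suc word_prob_def sum_distrib_left[symmetric] sum_pmf)
qed (simp add: word_prob_def)

lemma word_transfer_sum:
  "word_transfer ws (\<lambda>x. \<Sum>i\<in>I. c i * f i x) y = (\<Sum>i\<in>I. c i * word_transfer ws (f i) y)"
  unfolding word_transfer_def
  by (induction ws arbitrary: f) (auto simp: transfer_sum[abs_def] transfer_cmult[abs_def])

text \<open>Expanding \<open>L\<^sup>n\<close> over words replaces \<open>n\<close> steps by one step of maps whose expansion is the \<open>n\<close>-th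
power.\<close>

lemma Ln_words: "(L ^^ n) f y = (\<Sum>ws\<in>{ws. length ws = n}. word_prob ws * word_transfer ws f y)"
proof (induction n arbitrary: f)
  case 0 show ?case by (simp add: word_prob_def word_transfer_def)
next
  case (Suc n)
  have "(L ^^ Suc n) f y = (\<Sum>ws\<in>{ws. length ws = n}. word_prob ws * word_transfer ws (L f) y)"
    by (simp only: funpow_Suc_right comp_def Suc.IH)
  also have "\<dots> = (\<Sum>ws\<in>{ws. length ws = n}. \<Sum>\<omega>\<in>UNIV. word_prob (\<omega> # ws) * word_transfer (\<omega> # ws) f y)"
    unfolding L_def[abs_def] word_transfer_sum sum_distrib_left
    by (intro sum.cong refl) (simp add: word_prob_def word_transfer_def)
  finally show ?case unfolding sum_words_Suc by (subst sum.swap)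
qed

lemma word_expanding:
  assumes "ws \<noteq> []"
  shows "\<exists>S'. expanding (lam ^ length ws) S' (fold T ws) \<and> word_transfer ws = transfer S' (fold T ws)"
  using assms
proof (induction ws rule: rev_nonempty_induct)
  case (single \<omega>)
  have "fold T [\<omega>] = T \<omega>" by auto
  then show ?case using expanding[of \<omega>] by (auto simp: word_transfer_def intro!: exI[of _ "S \<omega>"])
next
  case (snoc \<omega> ws)
  then obtain S' where S': "expanding (lam ^ length ws) S' (fold T ws)" "word_transfer ws = transfer S' (fold T ws)" by blast
  have l: "0 < lam ^ length ws" using lam0 by simp
  have e: "fold T (ws @ [\<omega>]) = T \<omega> \<circ> fold T ws" by auto
  let ?S = "S' \<union> {x\<in>{0..1} - S'. fold T ws x \<in> S \<omega>}"
  have "expanding (lam ^ length ws * lam) ?S (fold T (ws @ [\<omega>]))"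
    unfolding e by (rule transfer_compose(1)[OF S'(1) l expanding lam0])
  moreover have "word_transfer (ws @ [\<omega>]) = transfer ?S (fold T (ws @ [\<omega>]))"
    unfolding e transfer_compose(2)[OF S'(1) l expanding lam0, symmetric, abs_def] using S'(2)
    by (auto simp: word_transfer_def)
  moreover have "lam ^ length (ws @ [\<omega>]) = lam ^ length ws * lam" by simp
  ultimately show ?case by (intro exI[of _ ?S]) (simp only: simp_thms)
qed

lemma word_transfer_ess_nonneg: "ess_nonneg f \<Longrightarrow> ess_nonneg (word_transfer ws f)"
  unfolding word_transfer_def by (induction ws arbitrary: f) (auto intro: ess_nonneg_transfer)

section \<open>Lasota--Yorke inequality for an iterate\<close>

text \<open>Words of a length \<open>n\<close> with \<open>lam\<^sup>n \<ge> 12\<close> satisfy the inequality with factor \<open>3 / 12 + 1 / 4\<close>, and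
averaging over words preserves it.\<close>

lemma iterate_LY:
  "\<exists>n\<ge>1. \<exists>C\<ge>0. \<forall>f B. bvar f B \<longrightarrow> supp01 f \<longrightarrow> bvar ((L ^^ n) f) (B / 2 + C * (LBINT x. \<bar>f x\<bar>))"
proof -
  obtain n0 where n0: "12 < lam ^ n0" using real_arch_pow[OF lam] by blast
  define n where "n = Suc n0"
  have n: "12 \<le> lam ^ n" using n0 lam unfolding n_def by (smt (verit) power_strict_increasing_iff lessI)
  have "\<exists>C\<ge>0. \<forall>f B. bvar f B \<longrightarrow> supp01 f \<longrightarrow>
      bvar (word_transfer ws f) ((3 / lam ^ n + 1 / 4) * B + C * (LBINT x. \<bar>f x\<bar>))"
    if ws: "length ws = n" for ws
  proof -
    have "ws \<noteq> []" using ws by (auto simp: n_def)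
    from word_expanding[OF this] obtain S' where S': "expanding (lam ^ n) S' (fold T ws)" "word_transfer ws = transfer S' (fold T ws)"
      using ws by blast
    show ?thesis unfolding S'(2) by (rule transfer_bvar[OF S'(1)]) (use lam0 in auto)
  qed
  then obtain C where C: "\<And>ws. length ws = n \<Longrightarrow> 0 \<le> C ws" "\<And>ws f B. length ws = n \<Longrightarrow> bvar f B \<Longrightarrow> supp01 f \<Longrightarrow>
      bvar (word_transfer ws f) ((3 / lam ^ n + 1 / 4) * B + C ws * (LBINT x. \<bar>f x\<bar>))" by metis
  define C' where "C' = (\<Sum>ws\<in>{ws. length ws = n}. C ws)"
  have CC: "C ws \<le> C'" if "length ws = n" for ws
    unfolding C'_def using C(1) that by (intro member_le_sum finite_words) auto
  show ?thesis
  proof (intro exI[of _ n] exI[of _ C'] conjI allI impI)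
    show "1 \<le> n" by (simp add: n_def)
    show "0 \<le> C'" unfolding C'_def using C(1) by (intro sum_nonneg) auto
    fix f B assume f: "bvar f B" "supp01 f"
    let ?I = "LBINT x. \<bar>f x\<bar>"
    have e: "(L ^^ n) f = (\<lambda>y. \<Sum>ws\<in>{ws. length ws = n}. word_prob ws * word_transfer ws f y)"
      by (rule ext) (rule Ln_words)
    have "bvar (word_transfer ws f) (B / 2 + C' * ?I)" if ws: "length ws = n" for ws
    proof (rule bvar_mono[OF C(2)[OF ws f]])
      have "3 / lam ^ n \<le> 1 / 4" using n by (simp add: divide_simps)
      then have "(3 / lam ^ n + 1 / 4) * B \<le> (1 / 2) * B"
        using bvar_nonneg[OF f(1)] by (intro mult_right_mono) auto
      moreover have "C ws * ?I \<le> C' * ?I" using CC[OF ws] by (intro mult_right_mono integral_nonneg_AE) auto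
      ultimately show "(3 / lam ^ n + 1 / 4) * B + C ws * ?I \<le> B / 2 + C' * ?I" by linarith
    qed
    then have "bvar ((L ^^ n) f) (\<Sum>ws\<in>{ws. length ws = n}. \<bar>word_prob ws\<bar> * (B / 2 + C' * ?I))"
      unfolding e by (intro bvar_sum finite_words bvar_cmult) auto
    then show "bvar ((L ^^ n) f) (B / 2 + C' * ?I)"
      using sum_word_prob[of n] word_prob_pos by (simp add: sum_distrib_right[symmetric] less_imp_le)
  qed
qed


section \<open>Minorization\<close>

definition ess_ge :: "real set \<Rightarrow> real \<Rightarrow> (real \<Rightarrow> real) \<Rightarrow> bool" where
  "ess_ge I c f \<longleftrightarrow> finite {x\<in>I. f x < c}"

text \<open>Every \<open>y\<close> off a finite set has a preimage \<open>x \<in> I\<close> under the word that is not exceptional; the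
corresponding single term of the sum is at least \<open>c\<close> divided by the maximal derivative, and the
other terms are nonnegative.\<close>

lemma word_spread:
  assumes ws: "ws \<noteq> []" "fold T ws ` I = {0..1}" and I: "I \<subseteq> {0..1}"
  shows "\<exists>b>0. \<forall>f c. 0 \<le> c \<longrightarrow> ess_nonneg f \<longrightarrow> ess_ge I c f \<longrightarrow> ess_ge {0..1} (b * c) ((L ^^ length ws) f)"
proof -
  let ?n = "length ws" and ?W = "{vs. length vs = length ws} :: 'w list set" and ?T = "fold T ws"
  obtain S' where S': "expanding (lam ^ ?n) S' ?T" "word_transfer ws = transfer S' ?T" using word_expanding[OF ws(1)] by blast
  have l: "0 < lam ^ ?n" using lam0 by simp
  obtain K T'' where K: "\<And>x. x\<in>{0..1} - S' \<Longrightarrow> \<bar>deriv ?T x\<bar> \<le> K \<and> (deriv ?T has_real_derivative T'' x) (at x) \<and> \<bar>T'' x\<bar> \<le> K"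
    using expanding_second_derivative[OF S'(1)] by blast
  define K' where "K' = \<bar>K\<bar> + 1"
  have K': "K' > 0" "\<And>x. x \<in> {0..1} - S' \<Longrightarrow> \<bar>deriv ?T x\<bar> \<le> K'" using K by (force simp: K'_def)+
  show ?thesis
  proof (intro exI[of _ "word_prob ws / K'"] conjI allI impI)
    show "0 < word_prob ws / K'" using word_prob_pos K' by simp
    fix f c assume c: "(0::real) \<le> c" and f: "ess_nonneg f" "ess_ge I c f"
    define X where "X = (\<Union>vs\<in>?W. {y. word_transfer vs f y < 0}) \<union> ?T ` S' \<union> ?T ` {x. f x < 0} \<union> ?T ` {x\<in>I. f x < c}"
    have "finite X" unfolding X_def
      using word_transfer_ess_nonneg[OF f(1)] f expandingD(1)[OF S'(1)] finite_words[of ?n]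
      by (auto simp: ess_nonneg_def ess_ge_def)
    moreover have "{y\<in>{0..1}. (L ^^ ?n) f y < word_prob ws / K' * c} \<subseteq> X"
    proof (rule ccontr)
      assume "\<not> ?thesis"
      then obtain y where y: "y \<in> {0..1}" "(L ^^ ?n) f y < word_prob ws / K' * c" "y \<notin> X" by blast
      obtain x where x: "x \<in> I" "?T x = y" using y(1) ws(2) by (metis imageE)
      have xS: "x \<in> {0..1} - S'" using x I y(3) by (auto simp: X_def)
      have fx: "c \<le> f x" using x y(3) by (auto simp: X_def not_less)
      have f0: "0 \<le> f z" if "?T z = y" for z using that y(3) by (force simp: X_def not_less)
      have "c / K' \<le> f x / \<bar>deriv ?T x\<bar>"
        using fx c K'(2)[OF xS] expandingD(8)[OF S'(1) xS] l by (intro frac_le) auto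
      also have "\<dots> = (\<Sum>z\<in>{x}. f z / \<bar>deriv ?T z\<bar>)" by simp
      also have "\<dots> \<le> (\<Sum>z\<in>{z\<in>{0..1} - S'. ?T z = y}. f z / \<bar>deriv ?T z\<bar>)"
        using expanding_finite_fibre[OF S'(1) l, of y] xS x(2) f0 by (intro sum_mono2) auto
      finally have "c / K' \<le> word_transfer ws f y" unfolding S'(2) transfer_def .
      then have "word_prob ws / K' * c \<le> word_prob ws * word_transfer ws f y"
        using mult_left_mono[of "c / K'" "word_transfer ws f y" "word_prob ws"] word_prob_pos[of ws] by simp
      also have "\<dots> = (\<Sum>vs\<in>{ws}. word_prob vs * word_transfer vs f y)" by simp
      also have "\<dots> \<le> (\<Sum>vs\<in>?W. word_prob vs * word_transfer vs f y)"
      proof (rule sum_mono2[OF finite_words])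
        fix vs assume "vs \<in> ?W - {ws}"
        then have "0 \<le> word_transfer vs f y" using y(3) by (auto simp: X_def not_less)
        then show "0 \<le> word_prob vs * word_transfer vs f y" using word_prob_pos[of vs] by simp
      qed simp
      also have "\<dots> = (L ^^ ?n) f y" by (rule Ln_words[symmetric])
      finally show False using y(2) by simp
    qed
    ultimately show "ess_ge {0..1} (word_prob ws / K' * c) ((L ^^ ?n) f)"
      unfolding ess_ge_def by (rule finite_subset[rotated])
  qed
qed

lemma ess_ge_unit_nonneg: "supp01 f \<Longrightarrow> 0 \<le> c \<Longrightarrow> ess_ge {0..1} c f \<Longrightarrow> ess_nonneg f"
  unfolding ess_nonneg_def ess_ge_def
  by (erule finite_subset[rotated]) (force simp: supp01_def)

text \<open>The last symbol of a word covering the unit interval is already onto, so a lower bound on the whole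
interval survives one more step up to a constant factor. This brings the lower bounds reached at
different times to one common time.\<close>

lemma ess_ge_persist:
  "\<exists>b>0. \<forall>f c n. 0 \<le> c \<longrightarrow> supp01 f \<longrightarrow> ess_ge {0..1} c f \<longrightarrow> ess_ge {0..1} (b ^ n * c) ((L ^^ n) f)"
proof -
  have "\<exists>ws. ws \<noteq> [] \<and> fold T ws ` {0..1} = {0..1}" by (rule covering) auto
  then obtain ws where ws: "ws \<noteq> []" "fold T ws ` {0..1} = {0..1}" by blast
  obtain vs \<omega> where vs: "ws = vs @ [\<omega>]" using ws(1) by (cases ws rule: rev_cases) auto
  have im: "T \<omega> ` (fold T vs ` {0..1}) = {0..1}" using ws(2) by (simp add: vs image_comp)
  have "fold T vs x \<in> {0..1}" if "x \<in> {0..1}" for x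
    using that expandingD(6)[OF expanding] by (induction vs rule: rev_induct) auto
  then have "T \<omega> ` (fold T vs ` {0..1}) \<subseteq> T \<omega> ` {0..1}" by blast
  moreover have "T \<omega> ` {0..1} \<subseteq> {0..1}" using expandingD(6)[OF expanding] by blast
  ultimately have "T \<omega> ` {0..1} = {0..1}" unfolding im by (rule subset_antisym[rotated])
  then have "fold T [\<omega>] ` {0..1} = {0..1}" by simp
  from word_spread[OF _ this] obtain b where b: "b > 0"
    "\<And>f c. 0 \<le> c \<Longrightarrow> ess_nonneg f \<Longrightarrow> ess_ge {0..1} c f \<Longrightarrow> ess_ge {0..1} (b * c) (L f)" by auto
  show ?thesis
  proof (intro exI[of _ b] conjI allI impI b(1))
    fix f :: "real \<Rightarrow> real" and c n assume c: "(0::real) \<le> c" and f: "supp01 f" "ess_ge {0..1} c f"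
    show "ess_ge {0..1} (b ^ n * c) ((L ^^ n) f)"
    proof (induction n)
      case (Suc n)
      have bc: "0 \<le> b ^ n * c" using b(1) c by simp
      have "ess_ge {0..1} (b * (b ^ n * c)) (L ((L ^^ n) f))"
        by (rule b(2)[OF bc ess_ge_unit_nonneg[OF Ln_supp01[OF f(1)] bc Suc] Suc])
      then show ?case by (simp add: mult.assoc)
    qed (use f in simp)
  qed
qed

definition bv_density :: "real \<Rightarrow> (real \<Rightarrow> real) \<Rightarrow> bool" where
  "bv_density A f \<longleftrightarrow> bvar f A \<and> supp01 f \<and> ess_nonneg f \<and> (LBINT x. f x) = 1"

lemma bv_densityD:
  assumes "bv_density A f"
  shows "bvar f A" "supp01 f" "ess_nonneg f" "(LBINT x. f x) = 1"
  using assms by (auto simp: bv_density_def)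

lemma integral_unit_indicator: "(LBINT x. indicator {0..1::real} x) = (1::real)"
  by simp

lemma bv_density_unit: "bv_density 2 (indicator {0..1})"
proof -
  have "{x. indicator {0..1::real} x < (0::real)} = {}" by (auto simp: not_less)
  then have "ess_nonneg (indicator {0..1})" unfolding ess_nonneg_def by (metis finite.emptyI)
  then show ?thesis unfolding bv_density_def
    using bvar_indicator[of 0 1] integral_unit_indicator by (auto simp: supp01_def)
qed

lemma bv_density_weaken: "bv_density A f \<Longrightarrow> A \<le> B \<Longrightarrow> bv_density B f"
  unfolding bv_density_def using bvar_mono by blast

text \<open>If \<open>f\<close> dropped below one half in each of the \<open>M\<close> intervals, its integral would be at most
\<open>1 / 2 + A / M\<close>, which is smaller than one.\<close>

lemma bv_density_large_on_interval:
  assumes f: "bv_density A f" and M: "2 * A < real M"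
  shows "\<exists>i<M. \<forall>x\<in>{real i / real M..<real (Suc i) / real M}. 1 / 2 \<le> f x"
proof (rule ccontr)
  assume "\<not> ?thesis"
  then have ex: "\<And>i. i < M \<Longrightarrow> \<exists>x\<in>{real i / real M..<real (Suc i) / real M}. f x < 1 / 2"
    by (auto simp: not_le)
  obtain v where v: "\<And>x y. x \<le> y \<Longrightarrow> \<bar>f y - f x\<bar> \<le> v y - v x" "\<And>x. 0 \<le> v x \<and> v x \<le> A"
    using bv_densityD(1)[OF f] unfolding bvar_def by blast
  have A0: "0 \<le> A" using bvar_nonneg bv_densityD(1)[OF f] by blast
  then have M0: "0 < M" using M by (cases M) auto
  define a where "a i = real i / real M" for i
  have part: "partition01 M a" using M0 by (auto simp: partition01_def a_def divide_strict_right_mono)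
  define D where "D i = v (a (Suc i)) - v (a i)" for i
  have mono: "r \<le> s \<Longrightarrow> v r \<le> v s" for r s using v(1)[of r s] by linarith
  have up: "f x \<le> 1 / 2 + D i" if i: "i < M" and x: "x \<in> {a i..<a (Suc i)}" for i x
  proof -
    obtain z where z: "z \<in> {a i..<a (Suc i)}" "f z < 1 / 2" using ex[OF i] by (auto simp: a_def)
    then show ?thesis using oscillation_le[where f = f and v = v and a = "a i" and x = x and b = "a (Suc i)" and z = z, OF v(1)] x by (simp add: D_def)
  qed
  have len: "a (Suc i) - a i = 1 / real M" "a i \<le> a (Suc i)" for i
    by (auto simp: a_def diff_divide_distrib[symmetric] divide_right_mono)
  have int: "integrable lborel (\<lambda>x. indicator {a i..<a (Suc i)} x * (1 / 2 + D i))" for i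
    using len(2)[of i] by (intro integrable_mult_left integrable_real_indicator) auto
  have "1 = (LBINT x. f x)" using bv_densityD(4)[OF f] by simp
  also have "\<dots> \<le> (LBINT x. (\<Sum>i<M. indicator {a i..<a (Suc i)} x * (1 / 2 + D i)))"
  proof (rule integral_mono_AE)
    show "integrable lborel f" by (rule bvar_integrable[OF bv_densityD(1,2)[OF f]])
    show "integrable lborel (\<lambda>x. \<Sum>i<M. indicator {a i..<a (Suc i)} x * (1 / 2 + D i))"
      by (rule Bochner_Integration.integrable_sum) (rule int)
    have D0: "0 \<le> D i" for i using mono[OF len(2)[of i]] by (simp add: D_def)
    have "AE x in lborel. x \<noteq> (1::real)" by (rule AE_lborel_singleton)
    then show "AE x in lborel. f x \<le> (\<Sum>i<M. indicator {a i..<a (Suc i)} x * (1 / 2 + D i))"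
    proof eventually_elim
      case (elim x)
      have nn: "0 \<le> (\<Sum>i<M. indicator {a i..<a (Suc i)} x * (1 / 2 + D i))"
        using D0 by (intro sum_nonneg) (simp add: add_nonneg_nonneg)
      show ?case
      proof (cases "0 \<le> x \<and> x < 1")
        case True
        then obtain i where i: "i < M" "a i \<le> x" "x < a (Suc i)" using partition01_cover[OF part] by metis
        then have "f x \<le> indicator {a i..<a (Suc i)} x * (1 / 2 + D i)" using up[of i x] by simp
        also have "\<dots> \<le> (\<Sum>i<M. indicator {a i..<a (Suc i)} x * (1 / 2 + D i))"
          using i(1) D0 by (intro member_le_sum) (auto simp: add_nonneg_nonneg)
        finally show ?thesis .
      next
        case False
        then have "f x = 0" using elim bv_densityD(2)[OF f] by (auto simp: supp01_def)
        then show ?thesis using nn by simp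
      qed
    qed
  qed
  also have "\<dots> = (\<Sum>i<M. LBINT x. indicator {a i..<a (Suc i)} x * (1 / 2 + D i))"
    by (rule Bochner_Integration.integral_sum) (rule int)
  also have "\<dots> = (\<Sum>i<M. (1 / real M) * (1 / 2 + D i))"
    using len by (intro sum.cong refl) simp
  also have "\<dots> = (1 / real M) * (real M / 2 + (\<Sum>i<M. D i))"
    unfolding sum_distrib_left[symmetric] sum.distrib by simp
  also have "(\<Sum>i<M. D i) = v (a M) - v (a 0)" unfolding D_def by (rule sum_lessThan_telescope)
  also have "(1 / real M) * (real M / 2 + (v (a M) - v (a 0))) \<le> (1 / real M) * (real M / 2 + A)"
    using v(2)[of "a M"] v(2)[of "a 0"] by (intro mult_left_mono) auto
  also have "\<dots> < 1" using M M0 by (simp add: field_simps)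
  finally show False by simp
qed

text \<open>Only finitely many intervals compete, so finitely many covering words serve all densities of
variation at most \<open>A\<close> and the lower bound does not depend on \<open>f\<close>.\<close>

lemma minorization: "\<exists>n0. \<forall>n\<ge>n0. \<exists>c>0. \<forall>f. bv_density A f \<longrightarrow> ess_ge {0..1} c ((L ^^ n) f)"
proof -
  obtain M :: nat where M: "2 * A < real M" using reals_Archimedean2 by blast
  define I where "I i = {real i / real M..<real (Suc i) / real M}" for i
  have I01: "I i \<subseteq> {0..1}" if "i < M" for i
  proof
    fix x assume x: "x \<in> I i"
    have "real (Suc i) / real M \<le> 1" using that by (simp add: divide_simps)
    moreover have "0 \<le> real i / real M" by simp
    ultimately show "x \<in> {0..1}" using x unfolding I_def atLeastLessThan_iff atLeastAtMost_iff by linarith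
  qed
  have "\<exists>ws. ws \<noteq> [] \<and> fold T ws ` I i = {0..1}" if "i < M" for i
  proof (rule covering[OF _ I01[OF that]])
    show "is_interval (I i)" unfolding I_def by (simp add: is_interval_1)
    have "real i / real M < real (Suc i) / real M" using that by (auto simp: divide_strict_right_mono)
    then show "interior (I i) \<noteq> {}" by (simp add: I_def)
  qed
  then obtain ws where ws: "\<And>i. i < M \<Longrightarrow> ws i \<noteq> []" "\<And>i. i < M \<Longrightarrow> fold T (ws i) ` I i = {0..1}" by metis
  have "\<exists>b>0. \<forall>f c. 0 \<le> c \<longrightarrow> ess_nonneg f \<longrightarrow> ess_ge (I i) c f \<longrightarrow> ess_ge {0..1} (b * c) ((L ^^ length (ws i)) f)"
    if "i < M" for i by (rule word_spread[OF ws(1)[OF that] ws(2)[OF that] I01[OF that]])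
  then obtain b where b: "\<And>i. i < M \<Longrightarrow> 0 < b i" "\<And>i f c. i < M \<Longrightarrow> 0 \<le> c \<Longrightarrow> ess_nonneg f \<Longrightarrow> ess_ge (I i) c f \<Longrightarrow>
      ess_ge {0..1} (b i * c) ((L ^^ length (ws i)) f)" by metis
  obtain \<beta> where \<beta>: "\<beta> > 0" "\<And>f c n. 0 \<le> c \<Longrightarrow> supp01 f \<Longrightarrow> ess_ge {0..1} c f \<Longrightarrow> ess_ge {0..1} (\<beta> ^ n * c) ((L ^^ n) f)"
    using ess_ge_persist by blast
  show ?thesis
  proof (intro exI[of _ "\<Sum>i<M. length (ws i)"] allI impI)
    fix n assume n: "(\<Sum>i<M. length (ws i)) \<le> n"
    have le: "length (ws i) \<le> n" if "i < M" for i
      using member_le_sum[of i "{..<M}" "\<lambda>i. length (ws i)"] that n by simp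
    define c where "c i = \<beta> ^ (n - length (ws i)) * (b i * (1 / 2))" for i
    have c0: "0 < c i" if "i < M" for i using b(1)[OF that] \<beta>(1) by (simp add: c_def)
    define c' where "c' = Min (insert 1 (c ` {..<M}))"
    have "0 < c'" unfolding c'_def using c0 by (subst Min_gr_iff) auto
    moreover have "ess_ge {0..1} c' ((L ^^ n) f)" if f: "bv_density A f" for f
    proof -
      obtain i where i: "i < M" "\<forall>x\<in>I i. 1 / 2 \<le> f x" using bv_density_large_on_interval[OF f M] by (auto simp: I_def)
      have "{x\<in>I i. f x < 1 / 2} = {}" using i(2) by fastforce
      then have "ess_ge (I i) (1 / 2) f" unfolding ess_ge_def by (simp only: finite.emptyI)
      then have e: "ess_ge {0..1} (b i * (1 / 2)) ((L ^^ length (ws i)) f)"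
        by (intro b(2)[OF i(1)] bv_densityD(3)[OF f]) auto
      have "ess_ge {0..1} (c i) ((L ^^ (n - length (ws i))) ((L ^^ length (ws i)) f))"
        unfolding c_def using b(1)[OF i(1)] by (intro \<beta>(2)[OF _ Ln_supp01[OF bv_densityD(2)[OF f]] e]) simp
      moreover have "(L ^^ (n - length (ws i))) ((L ^^ length (ws i)) f) = (L ^^ n) f"
        using le[OF i(1)] by (metis comp_apply funpow_add le_add_diff_inverse2)
      moreover have "c' \<le> c i" unfolding c'_def using i(1) by (intro Min_le) auto
      ultimately show ?thesis unfolding ess_ge_def
        by (auto elim: finite_subset[rotated])
    qed
    ultimately show "\<exists>c>0. \<forall>f. bv_density A f \<longrightarrow> ess_ge {0..1} c ((L ^^ n) f)" by blast
  qed
qed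

section \<open>Exponential decay\<close>

text \<open>With the constant \<open>C\<close> of the Lasota-Yorke inequality, \<open>A = 4 C + 4\<close> makes the variation drop to
\<open>3 A / 4\<close>. This leaves room for removing the mass \<open>c \<le> 1 / 8\<close> and renormalising without exceeding
\<open>A\<close>. The removed constant is the same for both densities and cancels in the difference.\<close>

lemma contraction:
  "\<exists>A\<ge>4. \<exists>N\<ge>1. \<exists>c. 0 < c \<and> c < 1 \<and> (\<forall>f g. bv_density A f \<longrightarrow> bv_density A g \<longrightarrow>
     (\<exists>f' g'. bv_density A f' \<and> bv_density A g' \<and> (\<forall>x. (L ^^ N) f x - (L ^^ N) g x = (1 - c) * (f' x - g' x))))"
proof -
  obtain n C where n: "n \<ge> 1" and C: "C \<ge> 0" "\<And>f B. bvar f B \<Longrightarrow> supp01 f \<Longrightarrow>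
      bvar ((L ^^ n) f) (B / 2 + C * (LBINT x. \<bar>f x\<bar>))" using iterate_LY by blast
  define A where "A = 4 * C + 4"
  have A4: "4 \<le> A" using C(1) by (simp add: A_def)
  have step: "bv_density (3 * A / 4) ((L ^^ n) f)" if f: "bv_density A f" for f
  proof -
    note fD = bv_densityD[OF f]
    have "bvar ((L ^^ n) f) (A / 2 + C * 1)"
      using C(2)[OF fD(1,2)] integral_abs_ess_nonneg[OF fD(3) bvar_measurable[OF fD(1)]] fD(4) by simp
    then have "bvar ((L ^^ n) f) (3 * A / 4)" by (rule bvar_mono) (simp add: A_def)
    then show ?thesis using Ln_supp01[OF fD(2)] Ln_ess_nonneg[OF fD(3)] Ln_integral[OF fD(1,2)] fD(4)
      by (simp add: bv_density_def)
  qed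
  have weaken: "bv_density A f" if "bv_density (3 * A / 4) f" for f
    using bv_density_weaken[OF that] A4 by simp
  have steps: "bv_density (3 * A / 4) ((L ^^ (n * Suc k)) f)" if f: "bv_density A f" for f k
  proof (induction k)
    case 0 then show ?case using step[OF f] by simp
  next
    case (Suc k)
    have "bv_density (3 * A / 4) ((L ^^ n) ((L ^^ (n * Suc k)) f))" by (rule step[OF weaken[OF Suc]])
    moreover have "(L ^^ n) ((L ^^ (n * Suc k)) f) = (L ^^ (n * Suc (Suc k))) f"
      by (metis comp_apply funpow_add mult_Suc_right)
    ultimately show ?case by simp
  qed
  obtain n0 where n0: "\<And>m. m \<ge> n0 \<Longrightarrow> \<exists>c>0. \<forall>f. bv_density A f \<longrightarrow> ess_ge {0..1} c ((L ^^ m) f)"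
    using minorization by blast
  define N where "N = n * Suc n0"
  have "1 * Suc n0 \<le> N" unfolding N_def using n by (rule mult_le_mono1)
  then have N: "n0 \<le> N" "1 \<le> N" by auto
  obtain c0 where c0: "c0 > 0" "\<And>f. bv_density A f \<Longrightarrow> ess_ge {0..1} c0 ((L ^^ N) f)" using n0[OF N(1)] by blast
  define c where "c = min c0 (1 / 8)"
  have c: "0 < c" "c \<le> 1 / 8" "c \<le> c0" using c0 by (auto simp: c_def)
  define R where "R f x = ((L ^^ N) f x - c * indicator {0..1} x) / (1 - c)" for f :: "real \<Rightarrow> real" and x :: real
  have R: "bv_density A (R f)" if f: "bv_density A f" for f
  proof -
    note gD = bv_densityD[OF steps[OF f, of n0, folded N_def]]
    have "bvar (\<lambda>x. (L ^^ N) f x + (-c) * indicator {0..1} x) (3 * A / 4 + \<bar>-c\<bar> * 2)"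
      by (intro bvar_add gD bvar_cmult bvar_indicator) simp
    from bvar_cmult[OF this, of "1 / (1 - c)"]
    have "bvar (R f) (\<bar>1 / (1 - c)\<bar> * (3 * A / 4 + \<bar>-c\<bar> * 2))"
      unfolding R_def[abs_def] by (simp add: field_simps)
    moreover have "\<bar>1 / (1 - c)\<bar> * (3 * A / 4 + \<bar>-c\<bar> * 2) \<le> A"
    proof -
      have "c * A \<le> (1 / 8) * A" using c A4 by (intro mult_right_mono) auto
      moreover have "A * (1 - c) = A - c * A" by (simp add: right_diff_distrib)
      ultimately have "3 * A / 4 + c * 2 \<le> A * (1 - c)" using c A4 by linarith
      then show ?thesis using c by (simp add: field_simps)
    qed
    ultimately have bv: "bvar (R f) A" by (rule bvar_mono)
    have sp: "supp01 (R f)" using gD(2) by (auto simp: supp01_def R_def)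
    have "{x. R f x < 0} \<subseteq> {x\<in>{0..1}. (L ^^ N) f x < c0}"
    proof
      fix x assume x: "x \<in> {x. R f x < 0}"
      then have x01: "x \<in> {0..1}" using sp by (auto simp: supp01_def)
      have "(L ^^ N) f x - c < 0" using x x01 c by (simp add: R_def divide_less_0_iff)
      then show "x \<in> {x\<in>{0..1}. (L ^^ N) f x < c0}" using x01 c by auto
    qed
    then have nn: "ess_nonneg (R f)"
      unfolding ess_nonneg_def using c0(2)[OF f] by (auto simp: ess_ge_def intro: finite_subset)
    have "(LBINT x. R f x) = (LBINT x. (L ^^ N) f x - c * indicator {0..1} x) / (1 - c)"
      unfolding R_def[abs_def] by (rule Bochner_Integration.integral_divide_zero)
    also have "(LBINT x. (L ^^ N) f x - c * indicator {0..1} x)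
        = (LBINT x. (L ^^ N) f x) - (LBINT x. c * indicator {0..1::real} x)"
      using bvar_integrable[OF gD(1,2)] by (intro Bochner_Integration.integral_diff) auto
    also have "(LBINT x. c * indicator {0..1::real} x) = c"
      by (subst Bochner_Integration.integral_mult_right_zero) (simp only: integral_unit_indicator mult_1_right)
    also have "((LBINT x. (L ^^ N) f x) - c) / (1 - c) = 1" using gD(4) c by simp
    finally show ?thesis using bv sp nn by (simp add: bv_density_def)
  qed
  have pair: "\<exists>f' g'. bv_density A f' \<and> bv_density A g' \<and> (\<forall>x. (L ^^ N) f x - (L ^^ N) g x = (1 - c) * (f' x - g' x))"
    if f: "bv_density A f" and g: "bv_density A g" for f g
  proof -
    have "(L ^^ N) f x - (L ^^ N) g x = (1 - c) * (R f x - R g x)" for x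
      using c by (simp add: R_def diff_divide_distrib[symmetric])
    then show ?thesis using R[OF f] R[OF g] by blast
  qed
  show ?thesis
  proof (rule exI[of _ A], rule conjI[OF A4], rule exI[of _ N], rule conjI[OF N(2)], rule exI[of _ c], intro conjI allI impI)
    show "0 < c" "c < 1" using c by auto
  qed (rule pair)
qed

text \<open>The geometric rate is stated for the variation, which dominates the supremum; the bounds on the
solution of the Poisson equation follow by summation.\<close>

definition decays :: "real \<Rightarrow> real \<Rightarrow> bool" where
  "decays E r \<longleftrightarrow> 0 \<le> E \<and> 0 < r \<and> r < 1 \<and> (\<forall>f V n. 0 < V \<longrightarrow> bvar f V \<longrightarrow> supp01 f \<longrightarrow>
     (LBINT x. f x) = 0 \<longrightarrow> bvar ((L ^^ n) f) (E * V * r ^ n))"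

text \<open>A function \<open>f\<close> of variation \<open>V\<close> with zero integral is \<open>V\<close> times the difference of the densities
\<open>f / V + 1\<close> and \<open>1\<close>, both of variation at most three.\<close>

lemma exponential_decay: "\<exists>E r. decays E r"
proof -
  obtain A N c where A: "A \<ge> 4" and N: "N \<ge> 1" and c: "0 < c" "c < 1" and
    con: "\<And>f g. bv_density A f \<Longrightarrow> bv_density A g \<Longrightarrow>
     \<exists>f' g'. bv_density A f' \<and> bv_density A g' \<and> (\<forall>x. (L ^^ N) f x - (L ^^ N) g x = (1 - c) * (f' x - g' x))"
    using contraction by metis
  have iter: "\<exists>f' g'. bv_density A f' \<and> bv_density A g' \<and>
      (\<forall>x. (L ^^ (N * k)) f x - (L ^^ (N * k)) g x = (1 - c) ^ k * (f' x - g' x))"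
    if f: "bv_density A f" and g: "bv_density A g" for f g k
  proof (induction k)
    case 0 then show ?case using f g by auto
  next
    case (Suc k)
    then obtain f1 g1 where 1: "bv_density A f1" "bv_density A g1"
      "\<And>x. (L ^^ (N * k)) f x - (L ^^ (N * k)) g x = (1 - c) ^ k * (f1 x - g1 x)" by blast
    obtain f2 g2 where 2: "bv_density A f2" "bv_density A g2"
      "\<And>x. (L ^^ N) f1 x - (L ^^ N) g1 x = (1 - c) * (f2 x - g2 x)" using con[OF 1(1,2)] by blast
    have s: "(L ^^ (N * Suc k)) u = (L ^^ N) ((L ^^ (N * k)) u)" for u
      by (metis comp_apply funpow_add mult_Suc_right)
    have "(L ^^ (N * Suc k)) f x - (L ^^ (N * Suc k)) g x = (1 - c) ^ Suc k * (f2 x - g2 x)" for x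
    proof -
      have "(L ^^ (N * Suc k)) f x - (L ^^ (N * Suc k)) g x
          = (L ^^ N) (\<lambda>x. (L ^^ (N * k)) f x - (L ^^ (N * k)) g x) x" by (simp only: s Ln_diff)
      also have "\<dots> = (1 - c) ^ k * ((L ^^ N) f1 x - (L ^^ N) g1 x)"
        by (simp add: 1(3) Ln_cmult Ln_diff)
      finally show ?thesis by (simp add: 2(3))
    qed
    then show ?case using 2(1,2) by blast
  qed
  obtain Cr where Cr: "\<And>n. 0 \<le> Cr n" "\<And>n f B. bvar f B \<Longrightarrow> supp01 f \<Longrightarrow> bvar ((L ^^ n) f) (Cr n * B)"
    using Ln_bvar by metis
  define C where "C = (\<Sum>n<N. Cr n)"
  have C: "Cr n \<le> C" if "n < N" for n unfolding C_def using Cr(1) that by (intro member_le_sum) auto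
  have C0: "0 \<le> C" unfolding C_def using Cr(1) by (intro sum_nonneg) auto
  define \<rho> where "\<rho> = 1 - c"
  have \<rho>: "0 < \<rho>" "\<rho> < 1" using c by (auto simp: \<rho>_def)
  \<comment> \<open>turns the rate \<open>\<rho>\<close> per \<open>N\<close> steps into a rate per step\<close>
  define r where "r = root N \<rho>"
  have r: "0 < r" "r < 1" "r ^ N = \<rho>" using \<rho> N by (auto simp: r_def)
  show ?thesis unfolding decays_def
  proof (rule exI[of _ "2 * A * C / \<rho>"], rule exI[of _ r], intro conjI allI impI r)
    show "0 \<le> 2 * A * C / \<rho>" using A C0 \<rho> by simp
    fix f :: "real \<Rightarrow> real" and V n
    assume V: "0 < V" and f: "bvar f V" "supp01 f" "(LBINT x. f x) = 0"
    define F where "F x = (1 / V) * f x + indicator {0..1} x" for x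
    let ?one = "indicator {0..1} :: real \<Rightarrow> real"
    have one: "bv_density A ?one"
      using bv_density_weaken[OF bv_density_unit] A by simp
    have "bvar F (\<bar>1 / V\<bar> * V + 2)" unfolding F_def[abs_def] by (intro bvar_add bvar_cmult f bvar_indicator) simp
    then have bF: "bvar F A" by (rule bvar_mono) (use V A in simp)
    have sF: "supp01 F" using f(2) by (auto simp: supp01_def F_def)
    have "0 \<le> F x" for x
    proof (cases "x \<in> {0..1}")
      case True
      have "- V \<le> f x" using bvar_bound[OF f(1,2), of x] by linarith
      then have "- 1 \<le> f x / V" using V by (simp add: field_simps)
      then show ?thesis using True by (simp add: F_def)
    qed (use sF in \<open>auto simp: supp01_def\<close>)
    then have "{x. F x < 0} = {}" by (auto simp: not_less)
    then have nF: "ess_nonneg F" unfolding ess_nonneg_def by (simp only: finite.emptyI)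
    have "(LBINT x. F x) = (LBINT x. (1 / V) * f x) + (LBINT x. ?one x)"
      unfolding F_def by (rule Bochner_Integration.integral_add) (use bvar_integrable[OF f(1,2)] in auto)
    then have "(LBINT x. F x) = 1"
      unfolding integral_unit_indicator Bochner_Integration.integral_mult_right_zero f(3) by simp
    with bF sF nF have F: "bv_density A F" by (simp add: bv_density_def)
    define k where "k = n div N"
    define m where "m = n mod N"
    have nkm: "n = m + N * k" and m: "m < N" using N by (auto simp: k_def m_def)
    obtain f' g' where fg: "bv_density A f'" "bv_density A g'"
      "\<And>x. (L ^^ (N * k)) F x - (L ^^ (N * k)) ?one x = (1 - c) ^ k * (f' x - g' x)" using iter[OF F one] by blast
    have fF: "f = (\<lambda>x. V * (F x - ?one x))" using V by (auto simp: F_def)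
    have e: "(L ^^ (N * k)) f = (\<lambda>x. V * \<rho> ^ k * (f' x + (-1) * g' x))"
    proof
      fix x
      have "(L ^^ (N * k)) f x = V * ((L ^^ (N * k)) F x - (L ^^ (N * k)) ?one x)"
        by (subst fF) (simp only: Ln_cmult Ln_diff)
      then show "(L ^^ (N * k)) f x = V * \<rho> ^ k * (f' x + (-1) * g' x)" by (simp add: fg(3) \<rho>_def)
    qed
    have "bvar ((L ^^ (N * k)) f) (\<bar>V * \<rho> ^ k\<bar> * (A + \<bar>-1\<bar> * A))"
      unfolding e by (intro bvar_cmult bvar_add bv_densityD(1) fg)
    then have "bvar ((L ^^ (N * k)) f) (2 * A * V * \<rho> ^ k)"
      by (rule bvar_mono) (use V \<rho> in \<open>simp add: algebra_simps\<close>)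
    then have "bvar ((L ^^ m) ((L ^^ (N * k)) f)) (Cr m * (2 * A * V * \<rho> ^ k))"
      by (intro Cr(2) Ln_supp01 f(2))
    moreover have "(L ^^ m) ((L ^^ (N * k)) f) = (L ^^ n) f" by (simp add: nkm funpow_add)
    ultimately have "bvar ((L ^^ n) f) (Cr m * (2 * A * V * \<rho> ^ k))" by simp
    then show "bvar ((L ^^ n) f) (2 * A * C / \<rho> * V * r ^ n)"
    proof (rule bvar_mono)
      have "\<rho> = r ^ N" using r by simp
      also have "\<dots> \<le> r ^ m" using r m by (intro power_decreasing) auto
      finally have "\<rho> * \<rho> ^ k \<le> r ^ m * \<rho> ^ k" using \<rho> by (intro mult_right_mono) auto
      also have "\<dots> = r ^ n" by (simp add: nkm power_add power_mult r(3))
      finally have "\<rho> ^ k \<le> r ^ n / \<rho>" using \<rho> by (simp add: field_simps)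
      then have "Cr m * (2 * A * V * \<rho> ^ k) \<le> C * (2 * A * V * (r ^ n / \<rho>))"
        using C[OF m] Cr(1)[of m] V A \<rho> C0 by (intro mult_mono) auto
      then show "Cr m * (2 * A * V * \<rho> ^ k) \<le> 2 * A * C / \<rho> * V * r ^ n" by (simp add: mult_ac)
    qed
  qed
qed

text \<open>Solution of the cohomological (Poisson) equation.\<close>

text \<open>The Neumann series for the inverse of the identity minus \<open>L\<close>.\<close>

definition poisson_sum :: "(real \<Rightarrow> real) \<Rightarrow> real \<Rightarrow> real" where
  "poisson_sum f x = (\<Sum>n. (L ^^ n) f x)"

lemma poisson_sum:
  assumes dec: "decays E r" and V: "0 < V" and f: "bvar f V" "supp01 f" "(LBINT x. f x) = 0"
  shows "bvar ((L ^^ n) f) (E * V * r ^ n)" "summable (\<lambda>n. (L ^^ n) f x)"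
    "(\<Sum>k<n. \<bar>(L ^^ k) f x\<bar>) \<le> E * V / (1 - r)"
    "bvar (poisson_sum f) (E * V / (1 - r))" "supp01 (poisson_sum f)"
    "L (poisson_sum f) x = poisson_sum f x - f x"
proof -
  have E: "0 \<le> E" and r: "0 < r" "r < 1" and d: "bvar ((L ^^ n) f) (E * V * r ^ n)" for n
    using dec V f unfolding decays_def by auto
  show "bvar ((L ^^ n) f) (E * V * r ^ n)" by (rule d)
  have b: "\<bar>(L ^^ n) f x\<bar> \<le> E * V * r ^ n" for n x by (rule bvar_bound[OF d Ln_supp01[OF f(2)]])
  have sr: "summable (\<lambda>n. E * V * r ^ n)" using r by (intro summable_mult summable_geometric) simp
  have geo: "(\<Sum>n. E * V * r ^ n) = E * V / (1 - r)"
    using r by (subst suminf_mult) (auto simp: suminf_geometric)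
  have s: "summable (\<lambda>n. (L ^^ n) f x)" for x
    by (rule summable_comparison_test'[OF sr, of 0]) (use b in simp)
  then show "summable (\<lambda>n. (L ^^ n) f x)" .
  have "(\<Sum>k<n. \<bar>(L ^^ k) f x\<bar>) \<le> (\<Sum>k<n. E * V * r ^ k)" by (rule sum_mono) (rule b)
  also have "\<dots> \<le> (\<Sum>k. E * V * r ^ k)" by (rule sum_le_suminf[OF sr]) (use E V r in auto)
  finally show "(\<Sum>k<n. \<bar>(L ^^ k) f x\<bar>) \<le> E * V / (1 - r)" unfolding geo .
  show "bvar (poisson_sum f) (E * V / (1 - r))"
    using bvar_suminf[OF d sr s] unfolding geo poisson_sum_def[abs_def] .
  have "(L ^^ n) f x = 0" if "x \<notin> {0..1}" for n x using Ln_supp01[OF f(2)] that by (auto simp: supp01_def)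
  then show "supp01 (poisson_sum f)" unfolding supp01_def poisson_sum_def by simp
  have "L (\<lambda>x. \<Sum>n. (L ^^ n) f x) x = (\<Sum>n. (L ^^ Suc n) f x)" using L_suminf(1)[OF s] by simp
  also have "\<dots> = (\<Sum>n. (L ^^ n) f x) - (L ^^ 0) f x" by (rule suminf_split_head[OF s])
  finally show "L (poisson_sum f) x = poisson_sum f x - f x" unfolding poisson_sum_def[abs_def] by simp
qed

section \<open>The invariant density\<close>

text \<open>With \<open>f = L 1 - 1\<close>, which has zero integral, the partial sums of \<open>1 + f + L f + \<dots>\<close> are the iterates
\<open>L\<^sup>n 1\<close>. The series provides their limit together with its variation bound and the exact
invariance; the lower bound then follows from minorization applied to \<open>h = L\<^sup>n h\<close>.\<close>

lemma invariant_density: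
  "\<exists>h A c. 0 < c \<and> bv_density A h \<and> L h = h \<and> (\<forall>x. 0 \<le> h x) \<and> ess_ge {0..1} c h"
proof -
  let ?one = "indicator {0..1} :: real \<Rightarrow> real"
  have one: "bvar ?one 2" "supp01 ?one" by (auto simp: bvar_indicator supp01_def)
  obtain C where C: "bvar (L ?one) C" using L_bvar one by blast
  define f where "f x = L ?one x - ?one x" for x
  define V where "V = C + 2"
  have "bvar (\<lambda>x. L ?one x + (-1) * ?one x) (C + \<bar>-1\<bar> * 2)" by (intro bvar_add C bvar_cmult one)
  then have bf: "bvar f V" by (simp add: f_def[abs_def] V_def)
  have V0: "0 < V" using bvar_nonneg[OF C] by (simp add: V_def)
  have sf: "supp01 f" using L_supp01 one(2) by (auto simp: supp01_def f_def)
  have "(LBINT x. f x) = (LBINT x. L ?one x) - (LBINT x. ?one x)"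
    unfolding f_def by (rule Bochner_Integration.integral_diff) (use bvar_integrable[OF C L_supp01] in auto)
  then have intf: "(LBINT x. f x) = 0" using Ln_integral[OF one, of 1] by simp
  obtain E r where dec: "decays E r" using exponential_decay by blast
  note ps = poisson_sum[OF dec V0 bf sf intf]
  define h where "h x = ?one x + poisson_sum f x" for x
  have bh: "bvar h (2 + E * V / (1 - r))" unfolding h_def[abs_def] by (intro bvar_add one ps(4))
  have sh: "supp01 h" using ps(5) one(2) by (auto simp: supp01_def h_def)
  have Lh: "L h = h"
  proof
    fix x
    have "L h x = L ?one x + L (poisson_sum f) x" unfolding h_def[abs_def] by (simp add: L_add)
    then show "L h x = h x" unfolding ps(6) by (simp add: h_def f_def)
  qed
  have Ln1: "(L ^^ n) ?one x = ?one x + (\<Sum>k<n. (L ^^ k) f x)" for n x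
  proof (induction n)
    case (Suc n)
    have "(L ^^ n) f x = (L ^^ n) (L ?one) x - (L ^^ n) ?one x" unfolding f_def[abs_def] by (simp add: Ln_diff)
    then show ?case using Suc by (simp add: funpow_swap1)
  qed simp
  have lim: "(\<lambda>n. (L ^^ n) ?one x) \<longlonglongrightarrow> h x" for x
    unfolding Ln1 h_def poisson_sum_def by (intro tendsto_intros summable_LIMSEQ ps(2))
  have h0: "0 \<le> h x" for x
    by (rule LIMSEQ_le_const[OF lim]) (auto intro!: Ln_nonneg)
  have "{x. h x < 0} = {}" using h0 by (auto simp: not_less)
  then have nh: "ess_nonneg h" unfolding ess_nonneg_def by (simp only: finite.emptyI)
  have "(\<lambda>n. LBINT x. (L ^^ n) ?one x) \<longlonglongrightarrow> (LBINT x. h x)"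
  proof (rule integral_dominated_convergence)
    let ?w = "\<lambda>x. (1 + E * V / (1 - r)) * ?one x"
    show "integrable lborel ?w" by simp
    show "h \<in> borel_measurable lborel" using bvar_measurable[OF bh] by simp
    show "(L ^^ n) ?one \<in> borel_measurable lborel" for n
    proof -
      obtain C where "bvar ((L ^^ n) ?one) C" using Ln_bvar[of n] one by blast
      then show ?thesis using bvar_measurable by simp
    qed
    show "AE x in lborel. (\<lambda>n. (L ^^ n) ?one x) \<longlonglongrightarrow> h x" using lim by simp
    fix n
    show "AE x in lborel. norm ((L ^^ n) ?one x) \<le> ?w x"
    proof (rule AE_I2)
      fix x :: real
      show "norm ((L ^^ n) ?one x) \<le> ?w x"
      proof (cases "x \<in> {0..1}")
        case True
        have "\<bar>\<Sum>k<n. (L ^^ k) f x\<bar> \<le> E * V / (1 - r)" by (rule order_trans[OF sum_abs ps(3)])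
        then show ?thesis using True by (simp add: Ln1)
      next
        case False
        then show ?thesis using Ln_supp01[OF one(2)] by (auto simp: supp01_def)
      qed
    qed
  qed
  moreover have "(LBINT x. (L ^^ n) ?one x) = 1" for n using Ln_integral[OF one, of n] by simp
  ultimately have "(LBINT x. h x) = 1" by (simp add: LIMSEQ_const_iff)
  with bh sh nh have dh: "bv_density (2 + E * V / (1 - r)) h" by (simp add: bv_density_def)
  obtain n c where c: "0 < c" "ess_ge {0..1} c ((L ^^ n) h)" using minorization dh by blast
  have "(L ^^ n) h = h" by (induction n) (auto simp: Lh)
  then show ?thesis using c dh Lh h0 by auto
qed


lemma koopman_nonneg: "(\<And>x. 0 \<le> u x) \<Longrightarrow> 0 \<le> koopman u x"
  unfolding koopman_def by (intro sum_nonneg) auto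

text \<open>Replace \<open>h0\<close> by an approximation \<open>g\<close> of bounded variation. For large \<open>n\<close> the function
\<open>L\<^sup>n g\<close> is close to a multiple of \<open>h\<close>, whereas stationarity allows \<open>n\<close> steps to be inserted for free
in the integral of \<open>u\<close> against \<open>h0\<close>.\<close>

lemma stationary_density_unique:
  assumes h: "bv_density A h" "L h = h"
    and h0: "integrable lborel h0" "supp01 h0" "(LBINT x. h0 x) = 1"
    and st: "\<And>u U. u \<in> borel_measurable borel \<Longrightarrow> (\<And>x. \<bar>u x\<bar> \<le> U) \<Longrightarrow>
      (LBINT x. h0 x * koopman u x) = (LBINT x. h0 x * u x)"
    and u: "u \<in> borel_measurable borel" "\<And>x. \<bar>u x\<bar> \<le> U"
  shows "(LBINT x. h0 x * u x) = (LBINT x. h x * u x)"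
proof -
  note hD = bv_densityD[OF h(1)]
  have U0: "0 \<le> U" using u(2)[of 0] by linarith
  define \<mu>u where "\<mu>u = (LBINT x. h x * u x)"
  obtain E r where dec: "decays E r" using exponential_decay by blast
  then have r: "0 < r" "r < 1" by (auto simp: decays_def)
  have kn: "(koopman ^^ n) u \<in> borel_measurable borel" "\<bar>(koopman ^^ n) u x\<bar> \<le> U" for n x
    using Ln_dual(2,3)[OF hD(1,2) u] by auto
  have int: "integrable lborel (\<lambda>x. f x * w x)"
    if "integrable lborel f" "w \<in> borel_measurable borel" "\<And>x. \<bar>w x\<bar> \<le> U" for f w :: "real \<Rightarrow> real"
  proof (rule Bochner_Integration.integrable_bound[of lborel "\<lambda>x. U * f x"])
    show "(\<lambda>x. f x * w x) \<in> borel_measurable lborel"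
      using borel_measurable_integrable[OF that(1)] that(2) by measurable
    show "AE x in lborel. norm (f x * w x) \<le> norm (U * f x)"
    proof (rule AE_I2)
      fix x show "norm (f x * w x) \<le> norm (U * f x)"
        using mult_right_mono[OF that(3)[of x], of "\<bar>f x\<bar>"] U0 by (simp add: abs_mult mult.commute)
    qed
  qed (use that(1) in simp)
  have bound: "\<bar>LBINT x. f x * w x\<bar> \<le> U * (LBINT x. \<bar>f x\<bar>)"
    if "integrable lborel f" "w \<in> borel_measurable borel" "\<And>x. \<bar>w x\<bar> \<le> U" for f w :: "real \<Rightarrow> real"
  proof -
    have "\<bar>LBINT x. f x * w x\<bar> \<le> (LBINT x. \<bar>f x * w x\<bar>)"
      by (rule integral_abs_bound)
    also have "\<dots> \<le> (LBINT x. U * \<bar>f x\<bar>)"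
    proof (rule integral_mono)
      fix x show "\<bar>f x * w x\<bar> \<le> U * \<bar>f x\<bar>"
        using mult_right_mono[OF that(3)[of x], of "\<bar>f x\<bar>"] by (simp add: abs_mult mult.commute)
    qed (use int[OF that] that(1) in auto)
    finally show ?thesis by simp
  qed
  have st_n: "(LBINT x. h0 x * (koopman ^^ n) u x) = (LBINT x. h0 x * u x)" for n
  proof (induction n)
    case (Suc n) then show ?case using st[OF kn] by simp
  qed simp
  have est: "\<bar>(LBINT x. h0 x * u x) - \<mu>u\<bar> \<le> 3 * U * e + e" if e: "e > 0" for e
  proof -
    have "bv_approximable (\<lambda>x. indicator {0..1} x * h0 x)" by (rule integrable_bv_approximable[OF h0(1)])
    moreover have "(\<lambda>x. indicator {0..1} x * h0 x) = h0" using h0(2) by (auto simp: supp01_def indicator_def fun_eq_iff)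
    ultimately have "bv_approximable h0" by simp
    then obtain g B where g: "bvar g B" "supp01 g" "(LBINT x. \<bar>h0 x - g x\<bar>) < e"
      using e unfolding bv_approximable_def by blast
    have gi: "integrable lborel g" by (rule bvar_integrable[OF g(1,2)])
    define m where "m = (LBINT x. g x)"
    have "\<bar>1 - m\<bar> = \<bar>LBINT x. h0 x - g x\<bar>" using h0(1,3) gi by (simp add: m_def)
    also have "\<dots> \<le> (LBINT x. \<bar>h0 x - g x\<bar>)" by (rule integral_abs_bound)
    finally have m1: "\<bar>1 - m\<bar> \<le> e" using g(3) by linarith
    define f where "f x = g x + (- m) * h x" for x
    define V where "V = B + \<bar>- m\<bar> * A + 1"
    have "bvar f (B + \<bar>- m\<bar> * A)" unfolding f_def[abs_def] by (intro bvar_add bvar_cmult g hD)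
    then have bf: "bvar f V" by (rule bvar_mono) (simp add: V_def)
    have V: "0 < V" using bvar_nonneg[OF g(1)] bvar_nonneg[OF hD(1)] by (simp add: V_def add_nonneg_pos)
    have sf: "supp01 f" using g(2) hD(2) by (auto simp: supp01_def f_def)
    have hi: "integrable lborel h" by (rule bvar_integrable[OF hD(1,2)])
    have "(LBINT x. f x) = m + (- m) * 1" unfolding f_def
      using gi hi hD(4) by (simp add: m_def)
    then have intf: "(LBINT x. f x) = 0" by simp
    note dn = poisson_sum(1)[OF dec V bf sf intf]
    have "(\<lambda>n. U * (E * V * r ^ n)) \<longlonglongrightarrow> U * (E * V * 0)"
      using r by (intro tendsto_intros LIMSEQ_power_zero) simp
    then have "\<exists>n. U * (E * V * r ^ n) < e"
      using order_tendstoD(2)[of _ "U * (E * V * 0)" sequentially e] e by (auto simp: eventually_sequentially)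
    then obtain n where n: "U * (E * V * r ^ n) < e" by blast
    define kn' where "kn' = (koopman ^^ n) u"
    have kk: "kn' \<in> borel_measurable borel" "\<And>x. \<bar>kn' x\<bar> \<le> U" using kn by (auto simp: kn'_def)
    have 1: "\<bar>LBINT x. (h0 x - g x) * kn' x\<bar> \<le> U * e"
    proof -
      have "\<bar>LBINT x. (h0 x - g x) * kn' x\<bar> \<le> U * (LBINT x. \<bar>h0 x - g x\<bar>)"
        by (rule bound) (use h0(1) gi kk in auto)
      also have "\<dots> \<le> U * e" using g(3) U0 by (intro mult_left_mono) auto
      finally show ?thesis .
    qed
    have 2: "\<bar>LBINT x. f x * kn' x\<bar> \<le> e"
    proof -
      have "(LBINT x. f x * kn' x) = (LBINT x. (L ^^ n) f x * u x)"
        unfolding kn'_def by (rule Ln_dual(1)[OF bf sf u, symmetric])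
      moreover have "\<bar>LBINT x. (L ^^ n) f x * u x\<bar> \<le> U * (LBINT x. \<bar>(L ^^ n) f x\<bar>)"
        by (rule bound[OF bvar_integrable[OF dn Ln_supp01[OF sf]] u])
      moreover have "\<dots> \<le> U * (E * V * r ^ n)"
        by (intro mult_left_mono U0 integral_abs_le_bound[OF bvar_measurable[OF dn] Ln_supp01[OF sf] bvar_bound[OF dn Ln_supp01[OF sf]]])
      ultimately show ?thesis using n by linarith
    qed
    have Lnh: "(L ^^ k) h = h" for k by (induction k) (auto simp: h(2))
    have 3: "(LBINT x. h x * kn' x) = \<mu>u"
      using Ln_dual(1)[OF hD(1,2) u, of n] by (simp add: Lnh kn'_def \<mu>u_def)
    have "(LBINT x. h0 x * u x) = (LBINT x. h0 x * kn' x)" unfolding kn'_def by (rule st_n[symmetric])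
    also have "\<dots> = (LBINT x. (h0 x - g x) * kn' x + (f x * kn' x + m * (h x * kn' x)))"
      by (rule Bochner_Integration.integral_cong) (auto simp: f_def algebra_simps)
    also have "\<dots> = (LBINT x. (h0 x - g x) * kn' x) + ((LBINT x. f x * kn' x) + m * (LBINT x. h x * kn' x))"
      using int[of "\<lambda>x. h0 x - g x", OF _ kk] int[OF bvar_integrable[OF bf sf] kk] int[OF hi kk] h0(1) gi by simp
    finally have eq: "(LBINT x. h0 x * u x) - \<mu>u
        = (LBINT x. (h0 x - g x) * kn' x) + (LBINT x. f x * kn' x) - (1 - m) * \<mu>u"
      by (simp add: 3 algebra_simps)
    have "\<bar>\<mu>u\<bar> \<le> U * (LBINT x. \<bar>h x\<bar>)" unfolding \<mu>u_def by (rule bound[OF hi u])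
    also have "(LBINT x. \<bar>h x\<bar>) = 1"
      using integral_abs_ess_nonneg[OF hD(3) bvar_measurable[OF hD(1)]] hD(4) by simp
    finally have "\<bar>(1 - m) * \<mu>u\<bar> \<le> e * U" unfolding abs_mult using m1 e by (intro mult_mono) auto
    then have "\<bar>(LBINT x. h0 x * u x) - \<mu>u\<bar> \<le> U * e + e + e * U" unfolding eq using 1 2 by linarith
    moreover have "0 \<le> U * e" using U0 e by simp
    moreover have "3 * U * e = 3 * (U * e)" "e * U = U * e" by simp_all
    ultimately show ?thesis by linarith
  qed
  have "\<bar>(LBINT x. h0 x * u x) - \<mu>u\<bar> \<le> 0 + e" if e: "e > 0" for e
  proof -
    have "0 < e / (3 * U + 1)" using e U0 by simp
    from est[OF this] have "\<bar>(LBINT x. h0 x * u x) - \<mu>u\<bar> \<le> (3 * U + 1) * (e / (3 * U + 1))"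
      by (simp only: distrib_right mult_1_left)
    also have "\<dots> = e" using U0 by (simp add: add_nonneg_eq_0_iff)
    finally show ?thesis by simp
  qed
  then have "\<bar>(LBINT x. h0 x * u x) - \<mu>u\<bar> \<le> 0" by (rule field_le_epsilon)
  then show ?thesis by (simp add: \<mu>u_def)
qed

section \<open>Exponential moments of Birkhoff sums\<close>

text \<open>The expectation, over the random words, of the exponential of the Birkhoff sum of \<open>f\<close> along the orbit
started at the given point; see lemma \<open>nn_integral_exp_birkhoff\<close>.\<close>

primrec exp_sum :: "(real \<Rightarrow> real) \<Rightarrow> nat \<Rightarrow> real \<Rightarrow> real" where
  "exp_sum f 0 = (\<lambda>x. 1)"
| "exp_sum f (Suc n) = (\<lambda>x. exp (f x) * koopman (exp_sum f n) x)"

lemma exp_sum_props: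
  assumes "f \<in> borel_measurable borel" "\<And>x. \<bar>f x\<bar> \<le> b"
  shows "exp_sum f n \<in> borel_measurable borel" "0 \<le> exp_sum f n x" "\<bar>exp_sum f n x\<bar> \<le> exp b ^ n"
proof -
  have "exp_sum f n \<in> borel_measurable borel \<and> (\<forall>x. 0 \<le> exp_sum f n x) \<and> (\<forall>x. \<bar>exp_sum f n x\<bar> \<le> exp b ^ n)"
  proof (induction n)
    case (Suc n)
    have "koopman (exp_sum f n) \<in> borel_measurable borel" using Suc by (intro koopman_measurable) auto
    then have "exp_sum f (Suc n) \<in> borel_measurable borel" using assms(1) by simp
    moreover have "0 \<le> exp_sum f (Suc n) x" for x using Suc by (simp add: koopman_nonneg)
    moreover have "\<bar>exp_sum f (Suc n) x\<bar> \<le> exp b ^ Suc n" for x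
    proof -
      have "f x \<le> b" using assms(2)[of x] by linarith
      moreover have "\<bar>koopman (exp_sum f n) x\<bar> \<le> exp b ^ n" using Suc by (intro koopman_bound) auto
      ultimately show ?thesis by (simp add: abs_mult mult_mono)
    qed
    ultimately show ?case by blast
  qed simp
  then show "exp_sum f n \<in> borel_measurable borel" "0 \<le> exp_sum f n x" "\<bar>exp_sum f n x\<bar> \<le> exp b ^ n" by auto
qed

lemma L_cong_off_finite:
  assumes "finite X" "\<And>x. x \<notin> X \<Longrightarrow> f x = g x"
  shows "finite {y. L f y \<noteq> L g y}"
proof (rule finite_subset)
  show "finite (\<Union>\<omega>. T \<omega> ` X)" using assms(1) by simp
  show "{y. L f y \<noteq> L g y} \<subseteq> (\<Union>\<omega>. T \<omega> ` X)"
  proof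
    fix y assume "y \<in> {y. L f y \<noteq> L g y}"
    then have ne: "L f y \<noteq> L g y" by simp
    show "y \<in> (\<Union>\<omega>. T \<omega> ` X)"
    proof (rule ccontr)
      assume y: "y \<notin> (\<Union>\<omega>. T \<omega> ` X)"
      have "transfer (S \<omega>) (T \<omega>) f y = transfer (S \<omega>) (T \<omega>) g y" for \<omega>
        unfolding transfer_def by (rule sum.cong[OF refl]) (use y assms(2) in fastforce)
      then have "L f y = L g y" unfolding L_def by simp
      with ne show False by simp
    qed
  qed
qed

lemma L_mono: "(\<And>x. f x \<le> g x) \<Longrightarrow> L f y \<le> L g y"
  unfolding L_def transfer_def
  by (intro sum_mono mult_left_mono divide_right_mono) auto

text \<open>The supersolution argument. Since \<open>h\<close> is at least \<open>c\<close> off a finite subset of the unit interval,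
\<open>g = G / h\<close> and \<open>a = g - \<phi>\<close> are bounded, and \<open>R\<close> bounds the differences \<open>g x - a y\<close>. Duality
transfers each step of \<open>exp_sum\<close> into one application of \<open>L\<close> to \<open>h exp (s g)\<close>; starting from
\<open>h exp (s a)\<close> instead of \<open>h\<close> costs the boundary factor \<open>exp (2 \<bar>s\<bar> R)\<close>.\<close>

lemma exponential_moment:
  assumes h: "bv_density A h" "L h = h" "\<And>x. 0 \<le> h x" "0 < c" "ess_ge {0..1} c h"
    and dec: "decays E r"
    and \<phi>: "\<phi> \<in> borel_measurable borel" "\<And>x. \<bar>\<phi> x\<bar> \<le> 1" "0 < V" "bvar (\<lambda>x. \<phi> x * h x) V"
      "(LBINT x. \<phi> x * h x) = 0"
  defines "R \<equiv> 2 * (E * V / (1 - r) / c) + 1"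
  shows "(LBINT x. h x * exp_sum (\<lambda>x. s * \<phi> x) n x) \<le> exp (2 * \<bar>s\<bar> * R + real n * s\<^sup>2 * R\<^sup>2)"
proof -
  note hD = bv_densityD[OF h(1)]
  have hm: "h \<in> borel_measurable borel" by (rule bvar_measurable[OF hD(1)])
  have hA: "\<bar>h x\<bar> \<le> A" for x by (rule bvar_bound[OF hD(1,2)])
  have sp: "supp01 (\<lambda>x. \<phi> x * h x)" using hD(2) by (auto simp: supp01_def)
  define G where "G = poisson_sum (\<lambda>x. \<phi> x * h x)"
  define Gb where "Gb = E * V / (1 - r)"
  note ps = poisson_sum[OF dec \<phi>(3,4) sp \<phi>(5), folded G_def Gb_def]
  have Gb: "\<bar>G x\<bar> \<le> Gb" for x by (rule bvar_bound[OF ps(4,5)])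
  have Gb0: "0 \<le> Gb" using Gb[of 0] by linarith
  have Gm: "G \<in> borel_measurable borel" by (rule bvar_measurable[OF ps(4)])
  define R0 where "R0 = Gb / c"
  have "0 \<le> Gb / c" using Gb0 h(4) by simp
  then have R0: "0 \<le> R0" "R = 2 * R0 + 1" by (simp_all only: R0_def R_def Gb_def)
  define g where "g x = (if c \<le> h x then G x / h x else 0)" for x
  have gb: "\<bar>g x\<bar> \<le> R0" for x
    using Gb[of x] Gb0 h(4) R0(1) by (auto simp: g_def R0_def intro!: frac_le)
  have gm: "g \<in> borel_measurable borel" unfolding g_def[abs_def] using Gm hm by measurable
  define a where "a x = g x - \<phi> x" for x
  have am: "a \<in> borel_measurable borel" unfolding a_def[abs_def] using gm \<phi>(1) by measurable
  have ab: "\<bar>a x\<bar> \<le> R0 + 1" for x using gb[of x] \<phi>(2)[of x] by (auto simp: a_def)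
  have fin: "finite {x\<in>{0..1}. h x < c}" using h(5) by (simp add: ess_ge_def)
  have "finite {y. L (\<lambda>x. h x * g x) y \<noteq> L G y}"
  proof (rule L_cong_off_finite[OF fin])
    fix x assume x: "x \<notin> {x\<in>{0..1}. h x < c}"
    show "h x * g x = G x"
    proof (cases "x \<in> {0..1}")
      case True then show ?thesis using x h(4) by (auto simp: g_def)
    next
      case False then show ?thesis using hD(2) ps(5) by (auto simp: supp01_def)
    qed
  qed
  then have finX: "finite ({y. L (\<lambda>x. h x * g x) y \<noteq> L G y} \<union> {x\<in>{0..1}. h x < c})" (is "finite ?X")
    using fin by blast
  define q where "q = exp (s\<^sup>2 * R\<^sup>2)"
  have super: "L (\<lambda>x. h x * exp (s * g x)) y \<le> q * (h y * exp (s * a y))" if y: "y \<notin> ?X" for y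
  proof (cases "y \<in> {0..1}")
    case False
    then show ?thesis using L_supp01 hD(2) by (auto simp: supp01_def)
  next
    case True
    then have hy: "c \<le> h y" using y by auto
    have Lhg: "L (\<lambda>x. h x * g x) y = h y * a y"
    proof -
      have "L (\<lambda>x. h x * g x) y = G y - \<phi> y * h y" using y ps(6) by auto
      also have "\<dots> = h y * a y" using hy h(4) by (simp add: a_def g_def algebra_simps)
      finally show ?thesis .
    qed
    \<comment> \<open>centring at the value for the image point, where the linear term averages to zero\<close>
    define \<alpha> where "\<alpha> = a y"
    have "L (\<lambda>x. h x * exp (s * g x)) y \<le> L (\<lambda>x. (exp (s * \<alpha>) * s) * (h x * g x) + (exp (s * \<alpha>) * (q - s * \<alpha>)) * h x) y"
    proof (rule L_mono)
      fix x
      have "\<bar>g x - \<alpha>\<bar> \<le> R" using gb[of x] ab[of y] R0 unfolding \<alpha>_def by linarith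
      then have sqle: "(g x - \<alpha>)\<^sup>2 \<le> R\<^sup>2" using R0 by (simp add: abs_le_square_iff[symmetric])
      have "exp (s * (g x - \<alpha>)) \<le> s * (g x - \<alpha>) + exp ((s * (g x - \<alpha>))\<^sup>2)" by (rule exp_le_add_exp_square)
      also have "exp ((s * (g x - \<alpha>))\<^sup>2) \<le> q"
        unfolding q_def power_mult_distrib using sqle by (simp add: mult_left_mono)
      finally have "exp (s * \<alpha>) * exp (s * (g x - \<alpha>)) \<le> exp (s * \<alpha>) * (s * (g x - \<alpha>) + q)"
        by (intro mult_left_mono) auto
      then have "exp (s * g x) \<le> exp (s * \<alpha>) * (s * (g x - \<alpha>) + q)"
        by (simp add: mult_exp_exp algebra_simps)
      then have "h x * exp (s * g x) \<le> h x * (exp (s * \<alpha>) * (s * (g x - \<alpha>) + q))" using h(3) by (rule mult_left_mono)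
      then show "h x * exp (s * g x) \<le> (exp (s * \<alpha>) * s) * (h x * g x) + (exp (s * \<alpha>) * (q - s * \<alpha>)) * h x"
        by (simp add: algebra_simps)
    qed
    also have "\<dots> = (exp (s * \<alpha>) * s) * (h y * \<alpha>) + (exp (s * \<alpha>) * (q - s * \<alpha>)) * h y"
      unfolding L_add L_cmult Lhg h(2) \<alpha>_def ..
    also have "\<dots> = q * (h y * exp (s * a y))" by (simp add: \<alpha>_def algebra_simps)
    finally show ?thesis .
  qed
  define B where "B = exp_sum (\<lambda>x. s * \<phi> x)"
  have sm: "(\<lambda>x. s * \<phi> x) \<in> borel_measurable borel" using \<phi>(1) by simp
  have sb: "\<bar>s * \<phi> x\<bar> \<le> \<bar>s\<bar>" for x using mult_left_mono[OF \<phi>(2)[of x], of "\<bar>s\<bar>"] by (simp add: abs_mult)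
  have Bm: "B n \<in> borel_measurable borel" and B0: "0 \<le> B n x" and Bb: "\<bar>B n x\<bar> \<le> exp \<bar>s\<bar> ^ n" for n x
    using exp_sum_props[OF sm sb] by (auto simp: B_def)
  have expm: "\<bar>exp (s * w)\<bar> \<le> exp (\<bar>s\<bar> * (R0 + 1))" if "\<bar>w\<bar> \<le> R0 + 1" for w
  proof -
    have "s * w \<le> \<bar>s * w\<bar>" by simp
    also have "\<dots> \<le> \<bar>s\<bar> * (R0 + 1)" unfolding abs_mult using that by (intro mult_left_mono) auto
    finally show ?thesis by simp
  qed
  have hew: "(\<lambda>x. h x * exp (s * w x)) \<in> borel_measurable borel" "\<bar>h x * exp (s * w x)\<bar> \<le> A * exp (\<bar>s\<bar> * (R0 + 1))"
    "supp01 (\<lambda>x. h x * exp (s * w x))"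
    if "w \<in> borel_measurable borel" "\<And>x. \<bar>w x\<bar> \<le> R0 + 1" for w x
  proof -
    show "(\<lambda>x. h x * exp (s * w x)) \<in> borel_measurable borel" using hm that(1) by measurable
    show "\<bar>h x * exp (s * w x)\<bar> \<le> A * exp (\<bar>s\<bar> * (R0 + 1))"
      unfolding abs_mult[of "h x"] by (rule mult_mono[OF hA expm[OF that(2)]]) (use bvar_nonneg[OF hD(1)] in auto)
    show "supp01 (\<lambda>x. h x * exp (s * w x))" using hD(2) by (auto simp: supp01_def)
  qed
  have int: "integrable lborel (\<lambda>x. f x * B n x)"
    if "f \<in> borel_measurable borel" "supp01 f" "\<And>x. \<bar>f x\<bar> \<le> b" for f b n
    by (rule bounded_supp01_mult_integrable[OF that Bm Bb])
  have gb1: "\<bar>g x\<bar> \<le> R0 + 1" for x using gb[of x] by linarith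
  have main: "(LBINT x. (h x * exp (s * a x)) * B n x) \<le> q ^ n * exp (\<bar>s\<bar> * (R0 + 1))" for n
  proof (induction n)
    case 0
    have hi: "integrable lborel h" by (rule bvar_integrable[OF hD(1,2)])
    have "(LBINT x. (h x * exp (s * a x)) * B 0 x) \<le> (LBINT x. h x * exp (\<bar>s\<bar> * (R0 + 1)))"
    proof (rule integral_mono)
      show "integrable lborel (\<lambda>x. h x * exp (s * a x) * B 0 x)"
        by (rule int) (use hew[OF am ab] in auto)
      fix x show "h x * exp (s * a x) * B 0 x \<le> h x * exp (\<bar>s\<bar> * (R0 + 1))"
        using expm[OF ab[of x]] h(3)[of x] by (simp add: B_def mult_left_mono)
    qed (use hi in simp)
    also have "\<dots> = exp (\<bar>s\<bar> * (R0 + 1))" using hD(4) by simp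
    finally show ?case by simp
  next
    case (Suc n)
    have "(LBINT x. (h x * exp (s * a x)) * B (Suc n) x) = (LBINT x. (h x * exp (s * g x)) * koopman (B n) x)"
    proof (rule Bochner_Integration.integral_cong[OF refl])
      fix x
      have "exp (s * a x) * exp (s * \<phi> x) = exp (s * g x)" by (simp add: mult_exp_exp a_def algebra_simps)
      then show "(h x * exp (s * a x)) * B (Suc n) x = (h x * exp (s * g x)) * koopman (B n) x"
        by (simp add: B_def mult.assoc)
    qed
    also have "\<dots> = (LBINT x. L (\<lambda>x. h x * exp (s * g x)) x * B n x)"
      by (rule L_dual[OF hew[OF gm gb1] Bm Bb, symmetric])
    also have "\<dots> \<le> (LBINT x. q * ((h x * exp (s * a x)) * B n x))"
    proof (rule integral_mono_AE)
      obtain k where "\<And>y. \<bar>L (\<lambda>x. h x * exp (s * g x)) y\<bar> \<le> k * (A * exp (\<bar>s\<bar> * (R0 + 1)))"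
        using L_bounded_dual hew[OF gm gb1] by blast
      then show "integrable lborel (\<lambda>x. L (\<lambda>x. h x * exp (s * g x)) x * B n x)"
        by (intro int L_supp01 L_measurable[OF hew[OF gm gb1]])
      show "integrable lborel (\<lambda>x. q * ((h x * exp (s * a x)) * B n x))"
        by (intro integrable_mult_right int) (use hew[OF am ab] in auto)
      have "AE x in lborel. x \<notin> ?X"
        using finX by (intro AE_discrete_difference) (auto simp: countable_finite)
      then show "AE x in lborel. L (\<lambda>x. h x * exp (s * g x)) x * B n x \<le> q * ((h x * exp (s * a x)) * B n x)"
      proof eventually_elim
        case (elim x)
        show ?case using mult_right_mono[OF super[OF elim] B0[of n x]] by (simp add: mult.assoc)
      qed
    qed
    also have "\<dots> = q * (LBINT x. (h x * exp (s * a x)) * B n x)" by simp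
    also have "\<dots> \<le> q * (q ^ n * exp (\<bar>s\<bar> * (R0 + 1)))" using Suc by (intro mult_left_mono) (auto simp: q_def)
    finally show ?case by (simp add: mult.assoc)
  qed
  have "(LBINT x. h x * B n x) \<le> (LBINT x. exp (\<bar>s\<bar> * (R0 + 1)) * ((h x * exp (s * a x)) * B n x))"
  proof (rule integral_mono)
    show "integrable lborel (\<lambda>x. h x * B n x)" by (rule int[OF hm hD(2) hA])
    show "integrable lborel (\<lambda>x. exp (\<bar>s\<bar> * (R0 + 1)) * ((h x * exp (s * a x)) * B n x))"
      by (intro integrable_mult_right int) (use hew[OF am ab] in auto)
    fix x
    have "\<bar>- a x\<bar> \<le> R0 + 1" using ab[of x] by simp
    from expm[OF this] have "exp (- (s * a x)) \<le> exp (\<bar>s\<bar> * (R0 + 1))" by simp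
    then have "exp (s * a x) * exp (- (s * a x)) \<le> exp (s * a x) * exp (\<bar>s\<bar> * (R0 + 1))" by (intro mult_left_mono) auto
    then have "1 \<le> exp (\<bar>s\<bar> * (R0 + 1)) * exp (s * a x)" by (simp add: mult_exp_exp mult.commute)
    then have "h x * B n x * 1 \<le> h x * B n x * (exp (\<bar>s\<bar> * (R0 + 1)) * exp (s * a x))"
      using h(3)[of x] B0[of n x] by (intro mult_left_mono) auto
    then show "h x * B n x \<le> exp (\<bar>s\<bar> * (R0 + 1)) * ((h x * exp (s * a x)) * B n x)" by (simp add: mult_ac)
  qed
  also have "\<dots> \<le> exp (\<bar>s\<bar> * (R0 + 1)) * (q ^ n * exp (\<bar>s\<bar> * (R0 + 1)))"
    using main[of n] by (simp add: mult_left_mono)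
  also have "\<dots> = exp (2 * \<bar>s\<bar> * (R0 + 1) + real n * s\<^sup>2 * R\<^sup>2)"
    unfolding q_def exp_of_nat_mult[symmetric] mult_exp_exp by (simp add: algebra_simps)
  also have "\<dots> \<le> exp (2 * \<bar>s\<bar> * R + real n * s\<^sup>2 * R\<^sup>2)"
    using R0 by (simp add: mult_left_mono)
  finally show ?thesis by (simp add: B_def)
qed


section \<open>Stationary measures\<close>

lemma unit_borel_measurable:
  assumes "sets \<mu> = sets unit_borel"
  shows "space \<mu> = {0..1}" "f \<in> borel_measurable borel \<Longrightarrow> f \<in> borel_measurable \<mu>" "T \<omega> \<in> measurable \<mu> \<mu>"
proof -
  show sp: "space \<mu> = {0..1}" using sets_eq_imp_space_eq[OF assms] by (simp add: unit_borel_def space_restrict_space)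
  show "f \<in> borel_measurable \<mu>" if "f \<in> borel_measurable borel"
    unfolding measurable_cong_sets[OF assms refl] unit_borel_def by (rule measurable_restrict_space1[OF that])
  have "T \<omega> \<in> measurable unit_borel unit_borel"
    unfolding unit_borel_def by (rule measurable_restrict_space3[OF expandingD(5)[OF expanding]]) (use expandingD(6)[OF expanding] in auto)
  then show "T \<omega> \<in> measurable \<mu> \<mu>" unfolding measurable_cong_sets[OF assms assms] .
qed

text \<open>Stationarity for sets says that \<open>\<mu>\<close> is the image of the product of \<open>p\<close> and \<open>\<mu>\<close> under the random
map; in this form it passes to functions.\<close>

lemma stationary_koopman:
  assumes ps: "prob_space \<mu>" and sets: "sets \<mu> = sets unit_borel" and st: "stationary p T \<mu>"
    and u: "u \<in> borel_measurable borel" "\<And>x. \<bar>u x\<bar> \<le> U"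
  shows "(\<integral>x. koopman u x \<partial>\<mu>) = (\<integral>x. u x \<partial>\<mu>)"
proof -
  interpret \<mu>: prob_space \<mu> by fact
  interpret pair: pair_prob_space "measure_pmf p" \<mu> by unfold_locales
  note m = unit_borel_measurable[OF sets]
  let ?Q = "measure_pmf p \<Otimes>\<^sub>M \<mu>"
  let ?F = "\<lambda>z. T (fst z) (snd z)"
  have F: "?F \<in> measurable ?Q \<mu>"
  proof (rule measurable_compose_countable)
    show "(\<lambda>x. T i (snd x)) \<in> measurable ?Q \<mu>" for i by (rule measurable_compose[OF measurable_snd m(3)])
    show "fst \<in> measurable ?Q (count_space UNIV)"
      using measurable_fst[of "measure_pmf p" \<mu>] by simp
  qed
  have eq: "distr ?Q \<mu> ?F = \<mu>"
  proof (rule measure_eqI)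
    fix A assume "A \<in> sets (distr ?Q \<mu> ?F)"
    then have A: "A \<in> sets \<mu>" by simp
    have TA: "T \<omega> -` A \<inter> {0..1} \<in> sets \<mu>" for \<omega> using measurable_sets[OF m(3) A] m(1) by simp
    have "emeasure (distr ?Q \<mu> ?F) A = emeasure ?Q (?F -` A \<inter> space ?Q)" by (rule emeasure_distr[OF F A])
    also have "\<dots> = (\<integral>\<^sup>+\<omega>. emeasure \<mu> (Pair \<omega> -` (?F -` A \<inter> space ?Q)) \<partial>measure_pmf p)"
      by (rule \<mu>.emeasure_pair_measure_alt[OF measurable_sets[OF F A]])
    also have "\<dots> = (\<integral>\<^sup>+\<omega>. emeasure \<mu> (T \<omega> -` A \<inter> {0..1}) \<partial>measure_pmf p)"
      by (intro nn_integral_cong arg_cong[where f = "emeasure \<mu>"]) (auto simp: space_pair_measure m(1))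
    also have "\<dots> = (\<Sum>\<omega>\<in>set_pmf p. emeasure \<mu> (T \<omega> -` A \<inter> {0..1}) * pmf p \<omega>)"
      by (rule nn_integral_measure_pmf_finite) auto
    also have "set_pmf p = UNIV" using p_pos by (auto simp: set_pmf_iff) (metis less_irrefl)
    also have "(\<Sum>\<omega>\<in>UNIV. emeasure \<mu> (T \<omega> -` A \<inter> {0..1}) * pmf p \<omega>)
        = ennreal (\<Sum>\<omega>\<in>UNIV. pmf p \<omega> * measure \<mu> (T \<omega> -` A \<inter> {0..1}))"
      by (subst sum_ennreal[symmetric]) (auto simp: \<mu>.emeasure_eq_measure ennreal_mult' mult.commute)
    also have "\<dots> = emeasure \<mu> A"
      using st A sets by (auto simp: stationary_def \<mu>.emeasure_eq_measure)
    finally show "emeasure (distr ?Q \<mu> ?F) A = emeasure \<mu> A" .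
  qed simp
  have um: "u \<in> borel_measurable \<mu>" by (rule m(2)[OF u(1)])
  have uF: "(\<lambda>z. u (?F z)) \<in> borel_measurable ?Q" by (rule measurable_compose[OF F um])
  have int: "integrable ?Q (\<lambda>z. u (?F z))"
    by (rule pair.P.integrable_const_bound[where B = U, OF AE_I2 uF]) (use u(2) in simp)
  have intT: "integrable \<mu> (\<lambda>x. u (T \<omega> x))" for \<omega>
    by (rule \<mu>.integrable_const_bound[where B = U, OF AE_I2 measurable_compose[OF m(3) um]]) (use u(2) in simp)
  have "(\<integral>x. u x \<partial>\<mu>) = (\<integral>x. u x \<partial>distr ?Q \<mu> ?F)" unfolding eq ..
  also have "\<dots> = (\<integral>z. u (?F z) \<partial>?Q)" by (rule integral_distr[OF F um])
  also have "\<dots> = (\<integral>\<omega>. (\<integral>x. u (T \<omega> x) \<partial>\<mu>) \<partial>measure_pmf p)" using pair.integral_fst'[OF int] by simp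
  also have "\<dots> = (\<Sum>\<omega>\<in>UNIV. (\<integral>x. u (T \<omega> x) \<partial>\<mu>) * pmf p \<omega>)"
    by (rule integral_measure_pmf_real) auto
  also have "\<dots> = (\<integral>x. koopman u x \<partial>\<mu>)"
    unfolding koopman_def using intT by (simp add: mult.commute)
  finally show ?thesis ..
qed

text \<open>The Radon-Nikodym density of \<open>\<mu>\<close> is merely integrable, but it is stationary and hence
indistinguishable from \<open>h\<close>.\<close>

lemma stationary_integral:
  assumes ac: "ac_stationary_prob p T \<mu>" and h: "bv_density A h" "L h = h"
    and u: "u \<in> borel_measurable borel" "\<And>x. \<bar>u x\<bar> \<le> U"
  shows "(\<integral>x. u x \<partial>\<mu>) = (LBINT x. h x * u x)"
proof -
  have ps: "prob_space \<mu>" and sets: "sets \<mu> = sets unit_borel" and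
    acl: "absolutely_continuous unit_lebesgue \<mu>" and st: "stationary p T \<mu>"
    using ac by (auto simp: ac_stationary_prob_def)
  interpret \<mu>: prob_space \<mu> by fact
  note m = unit_borel_measurable[OF sets]
  have s2: "sets unit_lebesgue = sets unit_borel"
    by (simp add: unit_lebesgue_def unit_borel_def sets_restrict_space)
  have "finite_measure unit_lebesgue"
    by (rule finite_measureI) (simp add: unit_lebesgue_def emeasure_restrict_space space_restrict_space)
  then interpret leb: finite_measure unit_lebesgue .
  have s3: "sets \<mu> = sets unit_lebesgue" using sets s2 by simp
  obtain D where D: "D \<in> borel_measurable unit_lebesgue" "AE x in unit_lebesgue. RN_deriv unit_lebesgue \<mu> x = ennreal (D x)"
    "\<And>x. 0 \<le> D x"
    using leb.real_RN_deriv[OF \<mu>.finite_measure_axioms acl s3] by metis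
  have dens: "density unit_lebesgue (\<lambda>x. ennreal (D x)) = \<mu>"
  proof -
    have "density unit_lebesgue (\<lambda>x. ennreal (D x)) = density unit_lebesgue (RN_deriv unit_lebesgue \<mu>)"
      by (rule density_cong) (use D in auto)
    then show ?thesis using leb.density_RN_deriv[OF acl s3] by simp
  qed
  define h0 where "h0 x = indicator {0..1} x * D x" for x
  have h0m: "h0 \<in> borel_measurable borel"
    using D(1) borel_measurable_restrict_space_iff[of "{0..1}" lborel D]
    by (simp add: unit_lebesgue_def h0_def[abs_def])
  have intD: "integrable unit_lebesgue D"
    using integrable_density[of "\<lambda>x. 1::real" unit_lebesgue D] D(1,3) dens by simp
  have int0: "integrable lborel h0"
    using intD integrable_restrict_space[of "{0..1}" lborel D] by (simp add: unit_lebesgue_def h0_def[abs_def])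
  have I: "(\<integral>x. v x \<partial>\<mu>) = (LBINT x. h0 x * v x)" if v: "v \<in> borel_measurable borel" for v :: "real \<Rightarrow> real"
  proof -
    have vm: "v \<in> borel_measurable unit_lebesgue"
      using m(2)[OF v] measurable_cong_sets[OF s3 refl] by blast
    have "(\<integral>x. v x \<partial>\<mu>) = (\<integral>x. v x \<partial>density unit_lebesgue (\<lambda>x. ennreal (D x)))" unfolding dens ..
    also have "\<dots> = (\<integral>x. D x *\<^sub>R v x \<partial>unit_lebesgue)" by (rule integral_density[OF vm D(1)]) (use D(3) in simp)
    also have "\<dots> = (LBINT x. indicator {0..1} x *\<^sub>R (D x *\<^sub>R v x))"
      unfolding unit_lebesgue_def by (rule integral_restrict_space) simp
    finally show ?thesis by (simp add: h0_def mult.assoc)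
  qed
  have "(LBINT x. h0 x * u x) = (LBINT x. h x * u x)"
  proof (rule stationary_density_unique[OF h int0 _ _ _ u])
    show "supp01 h0" by (auto simp: supp01_def h0_def)
    show "(LBINT x. h0 x) = 1" using I[of "\<lambda>x. 1"] by (simp add: \<mu>.prob_space)
    fix v :: "real \<Rightarrow> real" and V assume v: "v \<in> borel_measurable borel" "\<And>x. \<bar>v x\<bar> \<le> V"
    show "(LBINT x. h0 x * koopman v x) = (LBINT x. h0 x * v x)"
      using stationary_koopman[OF ps sets st v] I[OF v(1)] I[OF koopman_measurable[OF v(1)]] by simp
  qed
  then show ?thesis using I[OF u(1)] by simp
qed

section \<open>Birkhoff sums along random orbits\<close>

definition birkhoff :: "(real \<Rightarrow> real) \<Rightarrow> nat \<Rightarrow> real \<Rightarrow> (nat \<Rightarrow> 'w) \<Rightarrow> real" where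
  "birkhoff f n x w = (\<Sum>j<n. f (random_iterate T w j x))"

lemma orbit_measurable:
  assumes "(\<lambda>x::real. x) \<in> borel_measurable N"
  shows "(\<lambda>z. random_iterate T (snd z) j (fst z)) \<in> borel_measurable (N \<Otimes>\<^sub>M sequence_measure p)"
proof (induction j)
  case 0
  have "fst \<in> borel_measurable (N \<Otimes>\<^sub>M sequence_measure p)" using measurable_compose[OF measurable_fst assms] .
  then show ?case by simp
next
  case (Suc j)
  have "(\<lambda>z. T (snd z j) (random_iterate T (snd z) j (fst z))) \<in> borel_measurable (N \<Otimes>\<^sub>M sequence_measure p)"
  proof (rule measurable_compose_countable[where f = "\<lambda>i z. T i (random_iterate T (snd z) j (fst z))" and g = "\<lambda>z. snd z j"])
    show "(\<lambda>z. T i (random_iterate T (snd z) j (fst z))) \<in> borel_measurable (N \<Otimes>\<^sub>M sequence_measure p)" for i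
      by (rule measurable_compose[OF Suc expandingD(5)[OF expanding]])
    have "(\<lambda>w. w j) \<in> measurable (sequence_measure p) (measure_pmf p)"
      unfolding sequence_measure_def by (rule measurable_component_singleton) simp
    then have "(\<lambda>z. snd z j) \<in> measurable (N \<Otimes>\<^sub>M sequence_measure p) (measure_pmf p)"
      by (rule measurable_compose[OF measurable_snd])
    then show "(\<lambda>z. snd z j) \<in> measurable (N \<Otimes>\<^sub>M sequence_measure p) (count_space UNIV)" by simp
  qed
  then show ?case by simp
qed

lemma random_iterate_shift:
  "random_iterate T (case_nat \<omega> w) (Suc j) x = random_iterate T w j (T \<omega> x)"
  by (induction j) auto

lemma birkhoff_shift: "birkhoff f (Suc n) x (case_nat \<omega> w) = f x + birkhoff f n (T \<omega> x) w"
  unfolding birkhoff_def sum.lessThan_Suc_shift by (simp add: random_iterate_shift del: random_iterate.simps(2))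

lemma prob_space_sequence: "prob_space (sequence_measure p)"
  unfolding sequence_measure_def by (intro prob_space_PiM measure_pmf.prob_space_axioms)

lemma birkhoff_measurable:
  assumes "(\<lambda>x::real. x) \<in> borel_measurable N" "f \<in> borel_measurable borel"
  shows "(\<lambda>z. birkhoff f n (fst z) (snd z)) \<in> borel_measurable (N \<Otimes>\<^sub>M sequence_measure p)"
  unfolding birkhoff_def by (intro borel_measurable_sum measurable_compose[OF orbit_measurable[OF assms(1)] assms(2)])

lemma birkhoff_measurable_word:
  assumes "f \<in> borel_measurable borel"
  shows "(\<lambda>w. birkhoff f n x w) \<in> borel_measurable (sequence_measure p)"
proof -
  have "(\<lambda>w. (x, w)) \<in> measurable (sequence_measure p) (borel \<Otimes>\<^sub>M sequence_measure p)" by simp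
  from measurable_compose[OF this birkhoff_measurable[OF _ assms]] show ?thesis by simp
qed

text \<open>Splitting off the first symbol turns the product measure on sequences into the recursion that defines
\<open>exp_sum\<close>.\<close>

lemma nn_integral_exp_birkhoff:
  assumes f: "f \<in> borel_measurable borel" "\<And>x. \<bar>f x\<bar> \<le> b"
  shows "(\<integral>\<^sup>+w. ennreal (exp (birkhoff f n x w)) \<partial>sequence_measure p) = ennreal (exp_sum f n x)"
proof (induction n arbitrary: x)
  case 0
  interpret P: prob_space "sequence_measure p" by (rule prob_space_sequence)
  show ?case by (simp add: birkhoff_def P.emeasure_space_1)
next
  case (Suc n)
  let ?P = "sequence_measure p"
  interpret seq: sequence_space "measure_pmf p" by unfold_locales
  interpret P: prob_space ?P by (rule prob_space_sequence)
  let ?c = "\<lambda>(\<omega>, w). case_nat \<omega> w :: nat \<Rightarrow> 'w"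
  have iter: "distr (measure_pmf p \<Otimes>\<^sub>M ?P) ?P ?c = ?P" using seq.PiM_iter unfolding sequence_measure_def .
  have cm: "?c \<in> measurable (measure_pmf p \<Otimes>\<^sub>M ?P) ?P"
    unfolding sequence_measure_def case_prod_unfold by (intro measurable_case_nat' measurable_fst measurable_snd)
  have em: "(\<lambda>w. ennreal (exp (birkhoff f k y w))) \<in> borel_measurable ?P" for k y
    using birkhoff_measurable_word[OF f(1)] by simp
  have em2: "(\<lambda>z. ennreal (exp (birkhoff f (Suc n) x (?c z)))) \<in> borel_measurable (measure_pmf p \<Otimes>\<^sub>M ?P)"
    by (rule measurable_compose[OF cm em])
  have e0: "0 \<le> exp_sum f n y" for y by (rule exp_sum_props(2)[OF f])
  have "(\<integral>\<^sup>+w. ennreal (exp (birkhoff f (Suc n) x w)) \<partial>?P)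
      = (\<integral>\<^sup>+w. ennreal (exp (birkhoff f (Suc n) x w)) \<partial>distr (measure_pmf p \<Otimes>\<^sub>M ?P) ?P ?c)" unfolding iter ..
  also have "\<dots> = (\<integral>\<^sup>+z. ennreal (exp (birkhoff f (Suc n) x (?c z))) \<partial>(measure_pmf p \<Otimes>\<^sub>M ?P))"
    by (rule nn_integral_distr[OF cm]) (use em in simp)
  also have "\<dots> = (\<integral>\<^sup>+\<omega>. \<integral>\<^sup>+w. ennreal (exp (birkhoff f (Suc n) x (case_nat \<omega> w))) \<partial>?P \<partial>measure_pmf p)"
    using P.nn_integral_fst[OF em2] by simp
  also have "\<dots> = (\<integral>\<^sup>+\<omega>. ennreal (exp (f x) * exp_sum f n (T \<omega> x)) \<partial>measure_pmf p)"
  proof (rule nn_integral_cong)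
    fix \<omega>
    have "(\<integral>\<^sup>+w. ennreal (exp (birkhoff f (Suc n) x (case_nat \<omega> w))) \<partial>?P)
        = (\<integral>\<^sup>+w. ennreal (exp (f x)) * ennreal (exp (birkhoff f n (T \<omega> x) w)) \<partial>?P)"
      unfolding birkhoff_shift by (simp add: exp_add ennreal_mult)
    also have "\<dots> = ennreal (exp (f x)) * ennreal (exp_sum f n (T \<omega> x))"
      by (subst nn_integral_cmult[OF em]) (simp only: Suc)
    also have "\<dots> = ennreal (exp (f x) * exp_sum f n (T \<omega> x))" using e0 by (simp add: ennreal_mult)
    finally show "(\<integral>\<^sup>+w. ennreal (exp (birkhoff f (Suc n) x (case_nat \<omega> w))) \<partial>?P)
        = ennreal (exp (f x) * exp_sum f n (T \<omega> x))" .
  qed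
  also have "\<dots> = (\<Sum>\<omega>\<in>set_pmf p. ennreal (exp (f x) * exp_sum f n (T \<omega> x)) * pmf p \<omega>)"
    by (rule nn_integral_measure_pmf_finite) auto
  also have "set_pmf p = UNIV" using p_pos by (auto simp: set_pmf_iff) (metis less_irrefl)
  also have "(\<Sum>\<omega>\<in>UNIV. ennreal (exp (f x) * exp_sum f n (T \<omega> x)) * pmf p \<omega>)
      = (\<Sum>\<omega>\<in>UNIV. ennreal (exp (f x) * exp_sum f n (T \<omega> x) * pmf p \<omega>))"
    using e0 by (intro sum.cong refl) (simp add: ennreal_mult)
  also have "\<dots> = ennreal (\<Sum>\<omega>\<in>UNIV. exp (f x) * exp_sum f n (T \<omega> x) * pmf p \<omega>)"
    using e0 by (intro sum_ennreal) simp
  also have "(\<Sum>\<omega>\<in>UNIV. exp (f x) * exp_sum f n (T \<omega> x) * pmf p \<omega>) = exp_sum f (Suc n) x"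
    by (simp add: koopman_def sum_distrib_left mult_ac)
  finally show ?case .
qed

lemma orbit_range: "x \<in> {0..1} \<Longrightarrow> random_iterate T w j x \<in> {0..1}"
  by (cases j) (use expandingD(6)[OF expanding] in auto)

lemma measure_empirical:
  assumes x: "x \<in> {0..1}" and n: "n \<ge> 1" and A: "A \<in> sets unit_borel"
  shows "measure (empirical_measure T n x w) A = (\<Sum>j<n. indicator A (random_iterate T w j x)) / real n"
proof -
  have sp: "space unit_borel = {0..1}" by (simp add: unit_borel_def space_restrict_space)
  have sub: "sets unit_borel \<subseteq> Pow {0..1}" using sets.space_closed[of unit_borel] sp by simp
  have sg: "sigma_sets {0..1} (sets unit_borel) = sets unit_borel" using sets.sigma_sets_eq[of unit_borel] sp by simp
  let ?r = "\<lambda>j. return unit_borel (random_iterate T w j x)"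
  let ?f = "\<lambda>A. ennreal (1 / real n) * (\<Sum>j<n. emeasure (?r j) A)"
  have se: "sets (empirical_measure T n x w) = sets unit_borel"
    unfolding empirical_measure_def using sub sg by simp
  have "emeasure (empirical_measure T n x w) A = ?f A"
  proof (rule emeasure_measure_of[OF empirical_measure_def sub])
    show "positive (sets (empirical_measure T n x w)) ?f" by (simp add: positive_def)
    show "countably_additive (sets (empirical_measure T n x w)) ?f"
      unfolding countably_additive_def se
    proof (intro allI impI)
      fix B :: "nat \<Rightarrow> real set" assume B: "range B \<subseteq> sets unit_borel" "disjoint_family B"
      have "(\<Sum>i. ?f (B i)) = ennreal (1 / real n) * (\<Sum>i. \<Sum>j<n. emeasure (?r j) (B i))" by (rule ennreal_suminf_cmult)
      also have "(\<Sum>i. \<Sum>j<n. emeasure (?r j) (B i)) = (\<Sum>j<n. \<Sum>i. emeasure (?r j) (B i))"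
        by (rule suminf_sum) simp
      also have "\<dots> = (\<Sum>j<n. emeasure (?r j) (\<Union>i. B i))"
        by (intro sum.cong refl suminf_emeasure) (use B in auto)
      finally show "(\<Sum>i. ?f (B i)) = ?f (\<Union>i. B i)" .
    qed
    show "A \<in> sets (empirical_measure T n x w)" using A se by simp
  qed
  also have "(\<Sum>j<n. emeasure (?r j) A) = ennreal (\<Sum>j<n. indicator A (random_iterate T w j x))"
  proof -
    have "emeasure (?r j) A = ennreal (indicator A (random_iterate T w j x))" for j
      using emeasure_return[OF A, of "random_iterate T w j x"] by (auto simp: indicator_def)
    then show ?thesis by (simp only:) (rule sum_ennreal, simp)
  qed
  also have "ennreal (1 / real n) * \<dots> = ennreal ((\<Sum>j<n. indicator A (random_iterate T w j x)) / real n)"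
    by (subst ennreal_mult[symmetric]) (auto intro: sum_nonneg)
  finally show ?thesis unfolding measure_def by (simp add: sum_nonneg)
qed


lemma stationary_exponential_moment:
  assumes ac: "ac_stationary_prob p T \<mu>" and f: "f \<in> borel_measurable borel" "\<And>x. \<bar>f x\<bar> \<le> b"
  shows "(\<integral>\<^sup>+z. ennreal (exp (birkhoff f n (fst z) (snd z))) \<partial>(\<mu> \<Otimes>\<^sub>M sequence_measure p))
    = ennreal (\<integral>x. exp_sum f n x \<partial>\<mu>)"
proof -
  have ps: "prob_space \<mu>" and sets: "sets \<mu> = sets unit_borel" using ac by (auto simp: ac_stationary_prob_def)
  interpret \<mu>: prob_space \<mu> by fact
  interpret P: prob_space "sequence_measure p" by (rule prob_space_sequence)
  note m = unit_borel_measurable[OF sets]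
  note e = exp_sum_props[OF f]
  have "(\<lambda>z. ennreal (exp (birkhoff f n (fst z) (snd z)))) \<in> borel_measurable (\<mu> \<Otimes>\<^sub>M sequence_measure p)"
    using birkhoff_measurable[OF m(2) f(1)] by simp
  from P.nn_integral_fst[OF this]
  have "(\<integral>\<^sup>+z. ennreal (exp (birkhoff f n (fst z) (snd z))) \<partial>(\<mu> \<Otimes>\<^sub>M sequence_measure p))
      = (\<integral>\<^sup>+x. ennreal (exp_sum f n x) \<partial>\<mu>)"
    by (simp add: nn_integral_exp_birkhoff[OF f])
  also have "\<dots> = ennreal (\<integral>x. exp_sum f n x \<partial>\<mu>)"
  proof (rule nn_integral_eq_integral)
    show "integrable \<mu> (exp_sum f n)"
      by (rule \<mu>.integrable_const_bound[where B = "exp b ^ n", OF AE_I2 m(2)[OF e(1)]]) (use e(3) in simp)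
  qed (use e(2) in simp)
  finally show ?thesis .
qed

text \<open>The indicator of \<open>(-\<infinity>, t]\<close> times \<open>h\<close> has variation at most \<open>2 A\<close> and the centring term at most
\<open>A\<close>, whatever \<open>t\<close> is. This is why one constant \<open>R\<close> serves for all \<open>t\<close>. The half line may replace
\<open>[0, t]\<close> because orbits stay in the unit interval.\<close>

lemma distribution_function_moment:
  assumes ac: "ac_stationary_prob p T \<mu>"
  obtains F R where "1 \<le> R" "mono F" "\<And>t. 0 \<le> F t \<and> F t \<le> 1" "\<And>t. t \<in> {0..1} \<Longrightarrow> measure \<mu> {0..t} = F t"
    "\<And>s t n. (\<integral>\<^sup>+z. ennreal (exp (s * birkhoff (\<lambda>x. indicator {..t} x - F t) n (fst z) (snd z)))
        \<partial>(\<mu> \<Otimes>\<^sub>M sequence_measure p)) \<le> ennreal (exp (2 * \<bar>s\<bar> * R + real n * s\<^sup>2 * R\<^sup>2))"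
proof -
  have ps: "prob_space \<mu>" and sets: "sets \<mu> = sets unit_borel" using ac by (auto simp: ac_stationary_prob_def)
  interpret \<mu>: prob_space \<mu> by fact
  obtain h A c where h: "0 < c" "bv_density A h" "L h = h" "\<forall>x. 0 \<le> h x" "ess_ge {0..1} c h"
    using invariant_density by blast
  note hD = bv_densityD[OF h(2)]
  obtain E r where dec: "decays E r" using exponential_decay by blast
  then have E: "0 \<le> E" "r < 1" by (auto simp: decays_def)
  have hi: "integrable lborel h" by (rule bvar_integrable[OF hD(1,2)])
  have A0: "0 \<le> A" by (rule bvar_nonneg[OF hD(1)])
  define F where "F t = (LBINT x. indicator {..t} x * h x)" for t :: real
  have hit: "integrable lborel (\<lambda>x. indicator {..t} x * h x)" for t
    using integrable_mult_indicator[OF _ hi, of "{..t}"] by simp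
  have Fmono: "mono F"
  proof (rule monoI)
    fix t u :: real assume "t \<le> u"
    then show "F t \<le> F u" unfolding F_def
      by (intro integral_mono hit) (use h(4) in \<open>auto simp: indicator_def\<close>)
  qed
  have F01: "0 \<le> F t \<and> F t \<le> 1" for t
  proof
    show "0 \<le> F t" unfolding F_def using h(4) by (intro integral_nonneg_AE) (auto simp: indicator_def)
    have "F t \<le> (LBINT x. h x)" unfolding F_def
      by (intro integral_mono hit hi) (use h(4) in \<open>auto simp: indicator_def\<close>)
    then show "F t \<le> 1" using hD(4) by simp
  qed
  have \<mu>F: "measure \<mu> {0..t} = F t" if t: "t \<in> {0..1}" for t
  proof -
    have "{0..t} \<in> sets \<mu>" unfolding sets unit_borel_def sets_restrict_space
      by (rule image_eqI[of _ _ "{0..t}"]) (use t in auto)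
    then have "measure \<mu> {0..t} = (\<integral>x. indicator {0..t} x \<partial>\<mu>)" by simp
    also have "\<dots> = (LBINT x. h x * indicator {0..t} x)"
      by (rule stationary_integral[OF ac h(2,3), where U = 1]) (auto simp: indicator_def)
    also have "\<dots> = F t" unfolding F_def
      by (rule Bochner_Integration.integral_cong) (use hD(2) in \<open>auto simp: indicator_def supp01_def\<close>)
    finally show ?thesis .
  qed
  define V where "V = 3 * A + 1"
  define R where "R = 2 * (E * V / (1 - r) / c) + 1"
  have "0 \<le> E * V / (1 - r) / c" using E h(1) A0 by (simp add: V_def)
  then have R1: "1 \<le> R" by (simp add: R_def)
  show thesis
  proof (rule that[OF R1 Fmono F01 \<mu>F])
    fix s t :: real and n
    let ?\<phi> = "\<lambda>x. indicator {..t} x - F t"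
    have pm: "?\<phi> \<in> borel_measurable borel" by measurable
    have pb: "\<bar>?\<phi> x\<bar> \<le> 1" for x using F01[of t] by (auto simp: indicator_def)
    have "bvar (\<lambda>x. indicator {..t} x * h x + (- F t) * h x) (2 * A + \<bar>- F t\<bar> * A)"
      by (intro bvar_add bvar_restrict_atMost bvar_cmult hD)
    then have "bvar (\<lambda>x. ?\<phi> x * h x) (2 * A + \<bar>- F t\<bar> * A)" by (simp add: left_diff_distrib)
    moreover have "2 * A + \<bar>- F t\<bar> * A \<le> V"
      using mult_right_mono[of "F t" 1 A] F01[of t] A0 by (simp add: V_def)
    ultimately have pv: "bvar (\<lambda>x. ?\<phi> x * h x) V" by (rule bvar_mono)
    have "(LBINT x. ?\<phi> x * h x) = (LBINT x. indicator {..t} x * h x - F t * h x)"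
      by (simp add: left_diff_distrib)
    also have "\<dots> = F t - F t * 1" using hit[of t] hi hD(4) by (simp add: F_def)
    finally have pz: "(LBINT x. ?\<phi> x * h x) = 0" by simp
    have V0: "0 < V" using A0 by (simp add: V_def)
    have sm: "(\<lambda>x. s * ?\<phi> x) \<in> borel_measurable borel" using pm by simp
    have sb: "\<bar>s * ?\<phi> x\<bar> \<le> \<bar>s\<bar>" for x using mult_left_mono[OF pb[of x], of "\<bar>s\<bar>"] by (simp add: abs_mult)
    have bs: "s * birkhoff ?\<phi> n x w = birkhoff (\<lambda>x. s * ?\<phi> x) n x w" for x w
      unfolding birkhoff_def by (rule sum_distrib_left)
    have "(\<integral>\<^sup>+z. ennreal (exp (s * birkhoff ?\<phi> n (fst z) (snd z))) \<partial>(\<mu> \<Otimes>\<^sub>M sequence_measure p))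
        = ennreal (\<integral>x. exp_sum (\<lambda>x. s * ?\<phi> x) n x \<partial>\<mu>)"
      unfolding bs by (rule stationary_exponential_moment[OF ac sm sb])
    also have "(\<integral>x. exp_sum (\<lambda>x. s * ?\<phi> x) n x \<partial>\<mu>) = (LBINT x. h x * exp_sum (\<lambda>x. s * ?\<phi> x) n x)"
      by (rule stationary_integral[OF ac h(2,3) exp_sum_props(1,3)[OF sm sb]])
    also have "\<dots> \<le> exp (2 * \<bar>s\<bar> * R + real n * s\<^sup>2 * R\<^sup>2)" unfolding R_def
      by (rule exponential_moment[OF h(2,3) _ h(1,5) dec pm pb V0 pv pz]) (use h(4) in blast)
    finally show "(\<integral>\<^sup>+z. ennreal (exp (s * birkhoff ?\<phi> n (fst z) (snd z))) \<partial>(\<mu> \<Otimes>\<^sub>M sequence_measure p))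
        \<le> ennreal (exp (2 * \<bar>s\<bar> * R + real n * s\<^sup>2 * R\<^sup>2))" by (simp add: ennreal_leI)
  qed
qed

text \<open>For \<open>z = (x, w)\<close> the Kantorovich distance is the mean of \<open>\<bar>S \<tau> z\<bar> / n\<close> over \<open>\<tau>\<close> in the unit interval,
so Jensen's inequality bounds its exponential by the mean \<open>\<Phi> z\<close> of \<open>exp (s \<bar>S \<tau> z\<bar>)\<close>. By
Tonelli's theorem the expectation of \<open>\<Phi>\<close> inherits the uniform bound for fixed \<open>\<tau>\<close>. The event
itself is only compared with a measurable superset.\<close>

theorem empirical_concentration:
  assumes ac: "ac_stationary_prob p T \<mu>"
  shows "\<exists>t0>0. \<exists>C>0. \<forall>t>t0. \<forall>n\<ge>1.
    measure (\<mu> \<Otimes>\<^sub>M sequence_measure p)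
      {(x, w) \<in> space (\<mu> \<Otimes>\<^sub>M sequence_measure p).
         kantorovich (empirical_measure T n x w) \<mu> > t / sqrt (real n)}
    \<le> exp (- C * t\<^sup>2)"
proof -
  have ps: "prob_space \<mu>" and sets: "sets \<mu> = sets unit_borel" using ac by (auto simp: ac_stationary_prob_def)
  note m = unit_borel_measurable[OF sets]
  let ?M = "\<mu> \<Otimes>\<^sub>M sequence_measure p" and ?U = unit_lebesgue
  interpret \<mu>: prob_space \<mu> by fact
  interpret P: prob_space "sequence_measure p" by (rule prob_space_sequence)
  interpret pair: pair_prob_space \<mu> "sequence_measure p" by unfold_locales
  interpret U: prob_space ?U by (rule prob_space_unit_lebesgue)
  interpret UM: pair_prob_space ?U ?M by unfold_locales
  obtain F R where R: "1 \<le> R" and F: "mono F" "\<And>t. 0 \<le> F t \<and> F t \<le> 1" "\<And>t. t \<in> {0..1} \<Longrightarrow> measure \<mu> {0..t} = F t"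
    and mgf: "\<And>s t n. (\<integral>\<^sup>+z. ennreal (exp (s * birkhoff (\<lambda>x. indicator {..t} x - F t) n (fst z) (snd z))) \<partial>?M)
       \<le> ennreal (exp (2 * \<bar>s\<bar> * R + real n * s\<^sup>2 * R\<^sup>2))" by (rule distribution_function_moment[OF ac]) blast
  have Fm: "F \<in> borel_measurable borel" by (rule borel_measurable_mono[OF F(1)])
  have bound: "measure ?M {(x, w) \<in> space ?M. kantorovich (empirical_measure T n x w) \<mu> > t / sqrt (real n)}
      \<le> exp (- (1 / (8 * R\<^sup>2)) * t\<^sup>2)" if t: "16 * R < t" and n: "1 \<le> n" for t n
  proof -
    define S where "S \<tau> z = birkhoff (\<lambda>x. indicator {..\<tau>} x - F \<tau>) n (fst z) (snd z)" for \<tau> z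
    have t0: "0 < t" using t R by linarith
    define s where "s = t / (2 * R\<^sup>2 * sqrt (real n))"
    have s0: "0 < s" using t0 R n by (simp add: s_def)
    have Sb: "\<bar>S \<tau> z\<bar> \<le> real n" for \<tau> z
    proof -
      have "\<bar>S \<tau> z\<bar> \<le> (\<Sum>j<n. \<bar>indicator {..\<tau>} (random_iterate T (snd z) j (fst z)) - F \<tau>\<bar>)"
        unfolding S_def birkhoff_def by (rule sum_abs)
      also have "\<dots> \<le> (\<Sum>j<n. 1)" using F(2)[of \<tau>] by (intro sum_mono) (auto simp: indicator_def)
      finally show ?thesis by simp
    qed
    have Xm: "(\<lambda>q. random_iterate T (snd (snd q)) j (fst (snd q))) \<in> borel_measurable (?U \<Otimes>\<^sub>M ?M)" for j
      by (rule measurable_compose[OF measurable_snd orbit_measurable[OF m(2)]]) simp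
    have fm: "fst \<in> borel_measurable (?U \<Otimes>\<^sub>M ?M)"
      using measurable_compose[OF measurable_fst unit_lebesgue_measurable[of "\<lambda>x. x"]] by simp
    have Sm: "(\<lambda>q. S (fst q) (snd q)) \<in> borel_measurable (?U \<Otimes>\<^sub>M ?M)"
    proof -
      have "(\<lambda>q. \<Sum>j<n. (if random_iterate T (snd (snd q)) j (fst (snd q)) \<le> fst q then 1 else 0) - F (fst q))
          \<in> borel_measurable (?U \<Otimes>\<^sub>M ?M)"
        using Xm fm measurable_compose[OF fm Fm]
        by (intro borel_measurable_sum borel_measurable_diff measurable_If borel_measurable_const borel_measurable_le) auto
      then show ?thesis by (simp add: S_def birkhoff_def indicator_def of_bool_def)
    qed
    have Sz: "(\<lambda>\<tau>. S \<tau> z) \<in> borel_measurable ?U" if "z \<in> space ?M" for z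
      using measurable_compose[OF measurable_Pair2'[OF that] Sm] by simp
    have Em: "(\<lambda>q. ennreal (exp (s * \<bar>S (fst q) (snd q)\<bar>))) \<in> borel_measurable (?U \<Otimes>\<^sub>M ?M)" using Sm by simp
    define \<Phi> where "\<Phi> z = (\<integral>\<^sup>+\<tau>. ennreal (exp (s * \<bar>S \<tau> z\<bar>)) \<partial>?U)" for z
    have \<Phi>m: "\<Phi> \<in> borel_measurable ?M" unfolding \<Phi>_def[abs_def]
    proof (rule U.borel_measurable_nn_integral)
      show "case_prod (\<lambda>z \<tau>. ennreal (exp (s * \<bar>S \<tau> z\<bar>))) \<in> borel_measurable (?M \<Otimes>\<^sub>M ?U)"
        using measurable_compose[OF measurable_pair_swap' Em] by (simp add: case_prod_unfold)
    qed
    define K where "K = exp (2 * s * R + real n * s\<^sup>2 * R\<^sup>2)"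
    have "(\<integral>\<^sup>+z. \<Phi> z \<partial>?M) = (\<integral>\<^sup>+\<tau>. \<integral>\<^sup>+z. ennreal (exp (s * \<bar>S \<tau> z\<bar>)) \<partial>?M \<partial>?U)"
      unfolding \<Phi>_def using UM.Fubini[OF Em] by simp
    also have "\<dots> \<le> (\<integral>\<^sup>+\<tau>. ennreal (2 * K) \<partial>?U)"
    proof (rule nn_integral_mono)
      fix \<tau> assume \<tau>: "\<tau> \<in> space ?U"
      have S\<tau>: "(\<lambda>z. S \<tau> z) \<in> borel_measurable ?M"
        using measurable_compose[OF measurable_Pair1'[OF \<tau>] Sm] by simp
      have "(\<integral>\<^sup>+z. ennreal (exp (s * \<bar>S \<tau> z\<bar>)) \<partial>?M) \<le> (\<integral>\<^sup>+z. ennreal (exp (s * S \<tau> z)) + ennreal (exp ((- s) * S \<tau> z)) \<partial>?M)"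
      proof (rule nn_integral_mono)
        fix z
        have "exp (s * \<bar>S \<tau> z\<bar>) \<le> exp (s * S \<tau> z) + exp ((- s) * S \<tau> z)" by (cases "0 \<le> S \<tau> z") auto
        then show "ennreal (exp (s * \<bar>S \<tau> z\<bar>)) \<le> ennreal (exp (s * S \<tau> z)) + ennreal (exp ((- s) * S \<tau> z))"
          by (simp add: ennreal_plus[symmetric] ennreal_leI del: ennreal_plus)
      qed
      also have "\<dots> = (\<integral>\<^sup>+z. ennreal (exp (s * S \<tau> z)) \<partial>?M) + (\<integral>\<^sup>+z. ennreal (exp ((- s) * S \<tau> z)) \<partial>?M)"
        using S\<tau> by (intro nn_integral_add) auto
      also have "\<dots> \<le> ennreal K + ennreal K"
        using mgf[of s \<tau> n] mgf[of "- s" \<tau> n] s0 by (intro add_mono) (simp_all add: S_def K_def)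
      also have "\<dots> = ennreal (2 * K)" by (simp add: ennreal_plus[symmetric] K_def del: ennreal_plus)
      finally show "(\<integral>\<^sup>+z. ennreal (exp (s * \<bar>S \<tau> z\<bar>)) \<partial>?M) \<le> ennreal (2 * K)" .
    qed
    also have "\<dots> = ennreal (2 * K)" by (simp add: U.emeasure_space_1)
    finally have \<Phi>le: "(\<integral>\<^sup>+z. \<Phi> z \<partial>?M) \<le> ennreal (2 * K)" .
    define c where "c = exp (- (s * t * sqrt (real n)))"
    have kant: "1 \<le> ennreal c * \<Phi> z"
      if z: "z \<in> space ?M" and gt: "kantorovich (empirical_measure T n (fst z) (snd z)) \<mu> > t / sqrt (real n)" for z
    proof -
      have x: "fst z \<in> {0..1}" using z m(1) by (auto simp: space_pair_measure)
      have "kantorovich (empirical_measure T n (fst z) (snd z)) \<mu>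
          = (LBINT \<tau>. indicator {0..1} \<tau> *\<^sub>R (\<bar>S \<tau> z\<bar> / real n))"
        unfolding kantorovich_def set_lebesgue_integral_def
      proof (rule Bochner_Integration.integral_cong[OF refl])
        fix \<tau> :: real
        show "indicator {0..1} \<tau> *\<^sub>R \<bar>measure (empirical_measure T n (fst z) (snd z)) {0..\<tau>} - measure \<mu> {0..\<tau>}\<bar>
            = indicator {0..1} \<tau> *\<^sub>R (\<bar>S \<tau> z\<bar> / real n)"
        proof (cases "\<tau> \<in> {0..1}")
          case True
          have "{0..\<tau>} \<in> sets unit_borel" unfolding unit_borel_def sets_restrict_space
            by (rule image_eqI[of _ _ "{0..\<tau>}"]) (use True in auto)
          then have "measure (empirical_measure T n (fst z) (snd z)) {0..\<tau>}
              = (\<Sum>j<n. indicator {0..\<tau>} (random_iterate T (snd z) j (fst z))) / real n"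
            by (rule measure_empirical[OF x n])
          also have "(\<Sum>j<n. indicator {0..\<tau>} (random_iterate T (snd z) j (fst z)))
              = (\<Sum>j<n. indicator {..\<tau>} (random_iterate T (snd z) j (fst z)) :: real)"
            using orbit_range[OF x] by (intro sum.cong refl) (auto simp: indicator_def)
          also have "\<dots> = S \<tau> z + real n * F \<tau>" by (simp add: S_def birkhoff_def sum_subtractf)
          also have "(S \<tau> z + real n * F \<tau>) / real n - measure \<mu> {0..\<tau>} = S \<tau> z / real n"
            using n F(3)[OF True] by (simp add: add_divide_distrib)
          finally show ?thesis by simp
        qed simp
      qed
      also have "\<dots> = (\<integral>\<tau>. \<bar>S \<tau> z\<bar> / real n \<partial>?U)"
        unfolding unit_lebesgue_def by (rule integral_restrict_space[symmetric]) simp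
      also have "\<dots> = (\<integral>\<tau>. \<bar>S \<tau> z\<bar> \<partial>?U) / real n" by (rule Bochner_Integration.integral_divide_zero)
      finally have "t / sqrt (real n) < (\<integral>\<tau>. \<bar>S \<tau> z\<bar> \<partial>?U) / real n" using gt by simp
      then have "t / sqrt (real n) * real n < (\<integral>\<tau>. \<bar>S \<tau> z\<bar> \<partial>?U)" using n by (simp add: field_simps)
      moreover have "t / sqrt (real n) * real n = t * sqrt (real n)" 
      proof -
        have "t / sqrt (real n) * real n = t * (real n / sqrt (real n))" by simp
        then show ?thesis by (simp only: real_div_sqrt of_nat_0_le_iff)
      qed
      ultimately have "s * (t * sqrt (real n)) \<le> s * (\<integral>\<tau>. \<bar>S \<tau> z\<bar> \<partial>?U)" using s0 by (intro mult_left_mono) auto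
      also have "\<dots> = (\<integral>\<tau>. s * \<bar>S \<tau> z\<bar> \<partial>?U)" by simp
      finally have le: "s * t * sqrt (real n) \<le> (\<integral>\<tau>. s * \<bar>S \<tau> z\<bar> \<partial>?U)" by (simp add: mult.assoc)
      have i1: "integrable ?U (\<lambda>\<tau>. s * \<bar>S \<tau> z\<bar>)"
        by (rule U.integrable_const_bound[where B = "s * real n"])
           (use Sz[OF z] Sb s0 in \<open>auto simp: abs_mult\<close>)
      have i2: "integrable ?U (\<lambda>\<tau>. exp (s * \<bar>S \<tau> z\<bar>))"
        by (rule U.integrable_const_bound[where B = "exp (s * real n)"])
           (use Sz[OF z] Sb s0 in auto)
      have "exp (s * t * sqrt (real n)) \<le> exp (\<integral>\<tau>. s * \<bar>S \<tau> z\<bar> \<partial>?U)" using le by simp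
      also have "\<dots> \<le> (\<integral>\<tau>. exp (s * \<bar>S \<tau> z\<bar>) \<partial>?U)"
        by (rule U.jensens_inequality[where I = UNIV, OF i1 _ _ i2 exp_convex]) auto
      finally have J: "exp (s * t * sqrt (real n)) \<le> (\<integral>\<tau>. exp (s * \<bar>S \<tau> z\<bar>) \<partial>?U)" .
      have "\<Phi> z = ennreal (\<integral>\<tau>. exp (s * \<bar>S \<tau> z\<bar>) \<partial>?U)"
        unfolding \<Phi>_def by (rule nn_integral_eq_integral[OF i2]) simp
      then have "ennreal c * \<Phi> z = ennreal (c * (\<integral>\<tau>. exp (s * \<bar>S \<tau> z\<bar>) \<partial>?U))"
        by (simp add: c_def ennreal_mult')
      moreover have "1 \<le> c * (\<integral>\<tau>. exp (s * \<bar>S \<tau> z\<bar>) \<partial>?U)"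
      proof -
        have "1 = c * exp (s * t * sqrt (real n))" by (simp add: c_def exp_minus)
        also have "\<dots> \<le> c * (\<integral>\<tau>. exp (s * \<bar>S \<tau> z\<bar>) \<partial>?U)" using J by (intro mult_left_mono) (auto simp: c_def)
        finally show ?thesis .
      qed
      ultimately show ?thesis by simp
    qed
    let ?B = "{z \<in> space ?M. 1 \<le> ennreal c * \<Phi> z}"
    have Bs: "?B \<in> sets ?M" using \<Phi>m by measurable
    have "emeasure ?M ?B \<le> ennreal c * (\<integral>\<^sup>+z. \<Phi> z * indicator (space ?M) z \<partial>?M)"
      by (rule nn_integral_Markov_inequality) (use \<Phi>m in auto)
    also have "(\<integral>\<^sup>+z. \<Phi> z * indicator (space ?M) z \<partial>?M) = (\<integral>\<^sup>+z. \<Phi> z \<partial>?M)"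
      by (rule nn_integral_cong) simp
    also have "ennreal c * \<dots> \<le> ennreal c * ennreal (2 * K)" by (rule mult_left_mono[OF \<Phi>le]) simp
    also have "\<dots> = ennreal (2 * K * c)" by (simp add: ennreal_mult' c_def K_def mult.commute)
    finally have "measure ?M ?B \<le> 2 * K * c"
      unfolding pair.P.emeasure_eq_measure by (simp add: K_def c_def)
    also have "\<dots> \<le> exp (- (1 / (8 * R\<^sup>2)) * t\<^sup>2)"
      unfolding K_def c_def s_def by (rule gaussian_tail_exponent[OF R t n])
    finally have Bm: "measure ?M ?B \<le> exp (- (1 / (8 * R\<^sup>2)) * t\<^sup>2)" .
    let ?A = "{(x, w) \<in> space ?M. kantorovich (empirical_measure T n x w) \<mu> > t / sqrt (real n)}"
    have "?A \<subseteq> ?B" using kant by auto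
    then have "measure ?M ?A \<le> measure ?M ?B"
      using Bs pair.P.finite_measure_mono by blast
    then show ?thesis using Bm by linarith
  qed
  have "0 < 16 * R" "0 < 1 / (8 * R\<^sup>2)" using R by auto
  then show ?thesis using bound by blast
qed

end

section \<open>From Lasota--Yorke maps to the abstract system\<close>

text \<open>Redefining the map by zero outside the unit interval makes it Borel measurable on the line without
changing any orbit. The partition points form the exceptional set; off them the map is
differentiable, so the infimum defining \<open>min_expansion\<close> bounds the derivative from below.\<close>

lemma lasota_yorke_expanding:
  assumes ly: "lasota_yorke T" and lam: "lam \<le> min_expansion T"
  shows "\<exists>S. expanding lam S (\<lambda>x. if x \<in> {0..1} then T x else 0)"
proof -
  define T' where "T' x = (if x \<in> {0..1} then T x else 0)" for x
  obtain k a where a: "a 0 = 0" "a k = 1" "\<And>i. i < k \<Longrightarrow> a i < a (Suc i)"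
    and br: "\<And>i. i < k \<Longrightarrow> \<exists>g. C2_on (a i) (a (Suc i)) g \<and> (\<forall>x\<in>{a i<..<a (Suc i)}. T x = g x)"
    using ly unfolding lasota_yorke_def piecewise_C2_def by (metis (no_types, lifting))
  have part: "partition01 k a" using a by (auto simp: partition01_def)
  define S where "S = a ` {..k}"
  have "\<exists>g g' g''. (\<forall>x\<in>{a i<..<a (Suc i)}. T x = g x) \<and>
     (\<forall>x\<in>{a i..a (Suc i)}. (g has_real_derivative g' x) (at x within {a i..a (Suc i)})) \<and>
     (\<forall>x\<in>{a i..a (Suc i)}. (g' has_real_derivative g'' x) (at x within {a i..a (Suc i)})) \<and>
     continuous_on {a i..a (Suc i)} g''" if "i < k" for i
    using br[OF that] unfolding C2_on_def by blast
  then obtain g g' g'' where g: "\<And>i x. i < k \<Longrightarrow> x \<in> {a i<..<a (Suc i)} \<Longrightarrow> T x = g i x"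
    "\<And>i x. i < k \<Longrightarrow> x \<in> {a i..a (Suc i)} \<Longrightarrow> (g i has_real_derivative g' i x) (at x within {a i..a (Suc i)})"
    "\<And>i x. i < k \<Longrightarrow> x \<in> {a i..a (Suc i)} \<Longrightarrow> (g' i has_real_derivative g'' i x) (at x within {a i..a (Suc i)})"
    "\<And>i. i < k \<Longrightarrow> continuous_on {a i..a (Suc i)} (g'' i)" by metis
  have "\<exists>K\<ge>0. \<forall>x\<in>{a i..a (Suc i)}. \<bar>g' i x\<bar> \<le> K \<and> \<bar>g'' i x\<bar> \<le> K" if i: "i < k" for i
  proof -
    have c1: "continuous_on {a i..a (Suc i)} (g' i)" using g(3)[OF i] by (intro DERIV_continuous_on) blast
    have "bounded (g' i ` {a i..a (Suc i)})"
      by (rule compact_imp_bounded[OF compact_continuous_image[OF c1 compact_Icc]])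
    then obtain K1 where K1: "\<forall>y\<in>g' i ` {a i..a (Suc i)}. norm y \<le> K1"
      unfolding bounded_iff by blast
    have "bounded (g'' i ` {a i..a (Suc i)})"
      by (rule compact_imp_bounded[OF compact_continuous_image[OF g(4)[OF i] compact_Icc]])
    then obtain K2 where K2: "\<forall>y\<in>g'' i ` {a i..a (Suc i)}. norm y \<le> K2"
      unfolding bounded_iff by blast
    show ?thesis
      by (rule exI[of _ "max 0 (max K1 K2)"]) (use K1 K2 in \<open>force simp: le_max_iff_disj\<close>)
  qed
  then obtain K where K: "\<And>i. i < k \<Longrightarrow> 0 \<le> K i" "\<And>i x. i < k \<Longrightarrow> x \<in> {a i..a (Suc i)} \<Longrightarrow> \<bar>g' i x\<bar> \<le> K i \<and> \<bar>g'' i x\<bar> \<le> K i"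
    by metis
  have KS: "K i \<le> (\<Sum>i<k. K i)" if "i < k" for i using K(1) that by (intro member_le_sum) auto
  have S: "finite S" "0 \<in> S" "1 \<in> S" "S \<subseteq> {0..1}"
    unfolding S_def using a(1,2) partition01_range[OF part] by (auto intro: image_eqI[of _ _ 0] image_eqI[of _ _ k])
  have pc: "\<exists>i<k. x \<in> {a i<..<a (Suc i)}" if "x \<in> {0..1} - S" for x
  proof -
    have x: "0 \<le> x" "x < 1" using that S(3) by (cases "x = 1", auto)+
    obtain i where i: "i < k" "a i \<le> x" "x < a (Suc i)"
      by (rule partition01_cover[OF part x]) blast
    have "x \<noteq> a i" using that i(1) by (auto simp: S_def)
    then show ?thesis using i by auto
  qed
  have D: "(T' has_real_derivative g' i x) (at x)" "(T has_real_derivative g' i x) (at x)"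
    if i: "i < k" and x: "x \<in> {a i<..<a (Suc i)}" for i x
  proof -
    have sub: "{a i<..<a (Suc i)} \<subseteq> {0..1}"
      using partition01_range[OF part, of i] partition01_range[OF part, of "Suc i"] i by auto
    have "(g i has_real_derivative g' i x) (at x)"
      using g(2)[OF i, of x] x at_within_interior[of x "{a i..a (Suc i)}"] by auto
    then show "(T' has_real_derivative g' i x) (at x)" "(T has_real_derivative g' i x) (at x)"
      by (rule has_field_derivative_transform_within_open[OF _ open_greaterThanLessThan x];
          use g(1)[OF i] sub in \<open>force simp: T'_def\<close>)+
  qed
  have dT: "deriv T' x = g' i x" if "i < k" "x \<in> {a i<..<a (Suc i)}" for i x
    using DERIV_imp_deriv[OF D(1)[OF that]] .
  \<comment> \<open>off the partition points the index is unique, so the choice is immaterial\<close>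
  define T'' where "T'' x = g'' (SOME i. i < k \<and> x \<in> {a i<..<a (Suc i)}) x" for x
  have T'm: "T' \<in> borel_measurable borel"
  proof (rule measurable_discrete_difference[where X = S])
    have "continuous_on ({0..1} - S) T'"
    proof (rule continuous_at_imp_continuous_on, rule ballI)
      fix x assume "x \<in> {0..1} - S"
      then obtain i where "i < k" "x \<in> {a i<..<a (Suc i)}" using pc by blast
      then show "isCont T' x" using DERIV_isCont[OF D(1)] by blast
    qed
    then show "(\<lambda>x. indicator ({0..1} - S) x *\<^sub>R T' x) \<in> borel_measurable borel"
      using S(1) by (intro borel_measurable_continuous_on_indicator) (auto intro: borel_closed finite_imp_closed)
    show "countable S" using S(1) by (rule countable_finite)
    show "indicator ({0..1} - S) x *\<^sub>R T' x = T' x" if "x \<notin> S" for x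
      using that by (auto simp: T'_def indicator_def)
  qed auto
  have "expanding lam S T'" unfolding expanding_def
  proof (intro conjI exI[of _ "\<Sum>i<k. K i"] exI[of _ T''] ballI)
    show "finite S" "{0,1} \<subseteq> S" "S \<subseteq> {0..1}" using S by auto
    show "T' \<in> borel_measurable borel" by (rule T'm)
    have "T ` {0..1} \<subseteq> {0..1}" using ly unfolding lasota_yorke_def by blast
    then have "T x \<in> {0..1}" if "x \<in> {0..1}" for x using that by blast
    then show "\<forall>x. T' x \<in> {0..1}" unfolding T'_def by simp
  next
    fix x assume "x \<in> {0..1} - S"
    then have ex: "\<exists>i. i < k \<and> x \<in> {a i<..<a (Suc i)}" using pc by blast
    define i where "i = (SOME i. i < k \<and> x \<in> {a i<..<a (Suc i)})"
    have i: "i < k" "x \<in> {a i<..<a (Suc i)}" using someI_ex[OF ex] by (auto simp: i_def)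
    have xc: "x \<in> {a i..a (Suc i)}" using i(2) by auto
    show "(T' has_real_derivative deriv T' x) (at x)" using D(1)[OF i] dT[OF i] by simp
    have x01: "x \<in> {0<..<1}"
      using partition01_range[OF part, of i] partition01_range[OF part, of "Suc i"] i by auto
    have "min_expansion T \<le> \<bar>deriv T x\<bar>" unfolding min_expansion_def
    proof (rule cINF_lower)
      show "bdd_below ((\<lambda>x. \<bar>deriv T x\<bar>) ` {x \<in> {0<..<1}. T differentiable (at x)})"
        by (rule bdd_belowI[of _ 0]) auto
      show "x \<in> {x \<in> {0<..<1}. T differentiable (at x)}"
        using x01 D(2)[OF i] real_differentiable_def by blast
    qed
    then show "lam \<le> \<bar>deriv T' x\<bar>" using lam DERIV_imp_deriv[OF D(2)[OF i]] dT[OF i] by simp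
    show "\<bar>deriv T' x\<bar> \<le> (\<Sum>i<k. K i)" using K(2)[OF i(1) xc] KS[OF i(1)] dT[OF i] by simp
    have T''x: "T'' x = g'' i x" by (simp add: T''_def i_def)
    show "\<bar>T'' x\<bar> \<le> (\<Sum>i<k. K i)" using K(2)[OF i(1) xc] KS[OF i(1)] T''x by simp
    have "(g' i has_real_derivative g'' i x) (at x)"
      using g(3)[OF i(1) xc] i(2) at_within_interior[of x "{a i..a (Suc i)}"] by auto
    then show "(deriv T' has_real_derivative T'' x) (at x)" unfolding T''x
      by (rule has_field_derivative_transform_within_open[OF _ open_greaterThanLessThan i(2)])
         (simp add: dT[OF i(1)])
  qed
  then show ?thesis unfolding T'_def by blast
qed

lemma fold_eq_random_iterate:
  assumes "\<And>\<omega>. T \<omega> ` {0..1} \<subseteq> {0..1}" "x \<in> {0..1}"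
  shows "fold (\<lambda>\<omega> x. if x \<in> {0..1} then T \<omega> x else 0) (map w [0..<n]) x = random_iterate T w n x"
    and "random_iterate T w n x \<in> {0..1}"
    and "random_iterate (\<lambda>\<omega> x. if x \<in> {0..1} then T \<omega> x else 0) w n x = random_iterate T w n x"
proof -
  show r: "random_iterate T w n x \<in> {0..1}" for n
  proof (induction n)
    case (Suc n)
    then have "T (w n) (random_iterate T w n x) \<in> {0..1}" using assms(1)[of "w n"] by blast
    then show ?case by simp
  qed (use assms(2) in simp)
  show "fold (\<lambda>\<omega> x. if x \<in> {0..1} then T \<omega> x else 0) (map w [0..<n]) x = random_iterate T w n x"
  proof (induction n)
    case (Suc n) then show ?case using r[of n] by simp
  qed simp
  show "random_iterate (\<lambda>\<omega> x. if x \<in> {0..1} then T \<omega> x else 0) w n x = random_iterate T w n x"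
  proof (induction n)
    case (Suc n) then show ?case using r[of n] by simp
  qed simp
qed

theorem proposition8p6:
  fixes p :: "'w::finite pmf"
    and T :: "'w \<Rightarrow> real \<Rightarrow> real"
    and \<mu> :: "real measure"
  assumes "\<And>\<omega>. pmf p \<omega> > 0"
    and "\<And>\<omega>. lasota_yorke (T \<omega>)"
    and "\<And>\<omega>. min_expansion (T \<omega>) > 1"
    and "random_covering T"
    and "ac_stationary_prob p T \<mu>"
  shows "\<exists>t0>0. \<exists>C>0. \<forall>t>t0. \<forall>n\<ge>1.
    measure (\<mu> \<Otimes>\<^sub>M sequence_measure p)
      {(x, w) \<in> space (\<mu> \<Otimes>\<^sub>M sequence_measure p).
         kantorovich (empirical_measure T n x w) \<mu> > t / sqrt (real n)}
    \<le> exp (- C * t\<^sup>2)"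
proof -
  define T' where "T' = (\<lambda>\<omega> x. if x \<in> {0..1} then T \<omega> x else 0)"
  define lam where "lam = Min (range (\<lambda>\<omega>. min_expansion (T \<omega>)))"
  have lam: "1 < lam" "\<And>\<omega>. lam \<le> min_expansion (T \<omega>)"
    unfolding lam_def using assms(3) by auto
  have "\<exists>S. expanding lam S (T' \<omega>)" for \<omega>
    unfolding T'_def by (rule lasota_yorke_expanding[OF assms(2) lam(2)])
  then obtain S where S: "\<And>\<omega>. expanding lam (S \<omega>) (T' \<omega>)" by metis
  have T01: "T \<omega> ` {0..1} \<subseteq> {0..1}" for \<omega> using assms(2) by (auto simp: lasota_yorke_def)
  note fr = fold_eq_random_iterate[where T = T, OF T01, folded T'_def]
  interpret random_system p T' S lam
  proof
    fix I :: "real set" assume I: "is_interval I" "I \<subseteq> {0..1}" "interior I \<noteq> {}"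
    then obtain n w where n: "1 \<le> n" "random_iterate T w n ` I = {0..1}"
      using assms(4) unfolding random_covering_def by blast
    have "fold T' (map w [0..<n]) ` I = random_iterate T w n ` I"
      by (rule image_cong[OF refl]) (use fr(1) I(2) in blast)
    then show "\<exists>ws. ws \<noteq> [] \<and> fold T' ws ` I = {0..1}"
      using n by (intro exI[of _ "map w [0..<n]"]) auto
  qed (use assms(1) S lam in auto)
  have "T' \<omega> -` A \<inter> {0..1} = T \<omega> -` A \<inter> {0..1}" for \<omega> A by (auto simp: T'_def)
  then have ac: "ac_stationary_prob p T' \<mu>"
    using assms(5) by (simp add: ac_stationary_prob_def stationary_def)
  have sp: "space \<mu> = {0..1}" by (rule unit_borel_measurable(1)) (use ac in \<open>simp add: ac_stationary_prob_def\<close>)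
  have "empirical_measure T' n x w = empirical_measure T n x w" if "x \<in> {0..1}" for n x w
    unfolding empirical_measure_def by (simp only: fr(3)[OF that])
  then have eq: "{(x, w) \<in> space (\<mu> \<Otimes>\<^sub>M sequence_measure p). kantorovich (empirical_measure T n x w) \<mu> > b}
      = {(x, w) \<in> space (\<mu> \<Otimes>\<^sub>M sequence_measure p). kantorovich (empirical_measure T' n x w) \<mu> > b}" for n b
    by (auto simp: space_pair_measure sp)
  show ?thesis unfolding eq by (rule empirical_concentration[OF ac])
qed

end
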